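(* Let $G \subseteq \mathbb{N}$ be non-empty and let $F = \langle W, (R_\alpha)_{\alpha \in G}\rangle$ be an $\mathcal{L}_-$-agency-frame for $G$. Let $f \in \mathrm{Val}_F$ be an evaluation function such that for all $w \in W$ there is an $\mathcal{L}$-system $S_w \vdash \mathsf{DCB}$ with $f(w) = \{\mathrm{gc}(\sigma) \mid S_w \vdash \sigma\}$. (a) If $R_\alpha$ is reflexive for all $\alpha \in G$, then for each finite $\Phi \subseteq \mathsf{KT} + \mathsf{UBF} + \mathsf{IA}$ there is $m < \omega$ such that for all $n \geq m$ and all $w \in W$, $w^{\Gamma^n(f)} \models \Phi$. (b) If $R_\alpha$ is reflexive and transitive for all $\alpha \in G$, then for each finite $\Phi \subseteq \mathsf{KT} + \mathsf{UBF} + \mathsf{IA} + \mathsf{In}^+$ there is $m < \omega$ such that for all $n \geq m$ and all $w \in W$, $w^{\Gamma^n(f)} \models \Phi$. (c) If $R_\alpha$ is reflexive, transitive and Euclidean for all $\alpha \in G$, then for each finite $\Phi \subseteq \mathsf{KT} + \mathsf{UBF} + \mathsf{IA} + \mathsf{In}^+ + \mathsf{In}^-$ there is $m < \omega$ such that for all $n \geq m$ and all $w \in W$, $w^{\Gamma^n(f)} \models \Phi$.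
   Context: Language. $\mathcal{L}$ is the first-order language with equality having the arithmetic symbols $\underline{0}, S, +, \cdot$, a unary predicate $U$, a unary function symbol $u$, a unary predicate $\mathrm{K}^1$, a binary relation $\mathrm{K}^2$ (both written $\mathrm{K}$ when the arity is clear), a unary predicate $\mathrm{T}$ and a unary predicate $\mathrm{Ag}$. $\mathcal{L}_{\mathrm{PA}}$ is the sublanguage of arithmetic symbols; $\mathcal{L}_-$ is the sublanguage with symbols $\underline{0}, S, +, \cdot, U, u, \mathrm{Ag}$. For a language $L$: $L^n$ is the set of $L$-formulas with exactly $n$ free variables, $L^1[v]$ those with exactly $v$ free, $\mathrm{Atom}_L^n$ the atomic ones with exactly $n$ free variables, $\mathrm{Term}_L^0$ the closed $L$-terms, $\mathrm{Var}$ the variables. $\mathrm{PA}(\mathcal{L})$ is Peano Arithmetic with induction for all $\mathcal{L}$-formulas. Syntax coding. A Gödel numbering is fixed; $\mathrm{gc}(\phi) \in \mathbb{N}$ is the code of $\phi$, and $\ulcorner \phi \urcorner = \mathrm{gq}(\phi)$ is the numeral of that code. $\mathrm{num}(n)$ is the numeral of $n$; $\mathrm{sbt}(\phi,t,v)$ is the result of substituting $t$ for $v$ in $\phi$. A dot under a symbol denotes the representation in arithmetic of the corresponding syntactic relation or function (e.g. $\text{\d{$\mathcal{L}$}}^0$ represents the set of codes of sentences, $\text{\d{$\rightarrow$}}$ the function forming implications, $\text{\d{T}}$ the function forming $\mathrm{T}(t)$ from $t$, $\text{\d{K}}$ the function forming $\mathrm{K}(s,t)$ from $s,t$); $t^\circ$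 represents the value of a closed $\mathcal{L}_{\mathrm{PA}}$-term $t$. $\forall x \in \phi\,(\psi)$ abbreviates $\forall x(\phi(x) \rightarrow \psi)$. Systems. An $\mathcal{L}$-system is a recursively enumerable set of $\mathcal{L}$-sentences containing a Hilbert-style axiomatization of first-order logic and closed under modus ponens; it is given by axioms and rules, where a rule of a system may be applied to any theorem (but not to undischarged assumptions), and in an extension of the system it may be applied to any theorem of the extension. A system is identified with its set of theorems; $S\vdash\mathsf{DCB}$ means $S$ proves all theorems of $\mathsf{DCB}$. $\mathsf{Base}$ is $\mathrm{PA}(\mathcal{L})$. $\Pr_S$ is the standard provability predicate of $S$. $\mathsf{DCB}$ extends $\mathsf{Base}$ with the axioms: (Non-triviality) $\exists \alpha\, \mathrm{Ag}(\alpha)$; ($\mathrm{K}^1$-$\mathrm{K}^2$) $\forall \phi \in \text{\d{$\mathcal{L}$}}^0 (\mathrm{K}^1(\phi) \leftrightarrow \forall \alpha \in \mathrm{Ag}\ \mathrm{K}^2(\alpha,\phi))$; ($\mathsf{UK}^{\mathrm{K}}$) $\forall \alpha \in \mathrm{Ag}\ \forall \phi,\psi \in \text{\d{$\mathcal{L}$}}^0 ((\mathrm{K}(\alpha,\phi) \wedge \mathrm{K}(\alpha,\phi \mathbin{\text{\d{$\rightarrow$}}} \psi)) \rightarrow \mathrm{K}(\alpha,\psi))$; ($\mathsf{R}_{\mathsf{DCB}}$) $\forall \alpha \in \mathrm{Ag}\ \forall \phi \in \text{\d{$\mathcal{L}$}}^0 (\Pr_{\mathsf{DCB}}(\phi)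 \rightarrow \mathrm{K}(\alpha,\phi))$, where $\Pr_{\mathsf{DCB}}$ is the provability predicate of the very system $\mathsf{DCB}$ of which this is an axiom (obtained by the Gödel fixed-point lemma). $\mathsf{FS}$ extends $\mathsf{Base}$ with the axioms: $\forall t_1,\dots,t_n \in \text{\d{Term}}^0_{\mathcal{L}_{\mathrm{PA}}} (\mathrm{T}(\text{\d{$R$}}(t_1,\dots,t_n)) \leftrightarrow R(t_1^\circ,\dots,t_n^\circ))$ for each $R(\vec x) \in \mathrm{Atom}^n_{\mathcal{L}_-}$; $\forall \phi \in \text{\d{$\mathcal{L}$}}^0 (\mathrm{T}(\text{\d{$\neg$}}\phi) \leftrightarrow \neg \mathrm{T}(\phi))$; $\forall \phi,\psi \in \text{\d{$\mathcal{L}$}}^0 (\mathrm{T}(\phi \mathbin{\text{\d{$\circ$}}} \psi) \leftrightarrow (\mathrm{T}(\phi) \circ \mathrm{T}(\psi)))$ for each $\circ \in \{\rightarrow,\wedge,\vee\}$; $\forall v \in \text{\d{Var}}\ \forall \phi \in \text{\d{$\mathcal{L}$}}^1[v] (\mathrm{T}(\text{\d{$Q$}} v \phi) \leftrightarrow Q t \in \text{\d{Term}}^0_{\mathcal{L}}\ \mathrm{T}(\text{\d{sbt}}(\phi,t,v)))$ for each $Q \in \{\forall,\exists\}$; and the rules, for $\phi \in \mathcal{L}^0$: ($\mathsf{NEC}^{\mathrm{T}}$) from $\vdash \phi$ infer $\vdash \mathrm{T}(\ulcorner\phi\urcorner)$; ($\mathsf{CONEC}^{\mathrm{T}}$) from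 $\vdash \mathrm{T}(\ulcorner\phi\urcorner)$ infer $\vdash \phi$. $\mathsf{KT}$ extends $\mathsf{DCB}$ and $\mathsf{FS}$ with the axiom ($\mathsf{V}$) $\forall \alpha \in \mathrm{Ag}\ \forall \phi \in \text{\d{$\mathcal{L}$}}^0 (\mathrm{K}(\alpha,\phi) \rightarrow \mathrm{T}(\phi))$ and the rule, for $\phi \in \mathcal{L}^0$: ($\mathsf{NEC}^{\mathrm{K}}$) from $\vdash \phi$ infer $\vdash \forall \alpha \in \mathrm{Ag}\ \mathrm{K}(\alpha,\ulcorner\phi\urcorner)$. Supplementary axioms: ($\mathsf{UBF}$) $\forall \alpha \in \mathrm{Ag}\ \forall v \in \text{\d{Var}}\ \forall \phi \in \text{\d{$\mathcal{L}$}}^1[v] ((\forall t \in \text{\d{Term}}^0_{\mathcal{L}_{\mathrm{PA}}}\ \mathrm{K}(\alpha,\text{\d{sbt}}(\phi,t,v))) \rightarrow \mathrm{K}(\alpha,\text{\d{$\forall$}} v \phi))$; ($\mathsf{IA}$) $\forall \alpha \in \mathrm{Ag}\ \forall \phi \in \text{\d{$\mathcal{L}$}}^0 (\mathrm{K}(\alpha,\text{\d{T}}(\text{\d{gq}}(\phi))) \leftrightarrow \mathrm{T}(\text{\d{K}}(\text{\d{num}}(\alpha),\text{\d{gq}}(\phi))))$; ($\mathsf{In}^+$) $\forall \alpha \in \mathrm{Ag}\ \forall \phi \in \text{\d{$\mathcal{L}$}}^0 (\mathrm{K}(\alpha,\text{\d{T}}(\text{\d{gq}}(\phi))) \rightarrow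 \mathrm{K}(\alpha,\text{\d{K}}(\text{\d{num}}(\alpha),\text{\d{gq}}(\phi))))$; ($\mathsf{In}^-$) $\forall \alpha \in \mathrm{Ag}\ \forall \phi \in \text{\d{$\mathcal{L}$}}^0 (\neg\mathrm{K}(\alpha,\text{\d{T}}(\text{\d{gq}}(\phi))) \rightarrow \mathrm{K}(\alpha,\text{\d{$\neg$}}\text{\d{K}}(\text{\d{num}}(\alpha),\text{\d{gq}}(\phi))))$. Semantics. An $\mathcal{L}_-$-agency-frame for $G$ is a tuple $F = \langle W,(R_\alpha)_{\alpha\in G}\rangle$ where $W$ is a set of $\mathcal{L}_-$-expansions of the standard model $\mathbb{N}$ interpreting $\mathrm{Ag}$ by $G$, and each $R_\alpha$ is a binary relation on $W$. An evaluation function of $F$ is a function $f: W \to \mathcal{P}(\mathbb{N})$; $\mathrm{Val}_F$ is the set of these. For $f \in \mathrm{Val}_F$, $\alpha\in G$, $w \in W$: $f_\alpha(w) = \bigcap\{f(v) \mid w R_\alpha v\}$ and $f^{\mathrm{K}}(w) = \{\langle\alpha,\phi\rangle \mid \alpha\in G,\ \phi \in f_\alpha(w)\}$. $w^f$ is the $\mathcal{L}$-expansion of $w$ interpreting $\mathrm{T}$ by $f(w)$, $\mathrm{K}^2$ by $f^{\mathrm{K}}(w)$, and $\mathrm{K}^1$ by $\{\phi \mid \forall\alpha\in G\ \langle\alpha,\phi\rangle\in f^{\mathrm{K}}(w)\}$. The revision semantic operator $\Gamma: \mathrm{Val}_F\to\mathrm{Val}_F$ is $(\Gamma(f))(w)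 = \{\mathrm{gc}(\phi) \mid \phi\in\mathcal{L}^0,\ w^f \models \phi\}$; $\Gamma^n$ is its $n$-fold iterate. A relation $R$ is Euclidean if $aRb$ and $aRc$ imply $bRc$. *)

theory Defs
  imports "HOL-Number_Theory.Cong"
begin

section \<open>The language and its syntax\<close>

datatype tm = Var nat | Zero | Succ tm | Add tm tm | Mul tm tm | Fu tm

datatype fm =
    Eq tm tm            (infix "\<^bold>=" 50)
  | PU tm
  | PAg tm
  | PK1 tm
  | PK2 tm tm
  | PT tm
  | Neg fm              ("\<^bold>\<not> _" [40] 40)
  | Imp fm fm           (infixr "\<^bold>\<rightarrow>" 25)
  | And fm fm           (infixr "\<^bold>\<and>" 35)
  | Or fm fm            (infixr "\<^bold>\<or>" 30)
  | Forall nat fm       ("(3\<^bold>\<forall>_./ _)" [1000, 10] 10)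
  | Exists nat fm       ("(3\<^bold>\<exists>_./ _)" [1000, 10] 10)

abbreviation Iff :: "fm \<Rightarrow> fm \<Rightarrow> fm" (infixr "\<^bold>\<leftrightarrow>" 25)
  where "A \<^bold>\<leftrightarrow> B \<equiv> (A \<^bold>\<rightarrow> B) \<^bold>\<and> (B \<^bold>\<rightarrow> A)"

abbreviation v0 :: tm where "v0 \<equiv> Var 0"
abbreviation v1 :: tm where "v1 \<equiv> Var 1"
abbreviation v2 :: tm where "v2 \<equiv> Var 2"
abbreviation v3 :: tm where "v3 \<equiv> Var 3"

primrec fvt :: "tm \<Rightarrow> nat set" where
  "fvt (Var x) = {x}"
| "fvt Zero = {}"
| "fvt (Succ t) = fvt t"
| "fvt (Add s t) = fvt s \<union> fvt t"
| "fvt (Mul s t) = fvt s \<union> fvt t"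
| "fvt (Fu t) = fvt t"

primrec fv :: "fm \<Rightarrow> nat set" where
  "fv (s \<^bold>= t) = fvt s \<union> fvt t"
| "fv (PU t) = fvt t"
| "fv (PAg t) = fvt t"
| "fv (PK1 t) = fvt t"
| "fv (PK2 s t) = fvt s \<union> fvt t"
| "fv (PT t) = fvt t"
| "fv (\<^bold>\<not> A) = fv A"
| "fv (A \<^bold>\<rightarrow> B) = fv A \<union> fv B"
| "fv (A \<^bold>\<and> B) = fv A \<union> fv B"
| "fv (A \<^bold>\<or> B) = fv A \<union> fv B"
| "fv (\<^bold>\<forall>x. A) = fv A - {x}"
| "fv (\<^bold>\<exists>x. A) = fv A - {x}"

definition sentence :: "fm \<Rightarrow> bool" where
  "sentence A \<longleftrightarrow> fv A = {}"

primrec subt :: "tm \<Rightarrow> tm \<Rightarrow> nat \<Rightarrow> tm" where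
  "subt (Var y) t x = (if y = x then t else Var y)"
| "subt Zero t x = Zero"
| "subt (Succ s) t x = Succ (subt s t x)"
| "subt (Add r s) t x = Add (subt r t x) (subt s t x)"
| "subt (Mul r s) t x = Mul (subt r t x) (subt s t x)"
| "subt (Fu s) t x = Fu (subt s t x)"

primrec sbt :: "fm \<Rightarrow> tm \<Rightarrow> nat \<Rightarrow> fm" where
  "sbt (r \<^bold>= s) t x = (subt r t x \<^bold>= subt s t x)"
| "sbt (PU s) t x = PU (subt s t x)"
| "sbt (PAg s) t x = PAg (subt s t x)"
| "sbt (PK1 s) t x = PK1 (subt s t x)"
| "sbt (PK2 r s) t x = PK2 (subt r t x) (subt s t x)"
| "sbt (PT s) t x = PT (subt s t x)"
| "sbt (\<^bold>\<not> A) t x = (\<^bold>\<not> sbt A t x)"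
| "sbt (A \<^bold>\<rightarrow> B) t x = (sbt A t x \<^bold>\<rightarrow> sbt B t x)"
| "sbt (A \<^bold>\<and> B) t x = (sbt A t x \<^bold>\<and> sbt B t x)"
| "sbt (A \<^bold>\<or> B) t x = (sbt A t x \<^bold>\<or> sbt B t x)"
| "sbt (\<^bold>\<forall>y. A) t x = (\<^bold>\<forall>y. if y = x then A else sbt A t x)"
| "sbt (\<^bold>\<exists>y. A) t x = (\<^bold>\<exists>y. if y = x then A else sbt A t x)"

primrec free_for :: "tm \<Rightarrow> nat \<Rightarrow> fm \<Rightarrow> bool" where
  "free_for t x (r \<^bold>= s) = True"
| "free_for t x (PU s) = True"
| "free_for t x (PAg s) = True"
| "free_for t x (PK1 s) = True"
| "free_for t x (PK2 r s) = True"
| "free_for t x (PT s) = True"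
| "free_for t x (\<^bold>\<not> A) = free_for t x A"
| "free_for t x (A \<^bold>\<rightarrow> B) = (free_for t x A \<and> free_for t x B)"
| "free_for t x (A \<^bold>\<and> B) = (free_for t x A \<and> free_for t x B)"
| "free_for t x (A \<^bold>\<or> B) = (free_for t x A \<and> free_for t x B)"
| "free_for t x (\<^bold>\<forall>y. A) = (x \<notin> fv (\<^bold>\<forall>y. A) \<or> y \<notin> fvt t \<and> free_for t x A)"
| "free_for t x (\<^bold>\<exists>y. A) = (x \<notin> fv (\<^bold>\<exists>y. A) \<or> y \<notin> fvt t \<and> free_for t x A)"

primrec num :: "nat \<Rightarrow> tm" where
  "num 0 = Zero"
| "num (Suc n) = Succ (num n)"


section \<open>Goedel numbering\<close>

text \<open>The polynomial pairing is injective because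
  \<open>(a + b)\<^sup>2 \<le> npair a b < (a + b + 1)\<^sup>2\<close>. Since it is a term of the language of arithmetic,
  so are the arithmetical versions of the syntactic constructors below.\<close>

definition npair :: "nat \<Rightarrow> nat \<Rightarrow> nat" where
  "npair a b = (a + b) * (a + b) + a"

primrec gct :: "tm \<Rightarrow> nat" where
  "gct (Var x) = npair 0 x"
| "gct Zero = npair 1 0"
| "gct (Succ t) = npair 2 (gct t)"
| "gct (Add s t) = npair 3 (npair (gct s) (gct t))"
| "gct (Mul s t) = npair 4 (npair (gct s) (gct t))"
| "gct (Fu t) = npair 5 (gct t)"

primrec gc :: "fm \<Rightarrow> nat" where
  "gc (s \<^bold>= t) = npair 6 (npair (gct s) (gct t))"
| "gc (PU t) = npair 7 (gct t)"
| "gc (PAg t) = npair 8 (gct t)"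
| "gc (PK1 t) = npair 9 (gct t)"
| "gc (PK2 s t) = npair 10 (npair (gct s) (gct t))"
| "gc (PT t) = npair 11 (gct t)"
| "gc (\<^bold>\<not> A) = npair 12 (gc A)"
| "gc (A \<^bold>\<rightarrow> B) = npair 13 (npair (gc A) (gc B))"
| "gc (A \<^bold>\<and> B) = npair 14 (npair (gc A) (gc B))"
| "gc (A \<^bold>\<or> B) = npair 15 (npair (gc A) (gc B))"
| "gc (\<^bold>\<forall>x. A) = npair 16 (npair (gct (Var x)) (gc A))"
| "gc (\<^bold>\<exists>x. A) = npair 17 (npair (gct (Var x)) (gc A))"

definition gq :: "fm \<Rightarrow> tm" where
  "gq A = num (gc A)"


section \<open>Structures on the natural numbers\<close>

text \<open>All structures considered expand the standard model, so the arithmetical symbols are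
  interpreted once and for all.\<close>

record world =
  Uint :: "nat set"
  uint :: "nat \<Rightarrow> nat"

record lstruct = world +
  Agint :: "nat set"
  K1int :: "nat set"
  K2int :: "(nat \<times> nat) set"
  Tint :: "nat set"

primrec val :: "lstruct \<Rightarrow> (nat \<Rightarrow> nat) \<Rightarrow> tm \<Rightarrow> nat" where
  "val M e (Var x) = e x"
| "val M e Zero = 0"
| "val M e (Succ t) = Suc (val M e t)"
| "val M e (Add s t) = val M e s + val M e t"
| "val M e (Mul s t) = val M e s * val M e t"
| "val M e (Fu t) = uint M (val M e t)"

primrec sat :: "lstruct \<Rightarrow> (nat \<Rightarrow> nat) \<Rightarrow> fm \<Rightarrow> bool" where
  "sat M e (s \<^bold>= t) \<longleftrightarrow> val M e s = val M e t"
| "sat M e (PU t) \<longleftrightarrow> val M e t \<in> Uint M"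
| "sat M e (PAg t) \<longleftrightarrow> val M e t \<in> Agint M"
| "sat M e (PK1 t) \<longleftrightarrow> val M e t \<in> K1int M"
| "sat M e (PK2 s t) \<longleftrightarrow> (val M e s, val M e t) \<in> K2int M"
| "sat M e (PT t) \<longleftrightarrow> val M e t \<in> Tint M"
| "sat M e (\<^bold>\<not> A) \<longleftrightarrow> \<not> sat M e A"
| "sat M e (A \<^bold>\<rightarrow> B) \<longleftrightarrow> (sat M e A \<longrightarrow> sat M e B)"
| "sat M e (A \<^bold>\<and> B) \<longleftrightarrow> sat M e A \<and> sat M e B"
| "sat M e (A \<^bold>\<or> B) \<longleftrightarrow> sat M e A \<or> sat M e B"
| "sat M e (\<^bold>\<forall>x. A) \<longleftrightarrow> (\<forall>n. sat M (e(x := n)) A)"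
| "sat M e (\<^bold>\<exists>x. A) \<longleftrightarrow> (\<exists>n. sat M (e(x := n)) A)"

definition models :: "lstruct \<Rightarrow> fm \<Rightarrow> bool" (infix "\<Turnstile>" 50) where
  "M \<Turnstile> A \<longleftrightarrow> (\<forall>e. sat M e A)"


section \<open>First-order logic and Peano arithmetic\<close>

text \<open>A Hilbert calculus for sentences whose only rule is modus ponens: its axioms are
  all sentences that arise from an instance of a logical schema by prefixing universal
  quantifiers.\<close>

definition generalizations :: "fm \<Rightarrow> fm set" where
  "generalizations A = {foldr Forall xs A | xs. True}"

inductive logical_schema :: "fm \<Rightarrow> bool" where
  "logical_schema (A \<^bold>\<rightarrow> B \<^bold>\<rightarrow> A)"
| "logical_schema ((A \<^bold>\<rightarrow> B \<^bold>\<rightarrow> C) \<^bold>\<rightarrow> (A \<^bold>\<rightarrow> B) \<^bold>\<rightarrow> A \<^bold>\<rightarrow> C)"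
| "logical_schema (((\<^bold>\<not> A) \<^bold>\<rightarrow> (\<^bold>\<not> B)) \<^bold>\<rightarrow> B \<^bold>\<rightarrow> A)"
| "logical_schema (A \<^bold>\<and> B \<^bold>\<rightarrow> A)"
| "logical_schema (A \<^bold>\<and> B \<^bold>\<rightarrow> B)"
| "logical_schema (A \<^bold>\<rightarrow> B \<^bold>\<rightarrow> A \<^bold>\<and> B)"
| "logical_schema (A \<^bold>\<rightarrow> A \<^bold>\<or> B)"
| "logical_schema (B \<^bold>\<rightarrow> A \<^bold>\<or> B)"
| "logical_schema ((A \<^bold>\<rightarrow> C) \<^bold>\<rightarrow> (B \<^bold>\<rightarrow> C) \<^bold>\<rightarrow> A \<^bold>\<or> B \<^bold>\<rightarrow> C)"
| "free_for t x A \<Longrightarrow> logical_schema ((\<^bold>\<forall>x. A) \<^bold>\<rightarrow> sbt A t x)"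
| "logical_schema ((\<^bold>\<forall>x. A \<^bold>\<rightarrow> B) \<^bold>\<rightarrow> (\<^bold>\<forall>x. A) \<^bold>\<rightarrow> (\<^bold>\<forall>x. B))"
| "x \<notin> fv A \<Longrightarrow> logical_schema (A \<^bold>\<rightarrow> (\<^bold>\<forall>x. A))"
| "logical_schema ((\<^bold>\<exists>x. A) \<^bold>\<rightarrow> (\<^bold>\<not> (\<^bold>\<forall>x. \<^bold>\<not> A)))"
| "logical_schema ((\<^bold>\<not> (\<^bold>\<forall>x. \<^bold>\<not> A)) \<^bold>\<rightarrow> (\<^bold>\<exists>x. A))"
| "logical_schema (t \<^bold>= t)"
| "free_for s x A \<Longrightarrow> free_for t x A \<Longrightarrow>
    logical_schema (s \<^bold>= t \<^bold>\<rightarrow> sbt A s x \<^bold>\<rightarrow> sbt A t x)"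

definition logical_axioms :: "fm set" where
  "logical_axioms = {B. sentence B \<and> (\<exists>A. logical_schema A \<and> B \<in> generalizations A)}"

definition PA1 :: fm where "PA1 = (\<^bold>\<forall>0. \<^bold>\<not> (Succ v0 \<^bold>= Zero))"
definition PA2 :: fm where "PA2 = (\<^bold>\<forall>0. \<^bold>\<forall>1. Succ v0 \<^bold>= Succ v1 \<^bold>\<rightarrow> v0 \<^bold>= v1)"
definition PA3 :: fm where "PA3 = (\<^bold>\<forall>0. Add v0 Zero \<^bold>= v0)"
definition PA4 :: fm where "PA4 = (\<^bold>\<forall>0. \<^bold>\<forall>1. Add v0 (Succ v1) \<^bold>= Succ (Add v0 v1))"
definition PA5 :: fm where "PA5 = (\<^bold>\<forall>0. Mul v0 Zero \<^bold>= Zero)"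
definition PA6 :: fm where "PA6 = (\<^bold>\<forall>0. \<^bold>\<forall>1. Mul v0 (Succ v1) \<^bold>= Add (Mul v0 v1) v0)"

definition induction_schema :: "nat \<Rightarrow> fm \<Rightarrow> fm" where
  "induction_schema x A =
    (sbt A Zero x \<^bold>\<and> (\<^bold>\<forall>x. A \<^bold>\<rightarrow> sbt A (Succ (Var x)) x) \<^bold>\<rightarrow> (\<^bold>\<forall>x. A))"

definition PA_axioms :: "fm set" where
  "PA_axioms = {PA1, PA2, PA3, PA4, PA5, PA6} \<union>
    {B. sentence B \<and> (\<exists>x A. B \<in> generalizations (induction_schema x A))}"


section \<open>Systems\<close>

text \<open>The set of theorems of the system with non-logical axioms \<open>Ax\<close> and, in addition to modus
  ponens, the one-premise rules \<open>Rl\<close> (pairs of premise and conclusion).\<close>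

inductive_set thms :: "fm set \<Rightarrow> (fm \<times> fm) set \<Rightarrow> fm set" for Ax Rl where
  logic: "A \<in> logical_axioms \<Longrightarrow> A \<in> thms Ax Rl"
| axiom: "A \<in> Ax \<Longrightarrow> A \<in> thms Ax Rl"
| mp: "(A \<^bold>\<rightarrow> B) \<in> thms Ax Rl \<Longrightarrow> A \<in> thms Ax Rl \<Longrightarrow> B \<in> thms Ax Rl"
| rule: "(A, B) \<in> Rl \<Longrightarrow> A \<in> thms Ax Rl \<Longrightarrow> B \<in> thms Ax Rl"

text \<open>Partial recursive functions. \<open>RPrec\<close> recurses on, and \<open>RMin\<close> minimizes over, the first
  argument.\<close>

datatype recf = RZero | RSucc | RProj nat | RComp recf "recf list" | RPrec recf recf | RMin recf

inductive rec_eval :: "recf \<Rightarrow> nat list \<Rightarrow> nat \<Rightarrow> bool" where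
  "rec_eval RZero xs 0"
| "rec_eval RSucc [x] (Suc x)"
| "i < length xs \<Longrightarrow> rec_eval (RProj i) xs (xs ! i)"
| "list_all2 (\<lambda>g y. rec_eval g xs y) gs ys \<Longrightarrow> rec_eval f ys z \<Longrightarrow>
    rec_eval (RComp f gs) xs z"
| "rec_eval f xs y \<Longrightarrow> rec_eval (RPrec f g) (0 # xs) y"
| "rec_eval (RPrec f g) (n # xs) y \<Longrightarrow> rec_eval g (n # y # xs) z \<Longrightarrow>
    rec_eval (RPrec f g) (Suc n # xs) z"
| "rec_eval f (n # xs) 0 \<Longrightarrow> (\<forall>i<n. \<exists>y>0. rec_eval f (i # xs) y) \<Longrightarrow>
    rec_eval (RMin f) xs n"

definition rec_enumerable :: "nat set \<Rightarrow> bool" where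
  "rec_enumerable X \<longleftrightarrow> (\<exists>f. \<forall>n. n \<in> X \<longleftrightarrow> (\<exists>y. rec_eval f [n] y))"

definition L_system :: "fm set \<Rightarrow> bool" where
  "L_system S \<longleftrightarrow>
    (\<forall>A\<in>S. sentence A) \<and>
    rec_enumerable (gc ` S) \<and>
    logical_axioms \<subseteq> S \<and>
    (\<forall>A B. (A \<^bold>\<rightarrow> B) \<in> S \<longrightarrow> A \<in> S \<longrightarrow> B \<in> S)"


section \<open>Arithmetization\<close>

text \<open>In a formula \<open>X_fm k s t\<close> the bound variables are chosen among those with index at least
  \<open>k\<close>; the variables of the argument terms must have indices below \<open>k\<close>.
  \<open>X_tm\<close> is the term computing the code of a compound expression from the codes of its parts.\<close>

definition pair_tm :: "tm \<Rightarrow> tm \<Rightarrow> tm" where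
  "pair_tm s t = Add (Mul (Add s t) (Add s t)) s"

definition T_tm :: "tm \<Rightarrow> tm" where "T_tm t = pair_tm (num 11) t"
definition K2_tm :: "tm \<Rightarrow> tm \<Rightarrow> tm" where "K2_tm s t = pair_tm (num 10) (pair_tm s t)"
definition neg_tm :: "tm \<Rightarrow> tm" where "neg_tm s = pair_tm (num 12) s"
definition imp_tm :: "tm \<Rightarrow> tm \<Rightarrow> tm" where "imp_tm s t = pair_tm (num 13) (pair_tm s t)"
definition and_tm :: "tm \<Rightarrow> tm \<Rightarrow> tm" where "and_tm s t = pair_tm (num 14) (pair_tm s t)"
definition or_tm :: "tm \<Rightarrow> tm \<Rightarrow> tm" where "or_tm s t = pair_tm (num 15) (pair_tm s t)"
definition all_tm :: "tm \<Rightarrow> tm \<Rightarrow> tm" where "all_tm s t = pair_tm (num 16) (pair_tm s t)"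
definition ex_tm :: "tm \<Rightarrow> tm \<Rightarrow> tm" where "ex_tm s t = pair_tm (num 17) (pair_tm s t)"

definition le_fm :: "nat \<Rightarrow> tm \<Rightarrow> tm \<Rightarrow> fm" where
  "le_fm k s t = (\<^bold>\<exists>k. Add s (Var k) \<^bold>= t)"

definition less_fm :: "nat \<Rightarrow> tm \<Rightarrow> tm \<Rightarrow> fm" where
  "less_fm k s t = le_fm k (Succ s) t"

text \<open>Goedel's beta function: \<open>y = a mod (1 + (i + 1) * b)\<close>.\<close>

definition beta_fm :: "nat \<Rightarrow> tm \<Rightarrow> tm \<Rightarrow> tm \<Rightarrow> tm \<Rightarrow> fm" where
  "beta_fm k a b i y =
    (le_fm k y (Mul (Succ i) b) \<^bold>\<and>
     (\<^bold>\<exists>k. a \<^bold>= Add (Mul (Var k) (Succ (Mul (Succ i) b))) y))"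

text \<open>\<open>Ind_fm k step x\<close>: there is a finite sequence with last member \<open>x\<close> in which every member
  \<open>y\<close> satisfies \<open>step\<close>, the second argument of \<open>step\<close> expressing membership among
  the members preceding \<open>y\<close>.\<close>

definition Ind_fm :: "nat \<Rightarrow> (nat \<Rightarrow> (nat \<Rightarrow> tm \<Rightarrow> fm) \<Rightarrow> tm \<Rightarrow> fm) \<Rightarrow> tm \<Rightarrow> fm" where
  "Ind_fm k step x =
    (let a = Var k; b = Var (k+1); l = Var (k+2); i = Var (k+3); y = Var (k+4)
     in \<^bold>\<exists>k. \<^bold>\<exists>(k+1). \<^bold>\<exists>(k+2). beta_fm (k+3) a b l x \<^bold>\<and>
          (\<^bold>\<forall>(k+3). le_fm (k+4) i l \<^bold>\<rightarrow>
            (\<^bold>\<exists>(k+4). beta_fm (k+5) a b i y \<^bold>\<and>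
              step (k+5)
                (\<lambda>j z. \<^bold>\<exists>j. less_fm (j+1) (Var j) i \<^bold>\<and> beta_fm (j+1) a b (Var j) z) y)))"

definition Disj :: "fm list \<Rightarrow> fm" where
  "Disj As = foldr Or As (\<^bold>\<not> (Zero \<^bold>= Zero))"

definition Var_fm :: "nat \<Rightarrow> tm \<Rightarrow> fm" where
  "Var_fm k x = (\<^bold>\<exists>k. x \<^bold>= pair_tm (num 0) (Var k))"

text \<open>The tags (as in \<open>gct\<close> and \<open>gc\<close>) of the unary and binary function symbols (\<open>ft\<close>), and of
  all unary and binary function symbols, predicates and connectives (\<open>st\<close>).\<close>

abbreviation (input) unary_ft :: "nat list" where "unary_ft \<equiv> [2, 5]"
abbreviation (input) binary_ft :: "nat list" where "binary_ft \<equiv> [3, 4]"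
abbreviation (input) unary_st :: "nat list" where "unary_st \<equiv> [2, 5, 7, 8, 9, 11, 12]"
abbreviation (input) binary_st :: "nat list" where "binary_st \<equiv> [3, 4, 6, 10, 13, 14, 15]"

definition un_fm :: "nat \<Rightarrow> nat list \<Rightarrow> (nat \<Rightarrow> tm \<Rightarrow> fm) \<Rightarrow> tm \<Rightarrow> fm" where
  "un_fm k cs P y =
    (\<^bold>\<exists>k. Disj (map (\<lambda>c. y \<^bold>= pair_tm (num c) (Var k)) cs) \<^bold>\<and> P (k+1) (Var k))"

definition bin_fm :: "nat \<Rightarrow> nat list \<Rightarrow> (nat \<Rightarrow> tm \<Rightarrow> tm \<Rightarrow> fm) \<Rightarrow> tm \<Rightarrow> fm" where
  "bin_fm k cs P y =
    (\<^bold>\<exists>k. \<^bold>\<exists>(k+1). Disj (map (\<lambda>c. y \<^bold>= pair_tm (num c) (pair_tm (Var k) (Var (k+1)))) cs) \<^bold>\<and>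
       P (k+2) (Var k) (Var (k+1)))"

definition term_step ::
    "(nat \<Rightarrow> tm \<Rightarrow> fm) \<Rightarrow> nat list \<Rightarrow> nat \<Rightarrow> (nat \<Rightarrow> tm \<Rightarrow> fm) \<Rightarrow> tm \<Rightarrow> fm" where
  "term_step atom unary k mem y =
    (atom k y \<^bold>\<or> un_fm k unary mem y \<^bold>\<or> bin_fm k binary_ft (\<lambda>k s t. mem k s \<^bold>\<and> mem k t) y)"

definition Term_fm :: "nat \<Rightarrow> tm \<Rightarrow> fm" where
  "Term_fm k x = Ind_fm k (term_step (\<lambda>k y. Var_fm k y \<^bold>\<or> y \<^bold>= num (gct Zero)) unary_ft) x"

definition TermL0_fm :: "nat \<Rightarrow> tm \<Rightarrow> fm" where
  "TermL0_fm k x = Ind_fm k (term_step (\<lambda>k y. y \<^bold>= num (gct Zero)) unary_ft) x"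

definition TermPA0_fm :: "nat \<Rightarrow> tm \<Rightarrow> fm" where
  "TermPA0_fm k x = Ind_fm k (term_step (\<lambda>k y. y \<^bold>= num (gct Zero)) [2]) x"

definition Form_fm :: "nat \<Rightarrow> tm \<Rightarrow> fm" where
  "Form_fm k x = Ind_fm k (\<lambda>k mem y.
      un_fm k [7, 8, 9, 11] Term_fm y \<^bold>\<or>
      bin_fm k [6, 10] (\<lambda>k s t. Term_fm k s \<^bold>\<and> Term_fm k t) y \<^bold>\<or>
      un_fm k [12] mem y \<^bold>\<or>
      bin_fm k [13, 14, 15] (\<lambda>k s t. mem k s \<^bold>\<and> mem k t) y \<^bold>\<or>
      bin_fm k [16, 17] (\<lambda>k v s. Var_fm k v \<^bold>\<and> mem k s) y) x"

text \<open>The variable (coded by) \<open>v\<close> is not free in the term or formula (coded by) \<open>x\<close>.\<close>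

definition NotFree_fm :: "nat \<Rightarrow> tm \<Rightarrow> tm \<Rightarrow> fm" where
  "NotFree_fm k v x = Ind_fm k (\<lambda>k mem y.
      (Var_fm k y \<^bold>\<and> (\<^bold>\<not> (y \<^bold>= v))) \<^bold>\<or>
      y \<^bold>= num (gct Zero) \<^bold>\<or>
      un_fm k unary_st mem y \<^bold>\<or>
      bin_fm k binary_st (\<lambda>k s t. mem k s \<^bold>\<and> mem k t) y \<^bold>\<or>
      bin_fm k [16, 17] (\<lambda>k w s. w \<^bold>= v \<^bold>\<or> mem k s) y) x"

definition Sent_fm :: "nat \<Rightarrow> tm \<Rightarrow> fm" where
  "Sent_fm k x =
    (Form_fm k x \<^bold>\<and>
     (\<^bold>\<forall>k. le_fm (k+1) (Var k) x \<^bold>\<rightarrow> Var_fm (k+1) (Var k) \<^bold>\<rightarrow> NotFree_fm (k+1) (Var k) x))"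

text \<open>\<open>x\<close> is a formula whose only free variable is \<open>v\<close>.\<close>

definition L1_fm :: "nat \<Rightarrow> tm \<Rightarrow> tm \<Rightarrow> fm" where
  "L1_fm k v x =
    (Form_fm k x \<^bold>\<and> (\<^bold>\<not> NotFree_fm k v x) \<^bold>\<and>
     (\<^bold>\<forall>k. le_fm (k+1) (Var k) x \<^bold>\<rightarrow> Var_fm (k+1) (Var k) \<^bold>\<rightarrow> (\<^bold>\<not> (Var k \<^bold>= v)) \<^bold>\<rightarrow>
        NotFree_fm (k+1) (Var k) x))"

text \<open>\<open>y\<close> is the result of substituting \<open>t\<close> for the free occurrences of the variable \<open>v\<close> in the
  term or formula \<open>x\<close>; the sequence consists of pairs \<open>(x, y)\<close>.\<close>

definition sbt_step :: "tm \<Rightarrow> tm \<Rightarrow> nat \<Rightarrow> (nat \<Rightarrow> tm \<Rightarrow> fm) \<Rightarrow> tm \<Rightarrow> tm \<Rightarrow> fm" where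
  "sbt_step t v k mem x y =
    ((x \<^bold>= v \<^bold>\<and> y \<^bold>= t) \<^bold>\<or>
     (Var_fm k x \<^bold>\<and> (\<^bold>\<not> (x \<^bold>= v)) \<^bold>\<and> y \<^bold>= x) \<^bold>\<or>
     (x \<^bold>= num (gct Zero) \<^bold>\<and> y \<^bold>= x) \<^bold>\<or>
     Disj (map (\<lambda>c. un_fm k [c] (\<lambda>k s. \<^bold>\<exists>k. mem (k+1) (pair_tm s (Var k)) \<^bold>\<and>
       y \<^bold>= pair_tm (num c) (Var k)) x) unary_st) \<^bold>\<or>
     Disj (map (\<lambda>c. bin_fm k [c] (\<lambda>k s r. \<^bold>\<exists>k. \<^bold>\<exists>(k+1). mem (k+2) (pair_tm s (Var k)) \<^bold>\<and>
       mem (k+2) (pair_tm r (Var (k+1))) \<^bold>\<and>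
       y \<^bold>= pair_tm (num c) (pair_tm (Var k) (Var (k+1)))) x) binary_st) \<^bold>\<or>
     Disj (map (\<lambda>c. bin_fm k [c] (\<lambda>k w s. (w \<^bold>= v \<^bold>\<and> y \<^bold>= x) \<^bold>\<or>
       ((\<^bold>\<not> (w \<^bold>= v)) \<^bold>\<and> (\<^bold>\<exists>k. mem (k+1) (pair_tm s (Var k)) \<^bold>\<and>
         y \<^bold>= pair_tm (num c) (pair_tm w (Var k))))) x) [16, 17]))"

definition Sbt_fm :: "nat \<Rightarrow> tm \<Rightarrow> tm \<Rightarrow> tm \<Rightarrow> tm \<Rightarrow> fm" where
  "Sbt_fm k x t v y = Ind_fm k (\<lambda>k mem z. \<^bold>\<exists>k. \<^bold>\<exists>(k+1). z \<^bold>= pair_tm (Var k) (Var (k+1)) \<^bold>\<and>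
      sbt_step t v (k+2) mem (Var k) (Var (k+1))) (pair_tm x y)"

definition FreeFor_fm :: "nat \<Rightarrow> tm \<Rightarrow> tm \<Rightarrow> tm \<Rightarrow> fm" where
  "FreeFor_fm k t v x = Ind_fm k (\<lambda>k mem y.
      un_fm k [7, 8, 9, 11] (\<lambda>k s. s \<^bold>= s) y \<^bold>\<or>
      bin_fm k [6, 10] (\<lambda>k r s. s \<^bold>= s) y \<^bold>\<or>
      un_fm k [12] mem y \<^bold>\<or>
      bin_fm k [13, 14, 15] (\<lambda>k r s. mem k r \<^bold>\<and> mem k s) y \<^bold>\<or>
      bin_fm k [16, 17] (\<lambda>k w s. NotFree_fm k v y \<^bold>\<or> (NotFree_fm k w t \<^bold>\<and> mem k s)) y) x"

text \<open>\<open>t\<close> is (the code of) the numeral of \<open>n\<close>. Since \<open>gq A = num (gc A)\<close>, this represents,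
  on codes, the function \<open>gq\<close> as well.\<close>

definition Num_fm :: "nat \<Rightarrow> tm \<Rightarrow> tm \<Rightarrow> fm" where
  "Num_fm k n t = Ind_fm k (\<lambda>k mem z.
      z \<^bold>= pair_tm Zero (num (gct Zero)) \<^bold>\<or>
      (\<^bold>\<exists>k. \<^bold>\<exists>(k+1). z \<^bold>= pair_tm (Succ (Var k)) (pair_tm (num 2) (Var (k+1))) \<^bold>\<and>
         mem (k+2) (pair_tm (Var k) (Var (k+1))))) (pair_tm n t)"

text \<open>\<open>n\<close> is the value of the closed arithmetical term \<open>t\<close>.\<close>

definition val_step :: "nat \<Rightarrow> (nat \<Rightarrow> tm \<Rightarrow> fm) \<Rightarrow> tm \<Rightarrow> fm" where
  "val_step k mem z =
    (z \<^bold>= pair_tm (num (gct Zero)) Zero \<^bold>\<or>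
     (\<^bold>\<exists>k. \<^bold>\<exists>(k+1). z \<^bold>= pair_tm (pair_tm (num 2) (Var k)) (Succ (Var (k+1))) \<^bold>\<and>
        mem (k+2) (pair_tm (Var k) (Var (k+1)))) \<^bold>\<or>
     (\<^bold>\<exists>k. \<^bold>\<exists>(k+1). \<^bold>\<exists>(k+2). \<^bold>\<exists>(k+3).
        mem (k+4) (pair_tm (Var k) (Var (k+1))) \<^bold>\<and> mem (k+4) (pair_tm (Var (k+2)) (Var (k+3))) \<^bold>\<and>
        (z \<^bold>= pair_tm (pair_tm (num 3) (pair_tm (Var k) (Var (k+2)))) (Add (Var (k+1)) (Var (k+3))) \<^bold>\<or>
         z \<^bold>= pair_tm (pair_tm (num 4) (pair_tm (Var k) (Var (k+2)))) (Mul (Var (k+1)) (Var (k+3))))))"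

definition Val_fm :: "nat \<Rightarrow> tm \<Rightarrow> tm \<Rightarrow> fm" where
  "Val_fm k t n = Ind_fm k val_step (pair_tm t n)"

definition Gen_fm :: "nat \<Rightarrow> tm \<Rightarrow> tm \<Rightarrow> fm" where
  "Gen_fm k x y = Ind_fm k (\<lambda>k mem z.
      z \<^bold>= x \<^bold>\<or> bin_fm k [16] (\<lambda>k v s. Var_fm k v \<^bold>\<and> mem k s) z) y"

text \<open>The sixteen disjuncts correspond to those of the definition of the logical schemas.
  This formula is applied only to codes of formulas, so that \<open>a\<close>, \<open>b\<close>, \<open>c\<close> range over
  codes of formulas automatically wherever they are parts of \<open>x\<close>.\<close>

definition Schema_fm :: "nat \<Rightarrow> tm \<Rightarrow> fm" where
  "Schema_fm k x =
    (let a = Var k; b = Var (k+1); c = Var (k+2);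
         v = Var (k+3); s = Var (k+4); t = Var (k+5); j = k + 6
     in \<^bold>\<exists>k. \<^bold>\<exists>(k+1). \<^bold>\<exists>(k+2). \<^bold>\<exists>(k+3). \<^bold>\<exists>(k+4). \<^bold>\<exists>(k+5). Disj [
       x \<^bold>= imp_tm a (imp_tm b a),
       x \<^bold>= imp_tm (imp_tm a (imp_tm b c)) (imp_tm (imp_tm a b) (imp_tm a c)),
       x \<^bold>= imp_tm (imp_tm (neg_tm a) (neg_tm b)) (imp_tm b a),
       x \<^bold>= imp_tm (and_tm a b) a,
       x \<^bold>= imp_tm (and_tm a b) b,
       x \<^bold>= imp_tm a (imp_tm b (and_tm a b)),
       x \<^bold>= imp_tm a (or_tm a b),
       x \<^bold>= imp_tm b (or_tm a b),
       x \<^bold>= imp_tm (imp_tm a c) (imp_tm (imp_tm b c) (imp_tm (or_tm a b) c)),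
       Term_fm j t \<^bold>\<and> FreeFor_fm j t v a \<^bold>\<and> Sbt_fm j a t v b \<^bold>\<and> x \<^bold>= imp_tm (all_tm v a) b,
       x \<^bold>= imp_tm (all_tm v (imp_tm a b)) (imp_tm (all_tm v a) (all_tm v b)),
       NotFree_fm j v a \<^bold>\<and> x \<^bold>= imp_tm a (all_tm v a),
       x \<^bold>= imp_tm (ex_tm v a) (neg_tm (all_tm v (neg_tm a))),
       x \<^bold>= imp_tm (neg_tm (all_tm v (neg_tm a))) (ex_tm v a),
       x \<^bold>= pair_tm (num 6) (pair_tm t t),
       Form_fm j c \<^bold>\<and> Var_fm j v \<^bold>\<and> FreeFor_fm j s v c \<^bold>\<and> FreeFor_fm j t v c \<^bold>\<and>
         Sbt_fm j c s v a \<^bold>\<and> Sbt_fm j c t v b \<^bold>\<and>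
         x \<^bold>= imp_tm (pair_tm (num 6) (pair_tm s t)) (imp_tm a b)])"

definition LogAx_fm :: "nat \<Rightarrow> tm \<Rightarrow> fm" where
  "LogAx_fm k y =
    (Sent_fm k y \<^bold>\<and> (\<^bold>\<exists>k. Gen_fm (k+1) (Var k) y \<^bold>\<and> Schema_fm (k+1) (Var k)))"

definition IndAx_fm :: "nat \<Rightarrow> tm \<Rightarrow> fm" where
  "IndAx_fm k x =
    (let v = Var k; a = Var (k+1); b = Var (k+2); c = Var (k+3); j = k + 4
     in \<^bold>\<exists>k. \<^bold>\<exists>(k+1). \<^bold>\<exists>(k+2). \<^bold>\<exists>(k+3).
       x \<^bold>= imp_tm (and_tm b (all_tm v (imp_tm a c))) (all_tm v a) \<^bold>\<and>
       Sbt_fm j a (num (gct Zero)) v b \<^bold>\<and> Sbt_fm j a (pair_tm (num 2) v) v c)"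

definition PAAx_fm :: "nat \<Rightarrow> tm \<Rightarrow> fm" where
  "PAAx_fm k y =
    (Disj (map (\<lambda>A. y \<^bold>= gq A) [PA1, PA2, PA3, PA4, PA5, PA6]) \<^bold>\<or>
     (Sent_fm k y \<^bold>\<and> (\<^bold>\<exists>k. Gen_fm (k+1) (Var k) y \<^bold>\<and> IndAx_fm (k+1) (Var k))))"


section \<open>The system \<open>DCB\<close>\<close>

definition NonTriv :: fm where
  "NonTriv = (\<^bold>\<exists>0. PAg v0)"

definition K1K2 :: fm where
  "K1K2 = (\<^bold>\<forall>0. Sent_fm 1 v0 \<^bold>\<rightarrow> (PK1 v0 \<^bold>\<leftrightarrow> (\<^bold>\<forall>1. PAg v1 \<^bold>\<rightarrow> PK2 v1 v0)))"

definition UKK :: fm where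
  "UKK = (\<^bold>\<forall>0. PAg v0 \<^bold>\<rightarrow> (\<^bold>\<forall>1. Sent_fm 2 v1 \<^bold>\<rightarrow> (\<^bold>\<forall>2. Sent_fm 3 v2 \<^bold>\<rightarrow>
      PK2 v0 v1 \<^bold>\<and> PK2 v0 (imp_tm v1 v2) \<^bold>\<rightarrow> PK2 v0 v2)))"

text \<open>Provability of \<open>x\<close> in the system whose non-logical axioms are those of arithmetic,
  the preceding three axioms and the sentence coded by \<open>r\<close>.\<close>

definition PrFrom_fm :: "nat \<Rightarrow> tm \<Rightarrow> tm \<Rightarrow> fm" where
  "PrFrom_fm k r x = Ind_fm k (\<lambda>k mem y.
      LogAx_fm k y \<^bold>\<or> PAAx_fm k y \<^bold>\<or>
      y \<^bold>= gq NonTriv \<^bold>\<or> y \<^bold>= gq K1K2 \<^bold>\<or> y \<^bold>= gq UKK \<^bold>\<or> y \<^bold>= r \<^bold>\<or>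
      (\<^bold>\<exists>k. mem (k+1) (Var k) \<^bold>\<and> mem (k+1) (imp_tm (Var k) y))) x"

definition R_schema :: "(nat \<Rightarrow> tm \<Rightarrow> fm) \<Rightarrow> fm" where
  "R_schema P = (\<^bold>\<forall>1. PAg v1 \<^bold>\<rightarrow> (\<^bold>\<forall>2. Sent_fm 3 v2 \<^bold>\<rightarrow> P 3 v2 \<^bold>\<rightarrow> PK2 v1 v2))"

text \<open>Fixed-point construction. The diagonalization of a formula is the result of substituting the
  numeral of its code for variable \<open>0\<close>. \<open>PrDiag_fm k t x\<close> expresses that \<open>x\<close> is provable from the
  axioms above together with the diagonalization of the formula coded by \<open>t\<close>. Since the
  diagonalization of \<open>R_diag\<close> is \<open>R_DCB\<close> itself, \<open>Pr_DCB_fm\<close> expresses provability in \<open>DCB\<close>.\<close>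

definition PrDiag_fm :: "nat \<Rightarrow> tm \<Rightarrow> tm \<Rightarrow> fm" where
  "PrDiag_fm k t x =
    (let d = Var k; n = Var (k+1); r = Var (k+2)
     in \<^bold>\<exists>k. d \<^bold>= t \<^bold>\<and> (\<^bold>\<exists>(k+1). Num_fm (k+2) d n \<^bold>\<and>
          (\<^bold>\<exists>(k+2). Sbt_fm (k+3) d n (num (gct v0)) r \<^bold>\<and> PrFrom_fm (k+3) r x)))"

definition R_diag :: fm where
  "R_diag = R_schema (\<lambda>k x. PrDiag_fm k v0 x)"

definition Pr_DCB_fm :: "nat \<Rightarrow> tm \<Rightarrow> fm" where
  "Pr_DCB_fm k x = PrDiag_fm k (gq R_diag) x"

definition R_DCB :: fm where
  "R_DCB = R_schema Pr_DCB_fm"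

definition DCB_axioms :: "fm set" where
  "DCB_axioms = PA_axioms \<union> {NonTriv, K1K2, UKK, R_DCB}"

definition DCB :: "fm set" where
  "DCB = thms DCB_axioms {}"


section \<open>The systems \<open>FS\<close> and \<open>KT\<close>\<close>

text \<open>Every function symbol belongs to the language without \<open>K\<close> and \<open>T\<close>, so the terms are
  unrestricted.\<close>

primrec Lminus_atom :: "fm \<Rightarrow> bool" where
  "Lminus_atom (s \<^bold>= t) = True"
| "Lminus_atom (PU t) = True"
| "Lminus_atom (PAg t) = True"
| "Lminus_atom (PK1 t) = False"
| "Lminus_atom (PK2 s t) = False"
| "Lminus_atom (PT t) = False"
| "Lminus_atom (\<^bold>\<not> A) = False"
| "Lminus_atom (A \<^bold>\<rightarrow> B) = False"
| "Lminus_atom (A \<^bold>\<and> B) = False"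
| "Lminus_atom (A \<^bold>\<or> B) = False"
| "Lminus_atom (\<^bold>\<forall>x. A) = False"
| "Lminus_atom (\<^bold>\<exists>x. A) = False"

text \<open>\<open>T_atom_fm k c A xs\<close>: for all closed arithmetical terms, one for each variable \<open>x\<close> in the
  list \<open>xs\<close>, if their values are assigned to the variables in \<open>xs\<close> then \<open>A\<close> holds iff
  truth holds of the code obtained from \<open>c\<close> by substituting the terms for the
  variables in \<open>xs\<close>.\<close>

primrec T_atom_fm :: "nat \<Rightarrow> tm \<Rightarrow> fm \<Rightarrow> nat list \<Rightarrow> fm" where
  "T_atom_fm k c A [] = (PT c \<^bold>\<leftrightarrow> A)"
| "T_atom_fm k c A (x # xs) =
    (\<^bold>\<forall>k. TermPA0_fm (k+1) (Var k) \<^bold>\<rightarrow>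
      (\<^bold>\<exists>x. Val_fm (k+1) (Var k) (Var x) \<^bold>\<and>
        (\<^bold>\<exists>(k+1). Sbt_fm (k+2) c (Var k) (num (gct (Var x))) (Var (k+1)) \<^bold>\<and>
          T_atom_fm (k+2) (Var (k+1)) A xs)))"

definition T_atom :: "fm \<Rightarrow> fm" where
  "T_atom A =
    (let xs = sorted_list_of_set (fv A); k = Suc (Max (insert 0 (fv A)))
     in T_atom_fm k (gq A) A xs)"

definition T_neg :: fm where
  "T_neg = (\<^bold>\<forall>0. Sent_fm 1 v0 \<^bold>\<rightarrow> (PT (neg_tm v0) \<^bold>\<leftrightarrow> (\<^bold>\<not> PT v0)))"

definition T_bin :: "(tm \<Rightarrow> tm \<Rightarrow> tm) \<Rightarrow> (fm \<Rightarrow> fm \<Rightarrow> fm) \<Rightarrow> fm" where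
  "T_bin ctm conn = (\<^bold>\<forall>0. Sent_fm 1 v0 \<^bold>\<rightarrow> (\<^bold>\<forall>1. Sent_fm 2 v1 \<^bold>\<rightarrow>
      (PT (ctm v0 v1) \<^bold>\<leftrightarrow> conn (PT v0) (PT v1))))"

definition T_all :: fm where
  "T_all = (\<^bold>\<forall>0. Var_fm 1 v0 \<^bold>\<rightarrow> (\<^bold>\<forall>1. L1_fm 2 v0 v1 \<^bold>\<rightarrow>
      (PT (all_tm v0 v1) \<^bold>\<leftrightarrow>
        (\<^bold>\<forall>2. TermL0_fm 3 v2 \<^bold>\<rightarrow> (\<^bold>\<exists>3. Sbt_fm 4 v1 v2 v0 v3 \<^bold>\<and> PT v3)))))"

definition T_ex :: fm where
  "T_ex = (\<^bold>\<forall>0. Var_fm 1 v0 \<^bold>\<rightarrow> (\<^bold>\<forall>1. L1_fm 2 v0 v1 \<^bold>\<rightarrow>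
      (PT (ex_tm v0 v1) \<^bold>\<leftrightarrow>
        (\<^bold>\<exists>2. TermL0_fm 3 v2 \<^bold>\<and> (\<^bold>\<exists>3. Sbt_fm 4 v1 v2 v0 v3 \<^bold>\<and> PT v3)))))"

definition FS_axioms :: "fm set" where
  "FS_axioms = PA_axioms \<union> {T_atom A | A. Lminus_atom A} \<union>
    {T_neg, T_bin imp_tm Imp, T_bin and_tm And, T_bin or_tm Or, T_all, T_ex}"

definition NEC_T :: "(fm \<times> fm) set" where
  "NEC_T = {(A, PT (gq A)) | A. sentence A}"

definition CONEC_T :: "(fm \<times> fm) set" where
  "CONEC_T = {(PT (gq A), A) | A. sentence A}"

definition FS_rules :: "(fm \<times> fm) set" where
  "FS_rules = NEC_T \<union> CONEC_T"

definition FS :: "fm set" where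
  "FS = thms FS_axioms FS_rules"

definition Ax_V :: fm where
  "Ax_V = (\<^bold>\<forall>0. PAg v0 \<^bold>\<rightarrow> (\<^bold>\<forall>1. Sent_fm 2 v1 \<^bold>\<rightarrow> PK2 v0 v1 \<^bold>\<rightarrow> PT v1))"

definition NEC_K :: "(fm \<times> fm) set" where
  "NEC_K = {(A, \<^bold>\<forall>0. PAg v0 \<^bold>\<rightarrow> PK2 v0 (gq A)) | A. sentence A}"

definition KT_axioms :: "fm set" where
  "KT_axioms = DCB_axioms \<union> FS_axioms \<union> {Ax_V}"

definition KT_rules :: "(fm \<times> fm) set" where
  "KT_rules = FS_rules \<union> NEC_K"

definition KT :: "fm set" where
  "KT = thms KT_axioms KT_rules"

text \<open>The extension of \<open>KT\<close> by further axioms; the rules apply to all theorems of the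
  extension.\<close>

definition KT_plus :: "fm set \<Rightarrow> fm set" where
  "KT_plus X = thms (KT_axioms \<union> X) KT_rules"


section \<open>Supplementary axioms\<close>

definition UBF :: fm where
  "UBF = (\<^bold>\<forall>0. PAg v0 \<^bold>\<rightarrow> (\<^bold>\<forall>1. Var_fm 2 v1 \<^bold>\<rightarrow> (\<^bold>\<forall>2. L1_fm 3 v1 v2 \<^bold>\<rightarrow>
      (\<^bold>\<forall>3. TermPA0_fm 4 v3 \<^bold>\<rightarrow> (\<^bold>\<exists>4. Sbt_fm 5 v2 v3 v1 (Var 4) \<^bold>\<and> PK2 v0 (Var 4))) \<^bold>\<rightarrow>
      PK2 v0 (all_tm v1 v2))))"

text \<open>Below, \<open>v2\<close> is the value of \<open>gq\<close> at \<open>v1\<close> and \<open>v3\<close> is the value of \<open>num\<close> at \<open>v0\<close>.\<close>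

definition IA :: fm where
  "IA = (\<^bold>\<forall>0. PAg v0 \<^bold>\<rightarrow> (\<^bold>\<forall>1. Sent_fm 2 v1 \<^bold>\<rightarrow>
      (\<^bold>\<exists>2. Num_fm 3 v1 v2 \<^bold>\<and> (\<^bold>\<exists>3. Num_fm 4 v0 v3 \<^bold>\<and>
        (PK2 v0 (T_tm v2) \<^bold>\<leftrightarrow> PT (K2_tm v3 v2))))))"

definition In_plus :: fm where
  "In_plus = (\<^bold>\<forall>0. PAg v0 \<^bold>\<rightarrow> (\<^bold>\<forall>1. Sent_fm 2 v1 \<^bold>\<rightarrow>
      (\<^bold>\<exists>2. Num_fm 3 v1 v2 \<^bold>\<and> (\<^bold>\<exists>3. Num_fm 4 v0 v3 \<^bold>\<and>
        (PK2 v0 (T_tm v2) \<^bold>\<rightarrow> PK2 v0 (K2_tm v3 v2))))))"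

definition In_minus :: fm where
  "In_minus = (\<^bold>\<forall>0. PAg v0 \<^bold>\<rightarrow> (\<^bold>\<forall>1. Sent_fm 2 v1 \<^bold>\<rightarrow>
      (\<^bold>\<exists>2. Num_fm 3 v1 v2 \<^bold>\<and> (\<^bold>\<exists>3. Num_fm 4 v0 v3 \<^bold>\<and>
        ((\<^bold>\<not> PK2 v0 (T_tm v2)) \<^bold>\<rightarrow> PK2 v0 (neg_tm (K2_tm v3 v2)))))))"


section \<open>Agency frames and revision\<close>

text \<open>An expansion of the standard model to the symbols \<open>U\<close>, \<open>u\<close>, \<open>Ag\<close> that interprets \<open>Ag\<close> by the
  fixed set \<open>G\<close> is given by a \<open>world\<close>, i.e. the interpretations of \<open>U\<close> and \<open>u\<close>.\<close>

definition agency_frame :: "nat set \<Rightarrow> world set \<Rightarrow> (nat \<Rightarrow> (world \<times> world) set) \<Rightarrow> bool" where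
  "agency_frame G W R \<longleftrightarrow> (\<forall>\<alpha>\<in>G. R \<alpha> \<subseteq> W \<times> W)"

definition f_ag :: "(nat \<Rightarrow> (world \<times> world) set) \<Rightarrow> (world \<Rightarrow> nat set) \<Rightarrow> nat \<Rightarrow> world \<Rightarrow> nat set" where
  "f_ag R f \<alpha> w = \<Inter>{f v | v. (w, v) \<in> R \<alpha>}"

definition f_K :: "nat set \<Rightarrow> (nat \<Rightarrow> (world \<times> world) set) \<Rightarrow> (world \<Rightarrow> nat set) \<Rightarrow> world \<Rightarrow>
    (nat \<times> nat) set" where
  "f_K G R f w = {(\<alpha>, n). \<alpha> \<in> G \<and> n \<in> f_ag R f \<alpha> w}"

definition expand :: "nat set \<Rightarrow> (nat \<Rightarrow> (world \<times> world) set) \<Rightarrow> (world \<Rightarrow> nat set) \<Rightarrow> world \<Rightarrow>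
    lstruct" where
  "expand G R f w = \<lparr>Uint = Uint w, uint = uint w, Agint = G,
     K1int = {n. \<forall>\<alpha>\<in>G. (\<alpha>, n) \<in> f_K G R f w}, K2int = f_K G R f w, Tint = f w\<rparr>"

definition Gam :: "nat set \<Rightarrow> (nat \<Rightarrow> (world \<times> world) set) \<Rightarrow> (world \<Rightarrow> nat set) \<Rightarrow>
    (world \<Rightarrow> nat set)" where
  "Gam G R f w = {gc A | A. sentence A \<and> expand G R f w \<Turnstile> A}"

definition Euclidean :: "('a \<times> 'a) set \<Rightarrow> bool" where
  "Euclidean r \<longleftrightarrow> (\<forall>a b c. (a, b) \<in> r \<longrightarrow> (a, c) \<in> r \<longrightarrow> (b, c) \<in> r)"


section \<open>Adequacy of the arithmetization\<close>

text \<open>In every structure the formulas above define the intended syntactic relations; see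
  \<open>sat_Sent\<close>, \<open>sat_L1\<close>, \<open>sat_TermL0\<close>, \<open>sat_TermPA0\<close>, \<open>sat_Sbt_f\<close>, \<open>sat_Num\<close>,
  \<open>sat_Val\<close>, \<open>sat_LogAx\<close>, \<open>sat_PAAx\<close>, \<open>sat_T_atom\<close> and, for the provability predicate, \<open>sat_PrDCB\<close>.
  The fixed-point property of \<open>R_DCB\<close> is \<open>fixpoint\<close>; all axioms are sentences by \<open>closed\<close>, \<open>closed_PA\<close> and
  \<open>closed_T_atom\<close>.\<close>

definition tb :: "nat \<Rightarrow> tm \<Rightarrow> bool" where "tb k t \<longleftrightarrow> (\<forall>i\<in>fvt t. i < k)"

lemma tb_simps [simp]:
  "tb k (Var i) \<longleftrightarrow> i < k" "tb k Zero" "tb k (Succ t) \<longleftrightarrow> tb k t"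
  "tb k (Add s t) \<longleftrightarrow> tb k s \<and> tb k t" "tb k (Mul s t) \<longleftrightarrow> tb k s \<and> tb k t"
  "tb k (pair_tm s t) \<longleftrightarrow> tb k s \<and> tb k t"
  by (auto simp: tb_def pair_tm_def)

lemma fvt_num [simp]: "fvt (num n) = {}" by (induction n) auto
lemma tb_num [simp]: "tb k (num n)" by (simp add: tb_def)
lemma val_num [simp]: "val M e (num n) = n" by (induction n) auto
lemma val_pair [simp]: "val M e (pair_tm s t) = npair (val M e s) (val M e t)"
  by (simp add: pair_tm_def npair_def)
lemma fvt_pair [simp]: "fvt (pair_tm s t) = fvt s \<union> fvt t" by (auto simp add: pair_tm_def)

lemma tb_mono: "tb k t \<Longrightarrow> k \<le> j \<Longrightarrow> tb j t" by (auto simp: tb_def)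

lemma val_agree0: "\<forall>i\<in>fvt t. e' i = e i \<Longrightarrow> val M e' t = val M e t"
  by (induction t) auto
lemma val_agree: "tb k t \<Longrightarrow> \<forall>i<k. e' i = e i \<Longrightarrow> val M e' t = val M e t"
  by (rule val_agree0) (auto simp: tb_def)
lemma val_upd [simp]: "tb k t \<Longrightarrow> val M (e(k := n)) t = val M e t"
  by (rule val_agree) auto

lemma npair_le: "a \<le> npair a b" "b \<le> npair a b" 
proof -
  show "a \<le> npair a b" by (simp add: npair_def)
  have "b \<le> (a+b)*(a+b)"
    by (metis (no_types) le_add2 le_square le_trans)
  then show "b \<le> npair a b" by (simp add: npair_def)
qed

lemma npair_inj [simp]: "npair a b = npair c d \<longleftrightarrow> a = c \<and> b = d"
proof
  assume h: "npair a b = npair c d"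
  have *: False if "x + y < z + w" "npair x y = npair z w" for x y z w :: nat
  proof -
    have "(x+y+1)*(x+y+1) \<le> (z+w)*(z+w)" using that by (intro mult_le_mono) auto
    then show False using that(2) by (simp add: npair_def algebra_simps)
  qed
  have "a + b = c + d" using *[of a b c d] *[of c d a b] h by (metis nat_neq_iff)
  then show "a = c \<and> b = d" using h by (auto simp: npair_def)
qed auto

lemma gct_inj [simp]: "gct s = gct t \<longleftrightarrow> s = t"
proof (induction s arbitrary: t)
  case (Var x) then show ?case by (cases t) auto
next case Zero then show ?case by (cases t) auto
next case (Succ s) then show ?case by (cases t) auto
next case (Add s1 s2) then show ?case by (cases t) auto
next case (Mul s1 s2) then show ?case by (cases t) auto
next case (Fu s) then show ?case by (cases t) auto
qed

lemma gc_inj [simp]: "gc A = gc B \<longleftrightarrow> A = B"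
proof (induction A arbitrary: B)
  case (Eq x1 x2) then show ?case by (cases B) auto
next case (PU x) then show ?case by (cases B) auto
next case (PAg x) then show ?case by (cases B) auto
next case (PK1 x) then show ?case by (cases B) auto
next case (PK2 x1 x2) then show ?case by (cases B) auto
next case (PT x) then show ?case by (cases B) auto
next case (Neg A) then show ?case by (cases B) auto
next case (Imp A1 A2) then show ?case by (cases B) auto
next case (And A1 A2) then show ?case by (cases B) auto
next case (Or A1 A2) then show ?case by (cases B) auto
next case (Forall x A) then show ?case by (cases B) auto
next case (Exists x A) then show ?case by (cases B) auto
qed

lemma sat_le [simp]: "tb k s \<Longrightarrow> tb k t \<Longrightarrow> sat M e (le_fm k s t) \<longleftrightarrow> val M e s \<le> val M e t"
  by (auto simp: le_fm_def le_iff_add eq_commute)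
lemma sat_less [simp]: "tb k s \<Longrightarrow> tb k t \<Longrightarrow> sat M e (less_fm k s t) \<longleftrightarrow> val M e s < val M e t"
  by (auto simp: less_fm_def)

definition bet :: "nat \<Rightarrow> nat \<Rightarrow> nat \<Rightarrow> nat" where "bet a b i = a mod Suc (Suc i * b)"

lemma sat_beta [simp]:
  assumes "tb k a" "tb k b" "tb k i" "tb k y"
  shows "sat M e (beta_fm k a b i y) \<longleftrightarrow> val M e y = bet (val M e a) (val M e b) (val M e i)"
proof -
  have *: "(y \<le> m \<and> (\<exists>q. a = q * Suc m + y)) \<longleftrightarrow> y = a mod Suc m" for y m a :: nat
  proof
    assume "y = a mod Suc m"
    then show "y \<le> m \<and> (\<exists>q. a = q * Suc m + y)"
      by (metis div_mult_mod_eq less_Suc_eq_le mod_less_divisor zero_less_Suc)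
  next
    assume "y \<le> m \<and> (\<exists>q. a = q * Suc m + y)" then show "y = a mod Suc m"
      by (metis le_imp_less_Suc mod_less mod_mult_self3)
  qed
  show ?thesis using assms *[of "val M e y" "Suc (val M e i) * val M e b" "val M e a"]
    by (simp add: beta_fm_def bet_def)
qed

lemma beta_ex: "\<exists>a b. \<forall>i<length xs. bet a b i = xs ! i"
proof -
  define N where "N = Suc (length xs + sum_list xs)"
  define b where "b = (fact N :: nat)"
  have cop: "coprime (Suc (Suc i * b)) (Suc (Suc j * b))" if "i < j" "j < length xs" for i j
  proof (rule ccontr)
    assume "\<not> coprime (Suc (Suc i * b)) (Suc (Suc j * b))"
    then obtain c where c: "c dvd Suc (Suc i * b)" "c dvd Suc (Suc j * b)" "c \<noteq> 1"
      by (auto simp: coprime_def)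
    then obtain p where p: "prime p" "p dvd Suc (Suc i * b)" "p dvd Suc (Suc j * b)"
      using prime_factor_nat[of c] dvd_trans by blast
    have "Suc (Suc j * b) = Suc (Suc i * b) + (j - i) * b" using that by (simp add: algebra_simps)
    then have "p dvd (j - i) * b" using p by (metis dvd_add_right_iff)
    then have "p dvd j - i \<or> p dvd b" using p prime_dvd_mult_iff by blast
    moreover have "j - i dvd b" unfolding b_def N_def
      by (rule dvd_fact) (use that in auto)
    ultimately have "p dvd b" using dvd_trans by blast
    then have "p dvd Suc i * b" by simp
    then have "p dvd 1" using p(2) by (metis dvd_add_right_iff Suc_eq_plus1)
    then show False using p by simp
  qed
  have "\<exists>x. \<forall>i\<in>{..<length xs}. [x = xs ! i] (mod Suc (Suc i * b))"
  proof (rule chinese_remainder_nat)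
    show "\<forall>i\<in>{..<length xs}. \<forall>j\<in>{..<length xs}. i \<noteq> j \<longrightarrow> coprime (Suc (Suc i * b)) (Suc (Suc j * b))"
      using cop by (metis coprime_commute lessThan_iff nat_neq_iff)
  qed auto
  then obtain a where a: "\<And>i. i < length xs \<Longrightarrow> [a = xs ! i] (mod Suc (Suc i * b))" by auto
  have "bet a b i = xs ! i" if "i < length xs" for i
  proof -
    have "xs ! i \<le> sum_list xs" using that by (simp add: elem_le_sum_list)
    also have "\<dots> < N" by (simp add: N_def)
    also have "N \<le> b" unfolding b_def by (rule fact_ge_self)
    finally have "xs ! i < Suc (Suc i * b)" by simp
    then show ?thesis using a[OF that] by (simp add: bet_def cong_def)
  qed
  then show ?thesis by blast
qed

definition SeqIn :: "(nat set \<Rightarrow> nat \<Rightarrow> bool) \<Rightarrow> nat \<Rightarrow> bool" where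
  "SeqIn S x \<longleftrightarrow> (\<exists>xs. xs \<noteq> [] \<and> last xs = x \<and> (\<forall>i<length xs. S (set (take i xs)) (xs ! i)))"

lemma SeqIn_induct:
  assumes "SeqIn S x" and step: "\<And>Q y. S Q y \<Longrightarrow> \<forall>z\<in>Q. P z \<Longrightarrow> P y"
  shows "P x"
proof -
  obtain xs where xs: "xs \<noteq> []" "last xs = x" "\<forall>i<length xs. S (set (take i xs)) (xs ! i)"
    using assms by (auto simp: SeqIn_def)
  have "i < length xs \<Longrightarrow> P (xs ! i)" for i
  proof (induction i rule: less_induct)
    case (less i)
    show ?case
      by (rule step[of "set (take i xs)"]) (use xs less in \<open>auto simp: in_set_conv_nth\<close>)
  qed
  then show ?thesis using xs by (metis diff_less last_conv_nth length_greater_0_conv zero_less_one)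
qed

lemma SeqIn_intro:
  assumes mono: "\<And>Q Q' y. S Q y \<Longrightarrow> Q \<subseteq> Q' \<Longrightarrow> S Q' y"
    and fin: "finite Q" and Q: "\<forall>z\<in>Q. SeqIn S z" and x: "S Q x"
  shows "SeqIn S x"
proof -
  have "\<exists>xs. Q \<subseteq> set xs \<and> (\<forall>i<length xs. S (set (take i xs)) (xs ! i))"
    using fin Q
  proof (induction Q rule: finite_induct)
    case empty then show ?case by (intro exI[of _ "[]"]) auto
  next
    case (insert z Q)
    then obtain xs where xs: "Q \<subseteq> set xs" "\<forall>i<length xs. S (set (take i xs)) (xs ! i)" by auto
    obtain ys where ys: "ys \<noteq> []" "last ys = z" "\<forall>i<length ys. S (set (take i ys)) (ys ! i)"
      using insert by (auto simp: SeqIn_def)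
    have "S (set (take i (xs @ ys))) ((xs @ ys) ! i)" if "i < length (xs @ ys)" for i
    proof (cases "i < length xs")
      case True then show ?thesis using xs by (simp add: nth_append)
    next
      case False
      then have "S (set (take (i - length xs) ys)) (ys ! (i - length xs))" using that ys by auto
      then show ?thesis using False by (auto simp: nth_append intro: mono)
    qed
    then show ?case using xs ys by (intro exI[of _ "xs @ ys"]) auto
  qed
  then obtain xs where xs: "Q \<subseteq> set xs" "\<forall>i<length xs. S (set (take i xs)) (xs ! i)" by auto
  have "S (set xs) x" using mono x xs by blast
  then show ?thesis unfolding SeqIn_def
    by (intro exI[of _ "xs @ [x]"]) (use xs in \<open>auto simp: nth_append less_Suc_eq\<close>)
qed

lemma sat_Ind:
  assumes x: "tb k x"
    and step: "\<And>k' mem Q e' y. k + 5 \<le> k' \<Longrightarrow> \<forall>i<k. e' i = e i \<Longrightarrow> tb k' y \<Longrightarrow>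
       (\<And>k'' e'' z. k' \<le> k'' \<Longrightarrow> \<forall>i<k'. e'' i = e' i \<Longrightarrow> tb k'' z \<Longrightarrow>
          sat M e'' (mem k'' z) \<longleftrightarrow> val M e'' z \<in> Q) \<Longrightarrow>
       sat M e' (step k' mem y) \<longleftrightarrow> S Q (val M e' y)"
  shows "sat M e (Ind_fm k step x) \<longleftrightarrow> SeqIn S (val M e x)"
proof -
  define mem where "mem = (\<lambda>j z. \<^bold>\<exists>j. less_fm (j+1) (Var j) (Var (k+3)) \<^bold>\<and> beta_fm (j+1) (Var k) (Var (k+1)) (Var j) z)"
  have st: "sat M (e(k := a, k+1 := b, k+2 := l, k+3 := i, k+4 := y)) (step (k+5) mem (Var (k+4)))
     \<longleftrightarrow> S {bet a b j | j. j < i} y" for a b l i y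
  proof -
    let ?e = "e(k := a, k+1 := b, k+2 := l, k+3 := i, k+4 := y)"
    have "sat M ?e (step (k+5) mem (Var (k+4))) \<longleftrightarrow> S {bet a b j | j. j < i} (val M ?e (Var (k+4)))"
    proof (rule step)
      fix k'' e'' z assume k: "k + 5 \<le> k''" and eq: "\<forall>i<k+5. e'' i = ?e i" and z: "tb k'' z"
      have "e'' k = a" "e'' (Suc k) = b" "e'' (k+3) = i" using eq by auto
      then show "sat M e'' (mem k'' z) \<longleftrightarrow> val M e'' z \<in> {bet a b j | j. j < i}"
        using k z tb_mono[OF z, of "Suc k''"] by (auto simp: mem_def)
    qed auto
    then show ?thesis by simp
  qed
  have tbx: "tb (k+1) x" "tb (k+2) x" "tb (k+3) x" using x tb_mono by (auto intro: tb_mono)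
  have "sat M e (Ind_fm k step x) \<longleftrightarrow>
    (\<exists>a b l. val M e x = bet a b l \<and> (\<forall>i\<le>l. S {bet a b j | j. j < i} (bet a b i)))"
    using x tbx st unfolding Ind_fm_def Let_def mem_def[symmetric]
    by (simp flip: mem_def add: tb_mono[of k x] One_nat_def[symmetric] del: One_nat_def)
  also have "\<dots> \<longleftrightarrow> SeqIn S (val M e x)"
  proof
    assume "\<exists>a b l. val M e x = bet a b l \<and> (\<forall>i\<le>l. S {bet a b j | j. j < i} (bet a b i))"
    then obtain a b l where l: "val M e x = bet a b l" "\<And>i. i\<le>l \<Longrightarrow> S {bet a b j | j. j < i} (bet a b i)"
      by auto
    have "set (take i (map (bet a b) [0..<Suc l])) = {bet a b j | j. j < i}" if "i \<le> l" for i
      using that by (auto simp: take_map take_upt simp del: upt_Suc)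
    then show "SeqIn S (val M e x)" unfolding SeqIn_def using l
      by (intro exI[of _ "map (bet a b) [0..<Suc l]"]) (auto simp: less_Suc_eq_le last_map simp del: upt_Suc)
  next
    assume "SeqIn S (val M e x)"
    then obtain xs where xs: "xs \<noteq> []" "last xs = val M e x" "\<forall>i<length xs. S (set (take i xs)) (xs ! i)"
      by (auto simp: SeqIn_def)
    obtain a b where ab: "\<And>i. i<length xs \<Longrightarrow> bet a b i = xs ! i" using beta_ex[of xs] by blast
    have eq: "set (take i xs) = {bet a b j | j. j < i}" if "i < length xs" for i
    proof -
      have "set (take i xs) = {xs ! j | j. j < i}" using that by (simp flip: nth_image) (auto simp: less_imp_le)
      also have "\<dots> = {bet a b j | j. j < i}" using ab that by (metis (no_types, lifting) less_trans)
      finally show ?thesis .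
    qed
    show "\<exists>a b l. val M e x = bet a b l \<and> (\<forall>i\<le>l. S {bet a b j | j. j < i} (bet a b i))"
    proof (intro exI conjI allI impI)
      show "val M e x = bet a b (length xs - 1)" using xs ab by (simp add: last_conv_nth)
      fix i assume "i \<le> length xs - 1"
      then have i: "i < length xs" using xs(1) by (metis Suc_pred' length_greater_0_conv less_Suc_eq_le)
      show "S {bet a b j | j. j < i} (bet a b i)" using xs(3) eq[OF i] ab[OF i] i by metis
    qed
  qed
  finally show ?thesis .
qed

lemma sat_Disj [simp]: "sat M e (Disj As) \<longleftrightarrow> (\<exists>A\<in>set As. sat M e A)"
  by (induction As) (auto simp: Disj_def)

lemma tb_Suc [simp]: "tb k t \<Longrightarrow> tb (Suc k) t" by (erule tb_mono) simp
lemma tb_add [simp]: "tb k t \<Longrightarrow> tb (k + n) t" by (erule tb_mono) simp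

lemma val_tms [simp]:
  "val M e (T_tm t) = npair 11 (val M e t)"
  "val M e (K2_tm s t) = npair 10 (npair (val M e s) (val M e t))"
  "val M e (neg_tm s) = npair 12 (val M e s)"
  "val M e (imp_tm s t) = npair 13 (npair (val M e s) (val M e t))"
  "val M e (and_tm s t) = npair 14 (npair (val M e s) (val M e t))"
  "val M e (or_tm s t) = npair 15 (npair (val M e s) (val M e t))"
  "val M e (all_tm s t) = npair 16 (npair (val M e s) (val M e t))"
  "val M e (ex_tm s t) = npair 17 (npair (val M e s) (val M e t))"
  by (simp_all add: T_tm_def K2_tm_def neg_tm_def imp_tm_def and_tm_def or_tm_def all_tm_def ex_tm_def)

lemma tb_tms [simp]:
  "tb k (T_tm t) = tb k t"
  "tb k (K2_tm s t) \<longleftrightarrow> tb k s \<and> tb k t"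
  "tb k (neg_tm s) = tb k s"
  "tb k (imp_tm s t) \<longleftrightarrow> tb k s \<and> tb k t"
  "tb k (and_tm s t) \<longleftrightarrow> tb k s \<and> tb k t"
  "tb k (or_tm s t) \<longleftrightarrow> tb k s \<and> tb k t"
  "tb k (all_tm s t) \<longleftrightarrow> tb k s \<and> tb k t"
  "tb k (ex_tm s t) \<longleftrightarrow> tb k s \<and> tb k t"
  by (simp_all add: T_tm_def K2_tm_def neg_tm_def imp_tm_def and_tm_def or_tm_def all_tm_def ex_tm_def)

lemma gq_simps [simp]: "val M e (gq A) = gc A" "tb k (gq A)" "fvt (gq A) = {}"
  by (simp_all add: gq_def)

lemma sat_Var [simp]: "tb k x \<Longrightarrow> sat M e (Var_fm k x) \<longleftrightarrow> (\<exists>i. val M e x = gct (Var i))"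
  by (auto simp: Var_fm_def)

lemma sat_un: "tb k y \<Longrightarrow> sat M e (un_fm k cs P y) \<longleftrightarrow>
    (\<exists>n. (\<exists>c\<in>set cs. val M e y = npair c n) \<and> sat M (e(k := n)) (P (Suc k) (Var k)))"
  by (auto simp: un_fm_def)

lemma sat_bin: "tb k y \<Longrightarrow> sat M e (bin_fm k cs P y) \<longleftrightarrow>
    (\<exists>m n. (\<exists>c\<in>set cs. val M e y = npair c (npair m n)) \<and>
      sat M (e(k := m, Suc k := n)) (P (Suc (Suc k)) (Var k) (Var (Suc k))))"
  by (auto simp: bin_fm_def)

lemma sat_term_gen:
  assumes "tb k x" and "\<And>k e y. tb k y \<Longrightarrow> sat M e (atom k y) \<longleftrightarrow> P (val M e y)"
  shows "sat M e (Ind_fm k (term_step atom u) x) \<longleftrightarrow>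
    SeqIn (\<lambda>Q y. P y \<or> (\<exists>n. (\<exists>c\<in>set u. y = npair c n) \<and> n \<in> Q) \<or>
      (\<exists>m n. (y = npair 3 (npair m n) \<or> y = npair 4 (npair m n)) \<and> m \<in> Q \<and> n \<in> Q)) (val M e x)"
  by (rule sat_Ind) (use assms in \<open>simp_all add: term_step_def sat_un sat_bin\<close>)


lemma SeqIn_eq:
  assumes mono: "\<And>Q Q' y. S Q y \<Longrightarrow> Q \<subseteq> Q' \<Longrightarrow> S Q' y"
    and cl: "\<And>Q y. S Q y \<Longrightarrow> Q \<subseteq> X \<Longrightarrow> y \<in> X"
    and ind: "(\<And>Q y. S Q y \<Longrightarrow> finite Q \<Longrightarrow> \<forall>z\<in>Q. SeqIn S z \<Longrightarrow> SeqIn S y) \<Longrightarrow> \<forall>z\<in>X. SeqIn S z"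
  shows "SeqIn S x \<longleftrightarrow> x \<in> X"
proof
  assume "SeqIn S x" then show "x \<in> X"
    by (rule SeqIn_induct) (use cl in blast)
next
  have "\<forall>z\<in>X. SeqIn S z"
    by (rule ind, rule SeqIn_intro[OF mono]) auto
  then show "x \<in> X \<Longrightarrow> SeqIn S x" by auto
qed

primrec PAtm :: "tm \<Rightarrow> bool" where
  "PAtm (Var x) = True" | "PAtm Zero = True" | "PAtm (Succ t) = PAtm t"
| "PAtm (Add s t) \<longleftrightarrow> PAtm s \<and> PAtm t" | "PAtm (Mul s t) \<longleftrightarrow> PAtm s \<and> PAtm t" | "PAtm (Fu t) = False"

definition "CTm = {gct t | t. True}"
definition "CTL0 = {gct t | t. fvt t = {}}"
definition "CTP0 = {gct t | t. PAtm t \<and> fvt t = {}}"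
definition "CFm = {gc A | A. True}"

lemma CTm_cl: "n \<in> CTm \<Longrightarrow> npair 2 n \<in> CTm" "n \<in> CTm \<Longrightarrow> npair 5 n \<in> CTm"
  "m \<in> CTm \<Longrightarrow> n \<in> CTm \<Longrightarrow> npair 3 (npair m n) \<in> CTm"
  "m \<in> CTm \<Longrightarrow> n \<in> CTm \<Longrightarrow> npair 4 (npair m n) \<in> CTm"
  "gct t \<in> CTm"
  by (auto simp: CTm_def intro: gct.simps[symmetric])
lemma CTL0_cl: "n \<in> CTL0 \<Longrightarrow> npair 2 n \<in> CTL0" "n \<in> CTL0 \<Longrightarrow> npair 5 n \<in> CTL0"
  "m \<in> CTL0 \<Longrightarrow> n \<in> CTL0 \<Longrightarrow> npair 3 (npair m n) \<in> CTL0"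
  "m \<in> CTL0 \<Longrightarrow> n \<in> CTL0 \<Longrightarrow> npair 4 (npair m n) \<in> CTL0"
  "gct Zero \<in> CTL0"
  unfolding CTL0_def mem_Collect_eq
  by (force intro: gct.simps[symmetric] exI[of _ Zero])+
lemma CTP0_cl: "n \<in> CTP0 \<Longrightarrow> npair 2 n \<in> CTP0"
  "m \<in> CTP0 \<Longrightarrow> n \<in> CTP0 \<Longrightarrow> npair 3 (npair m n) \<in> CTP0"
  "m \<in> CTP0 \<Longrightarrow> n \<in> CTP0 \<Longrightarrow> npair 4 (npair m n) \<in> CTP0"
  "gct Zero \<in> CTP0"
  unfolding CTP0_def mem_Collect_eq
  by (force intro: gct.simps[symmetric] exI[of _ Zero])+

lemma sat_Term [simp]:
  assumes "tb k x" shows "sat M e (Term_fm k x) \<longleftrightarrow> (\<exists>t. val M e x = gct t)"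
proof -
  let ?P = "\<lambda>y. (\<exists>i. y = gct (Var i)) \<or> y = gct Zero"
  let ?S = "\<lambda>Q y. ?P y \<or> (\<exists>n. (\<exists>c\<in>set [2,5]. y = npair c n) \<and> n \<in> Q) \<or>
      (\<exists>m n. (y = npair 3 (npair m n) \<or> y = npair 4 (npair m n)) \<and> m \<in> Q \<and> n \<in> Q)"
  have "sat M e (Term_fm k x) \<longleftrightarrow> SeqIn ?S (val M e x)"
    unfolding Term_fm_def by (rule sat_term_gen) (use assms in simp_all)
  also have "\<dots> \<longleftrightarrow> val M e x \<in> CTm"
  proof (rule SeqIn_eq)
    fix Q y assume "?S Q y" "Q \<subseteq> CTm"
    then show "y \<in> CTm"
      by (elim disjE exE conjE bexE) (auto simp del: gct.simps intro!: CTm_cl)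
  next
    assume st: "\<And>Q y. ?S Q y \<Longrightarrow> finite Q \<Longrightarrow> \<forall>z\<in>Q. SeqIn ?S z \<Longrightarrow> SeqIn ?S y"
    have "SeqIn ?S (gct t)" for t
    proof (induction t)
      case (Var x) show ?case by (rule st[of _ "{}"]) auto
    next case Zero show ?case by (rule st[of _ "{}"]) auto
    next case (Succ t) then show ?case by (intro st[of _ "{gct t}"]) auto
    next case (Add s t) then show ?case by (intro st[of _ "{gct s, gct t}"]) auto
    next case (Mul s t) then show ?case by (intro st[of _ "{gct s, gct t}"]) auto
    next case (Fu t) then show ?case by (intro st[of _ "{gct t}"]) auto
    qed
    then show "\<forall>z\<in>CTm. SeqIn ?S z" by (auto simp: CTm_def)
  qed blast
  finally show ?thesis by (auto simp: CTm_def)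
qed

lemma sat_TermL0 [simp]:
  assumes "tb k x" shows "sat M e (TermL0_fm k x) \<longleftrightarrow> (\<exists>t. fvt t = {} \<and> val M e x = gct t)"
proof -
  let ?S = "\<lambda>Q y. y = gct Zero \<or> (\<exists>n. (\<exists>c\<in>set [2,5]. y = npair c n) \<and> n \<in> Q) \<or>
      (\<exists>m n. (y = npair 3 (npair m n) \<or> y = npair 4 (npair m n)) \<and> m \<in> Q \<and> n \<in> Q)"
  have "sat M e (TermL0_fm k x) \<longleftrightarrow> SeqIn ?S (val M e x)"
    unfolding TermL0_fm_def by (rule sat_term_gen) (use assms in simp_all)
  also have "\<dots> \<longleftrightarrow> val M e x \<in> CTL0"
  proof (rule SeqIn_eq)
    fix Q y assume "?S Q y" "Q \<subseteq> CTL0"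
    then show "y \<in> CTL0"
      by (elim disjE exE conjE bexE) (auto simp del: gct.simps intro!: CTL0_cl)
  next
    assume st: "\<And>Q y. ?S Q y \<Longrightarrow> finite Q \<Longrightarrow> \<forall>z\<in>Q. SeqIn ?S z \<Longrightarrow> SeqIn ?S y"
    have "fvt t = {} \<Longrightarrow> SeqIn ?S (gct t)" for t
    proof (induction t)
      case (Var x) then show ?case by simp
    next case Zero show ?case by (rule st[of _ "{}"]) auto
    next case (Succ t) then show ?case by (intro st[of _ "{gct t}"]) auto
    next case (Add s t) then show ?case by (intro st[of _ "{gct s, gct t}"]) auto
    next case (Mul s t) then show ?case by (intro st[of _ "{gct s, gct t}"]) auto
    next case (Fu t) then show ?case by (intro st[of _ "{gct t}"]) auto
    qed
    then show "\<forall>z\<in>CTL0. SeqIn ?S z" by (auto simp: CTL0_def)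
  qed blast
  finally show ?thesis by (auto simp: CTL0_def)
qed

lemma sat_TermPA0 [simp]:
  assumes "tb k x" shows "sat M e (TermPA0_fm k x) \<longleftrightarrow> (\<exists>t. PAtm t \<and> fvt t = {} \<and> val M e x = gct t)"
proof -
  let ?S = "\<lambda>Q y. y = gct Zero \<or> (\<exists>n. (\<exists>c\<in>set [2]. y = npair c n) \<and> n \<in> Q) \<or>
      (\<exists>m n. (y = npair 3 (npair m n) \<or> y = npair 4 (npair m n)) \<and> m \<in> Q \<and> n \<in> Q)"
  have "sat M e (TermPA0_fm k x) \<longleftrightarrow> SeqIn ?S (val M e x)"
    unfolding TermPA0_fm_def by (rule sat_term_gen) (use assms in simp_all)
  also have "\<dots> \<longleftrightarrow> val M e x \<in> CTP0"
  proof (rule SeqIn_eq)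
    fix Q y assume "?S Q y" "Q \<subseteq> CTP0"
    then show "y \<in> CTP0"
      by (elim disjE exE conjE bexE) (auto simp del: gct.simps intro!: CTP0_cl)
  next
    assume st: "\<And>Q y. ?S Q y \<Longrightarrow> finite Q \<Longrightarrow> \<forall>z\<in>Q. SeqIn ?S z \<Longrightarrow> SeqIn ?S y"
    have "PAtm t \<Longrightarrow> fvt t = {} \<Longrightarrow> SeqIn ?S (gct t)" for t
    proof (induction t)
      case (Var x) then show ?case by simp
    next case Zero show ?case by (rule st[of _ "{}"]) auto
    next case (Succ t) then show ?case by (intro st[of _ "{gct t}"]) auto
    next case (Add s t) then show ?case by (intro st[of _ "{gct s, gct t}"]) auto
    next case (Mul s t) then show ?case by (intro st[of _ "{gct s, gct t}"]) auto
    next case (Fu t) then show ?case by simp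
    qed
    then show "\<forall>z\<in>CTP0. SeqIn ?S z" by (auto simp: CTP0_def)
  qed blast
  finally show ?thesis by (auto simp: CTP0_def)
qed

lemma CFm_cl:
  "npair 6 (npair (gct s) (gct t)) \<in> CFm" "npair 7 (gct t) \<in> CFm" "npair 8 (gct t) \<in> CFm"
  "npair 9 (gct t) \<in> CFm" "npair 10 (npair (gct s) (gct t)) \<in> CFm" "npair 11 (gct t) \<in> CFm"
  "n \<in> CFm \<Longrightarrow> npair 12 n \<in> CFm"
  "m \<in> CFm \<Longrightarrow> n \<in> CFm \<Longrightarrow> npair 13 (npair m n) \<in> CFm"
  "m \<in> CFm \<Longrightarrow> n \<in> CFm \<Longrightarrow> npair 14 (npair m n) \<in> CFm"
  "m \<in> CFm \<Longrightarrow> n \<in> CFm \<Longrightarrow> npair 15 (npair m n) \<in> CFm"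
  "n \<in> CFm \<Longrightarrow> npair 16 (npair (gct (Var i)) n) \<in> CFm"
  "n \<in> CFm \<Longrightarrow> npair 17 (npair (gct (Var i)) n) \<in> CFm"
  unfolding CFm_def mem_Collect_eq
  by (blast intro: gc.simps[symmetric])+

lemma sat_Form [simp]:
  assumes "tb k x" shows "sat M e (Form_fm k x) \<longleftrightarrow> (\<exists>A. val M e x = gc A)"
proof -
  let ?S = "\<lambda>Q y. (\<exists>n. (\<exists>c\<in>{7,8,9,11}. y = npair c n) \<and> (\<exists>t. n = gct t)) \<or>
     (\<exists>m n. (\<exists>c\<in>{6,10}. y = npair c (npair m n)) \<and> (\<exists>t. m = gct t) \<and> (\<exists>t. n = gct t)) \<or>
     (\<exists>n. y = npair 12 n \<and> n \<in> Q) \<or>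
     (\<exists>m n. (\<exists>c\<in>{13,14,15}. y = npair c (npair m n)) \<and> m \<in> Q \<and> n \<in> Q) \<or>
     (\<exists>m n. (\<exists>c\<in>{16,17}. y = npair c (npair m n)) \<and> (\<exists>i. m = gct (Var i)) \<and> n \<in> Q)"
  have "sat M e (Form_fm k x) \<longleftrightarrow> SeqIn ?S (val M e x)"
    unfolding Form_fm_def by (rule sat_Ind) (use assms in \<open>simp_all add: sat_un sat_bin\<close>)
  also have "\<dots> \<longleftrightarrow> val M e x \<in> CFm"
  proof (rule SeqIn_eq)
    fix Q y assume "?S Q y" "Q \<subseteq> CFm"
    then show "y \<in> CFm"
      by (elim disjE exE conjE bexE) (auto simp del: gct.simps intro!: CFm_cl)
  next
    assume st: "\<And>Q y. ?S Q y \<Longrightarrow> finite Q \<Longrightarrow> \<forall>z\<in>Q. SeqIn ?S z \<Longrightarrow> SeqIn ?S y"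
    have "SeqIn ?S (gc A)" for A
    proof (induction A)
      case (Eq s t) show ?case by (rule st[of _ "{}"]) auto
    next case (PU t) show ?case by (rule st[of _ "{}"]) auto
    next case (PAg t) show ?case by (rule st[of _ "{}"]) auto
    next case (PK1 t) show ?case by (rule st[of _ "{}"]) auto
    next case (PK2 s t) show ?case by (rule st[of _ "{}"]) auto
    next case (PT t) show ?case by (rule st[of _ "{}"]) auto
    next case (Neg A) then show ?case by (intro st[of _ "{gc A}"]) auto
    next case (Imp A B) then show ?case by (intro st[of _ "{gc A, gc B}"]) auto
    next case (And A B) then show ?case by (intro st[of _ "{gc A, gc B}"]) auto
    next case (Or A B) then show ?case by (intro st[of _ "{gc A, gc B}"]) auto
    next case (Forall x A) then show ?case by (intro st[of _ "{gc A}"]) auto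
    next case (Exists x A) then show ?case by (intro st[of _ "{gc A}"]) auto
    qed
    then show "\<forall>z\<in>CFm. SeqIn ?S z" by (auto simp: CFm_def)
  qed blast
  finally show ?thesis by (auto simp: CFm_def)
qed

lemma bex_cong_simps: "(\<exists>c\<in>set (map g xs). P c) = (\<exists>c\<in>set xs. P (g c))" by auto

definition "SNF V Q y \<longleftrightarrow> ((\<exists>i. y = gct (Var i)) \<and> y \<noteq> V) \<or> y = gct Zero \<or>
     (\<exists>n. (\<exists>c\<in>set [2, 5, 7, 8, 9, 11, 12]. y = npair c n) \<and> n \<in> Q) \<or>
     (\<exists>m n. (\<exists>c\<in>set [3, 4, 6, 10, 13, 14, 15]. y = npair c (npair m n)) \<and> m \<in> Q \<and> n \<in> Q) \<or>
     (\<exists>m n. (\<exists>c\<in>set [16, 17]. y = npair c (npair m n)) \<and> (m = V \<or> n \<in> Q))"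

lemma sat_NotFree0:
  assumes "tb k x" "tb k v"
  shows "sat M e (NotFree_fm k v x) \<longleftrightarrow> SeqIn (SNF (val M e v)) (val M e x)"
  unfolding NotFree_fm_def
proof (rule sat_Ind, fact, goal_cases)
  case (1 k' mem Q e' y)
  have v: "tb k' v" using 1 assms tb_mono by (metis add_leE)
  have [simp]: "val M e' v = val M e v" using assms 1(2) by (rule_tac val_agree) 
  show ?case using 1 v unfolding SNF_def by (simp add: sat_un sat_bin del: list.set)
qed

lemma SNF_step:
  "SNF V Q y \<Longrightarrow> finite Q \<Longrightarrow> \<forall>z\<in>Q. SeqIn (SNF V) z \<Longrightarrow> SeqIn (SNF V) y"
  by (rule SeqIn_intro[where S="SNF V" and Q=Q]) (unfold SNF_def, blast+)

lemma SNF_simps [simp]: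
  "SNF (gct (Var i)) Q (gct (Var j)) \<longleftrightarrow> i \<noteq> j"
  "SNF (gct (Var i)) Q (gct Zero)"
  "SNF (gct (Var i)) Q (gct (Succ t)) \<longleftrightarrow> gct t \<in> Q"
  "SNF (gct (Var i)) Q (gct (Fu t)) \<longleftrightarrow> gct t \<in> Q"
  "SNF (gct (Var i)) Q (gct (Add s t)) \<longleftrightarrow> gct s \<in> Q \<and> gct t \<in> Q"
  "SNF (gct (Var i)) Q (gct (Mul s t)) \<longleftrightarrow> gct s \<in> Q \<and> gct t \<in> Q"
  "SNF (gct (Var i)) Q (gc (PU t)) \<longleftrightarrow> gct t \<in> Q"
  "SNF (gct (Var i)) Q (gc (PAg t)) \<longleftrightarrow> gct t \<in> Q"
  "SNF (gct (Var i)) Q (gc (PK1 t)) \<longleftrightarrow> gct t \<in> Q"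
  "SNF (gct (Var i)) Q (gc (PT t)) \<longleftrightarrow> gct t \<in> Q"
  "SNF (gct (Var i)) Q (gc (Eq s t)) \<longleftrightarrow> gct s \<in> Q \<and> gct t \<in> Q"
  "SNF (gct (Var i)) Q (gc (PK2 s t)) \<longleftrightarrow> gct s \<in> Q \<and> gct t \<in> Q"
  "SNF (gct (Var i)) Q (gc (Neg A)) \<longleftrightarrow> gc A \<in> Q"
  "SNF (gct (Var i)) Q (gc (Imp A B)) \<longleftrightarrow> gc A \<in> Q \<and> gc B \<in> Q"
  "SNF (gct (Var i)) Q (gc (And A B)) \<longleftrightarrow> gc A \<in> Q \<and> gc B \<in> Q"
  "SNF (gct (Var i)) Q (gc (Or A B)) \<longleftrightarrow> gc A \<in> Q \<and> gc B \<in> Q"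
  "SNF (gct (Var i)) Q (gc (Forall x A)) \<longleftrightarrow> x = i \<or> gc A \<in> Q"
  "SNF (gct (Var i)) Q (gc (Exists x A)) \<longleftrightarrow> x = i \<or> gc A \<in> Q"
  unfolding SNF_def by simp_all blast+

lemma SNF_t: "i \<notin> fvt t \<Longrightarrow> SeqIn (SNF (gct (Var i))) (gct t)"
proof (induction t)
  case (Var x) then show ?case by (intro SNF_step[where Q="{}"]) (auto simp del: gct.simps)
next   case Zero then show ?case by (intro SNF_step[where Q="{}"]) (auto simp del: gct.simps)
next   case (Succ t) then show ?case by (intro SNF_step[where Q="{gct t}"]) (auto simp del: gct.simps)
next   case (Add s t) then show ?case by (intro SNF_step[where Q="{gct s, gct t}"]) (auto simp del: gct.simps)
next   case (Mul s t) then show ?case by (intro SNF_step[where Q="{gct s, gct t}"]) (auto simp del: gct.simps)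
next   case (Fu t) then show ?case by (intro SNF_step[where Q="{gct t}"]) (auto simp del: gct.simps)
qed

lemma SNF_f: "i \<notin> fv A \<Longrightarrow> SeqIn (SNF (gct (Var i))) (gc A)"
proof (induction A)
  case (Eq s t) then show ?case by (intro SNF_step[where Q="{gct s, gct t}"]) (auto simp del: gct.simps gc.simps intro: SNF_t split: if_splits)
next   case (PU t) then show ?case by (intro SNF_step[where Q="{gct t}"]) (auto simp del: gct.simps gc.simps intro: SNF_t split: if_splits)
next   case (PAg t) then show ?case by (intro SNF_step[where Q="{gct t}"]) (auto simp del: gct.simps gc.simps intro: SNF_t split: if_splits)
next   case (PK1 t) then show ?case by (intro SNF_step[where Q="{gct t}"]) (auto simp del: gct.simps gc.simps intro: SNF_t split: if_splits)
next   case (PK2 s t) then show ?case by (intro SNF_step[where Q="{gct s, gct t}"]) (auto simp del: gct.simps gc.simps intro: SNF_t split: if_splits)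
next   case (PT t) then show ?case by (intro SNF_step[where Q="{gct t}"]) (auto simp del: gct.simps gc.simps intro: SNF_t split: if_splits)
next   case (Neg A) then show ?case by (intro SNF_step[where Q="{gc A}"]) (auto simp del: gct.simps gc.simps intro: SNF_t split: if_splits)
next   case (Imp A B) then show ?case by (intro SNF_step[where Q="{gc A, gc B}"]) (auto simp del: gct.simps gc.simps intro: SNF_t split: if_splits)
next   case (And A B) then show ?case by (intro SNF_step[where Q="{gc A, gc B}"]) (auto simp del: gct.simps gc.simps intro: SNF_t split: if_splits)
next   case (Or A B) then show ?case by (intro SNF_step[where Q="{gc A, gc B}"]) (auto simp del: gct.simps gc.simps intro: SNF_t split: if_splits)
next case (Forall x A) then show ?case
    by (intro SNF_step[where Q="if x = i then {} else {gc A}"]) (auto simp del: gct.simps gc.simps intro: SNF_t split: if_splits)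
next case (Exists x A) then show ?case
    by (intro SNF_step[where Q="if x = i then {} else {gc A}"]) (auto simp del: gct.simps gc.simps intro: SNF_t split: if_splits)
qed

lemma SNF_D: "SeqIn (SNF (gct (Var i))) y \<Longrightarrow>
   (\<forall>t. y = gct t \<longrightarrow> i \<notin> fvt t) \<and> (\<forall>A. y = gc A \<longrightarrow> i \<notin> fv A)"
proof (erule SeqIn_induct, intro conjI allI impI)
  fix Q y t assume "SNF (gct (Var i)) Q y" "y = gct t"
    "\<forall>z\<in>Q. (\<forall>t. z = gct t \<longrightarrow> i \<notin> fvt t) \<and> (\<forall>A. z = gc A \<longrightarrow> i \<notin> fv A)"
  then show "i \<notin> fvt t" by (cases t) (auto simp del: gct.simps gc.simps)
next
  fix Q y A assume "SNF (gct (Var i)) Q y" "y = gc A"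
    "\<forall>z\<in>Q. (\<forall>t. z = gct t \<longrightarrow> i \<notin> fvt t) \<and> (\<forall>A. z = gc A \<longrightarrow> i \<notin> fv A)"
  then show "i \<notin> fv A" by (cases A) (auto simp del: gct.simps gc.simps)
qed

lemma sat_NotFree_t: 
  assumes "tb k x" "tb k v" "val M e v = gct (Var i)" "val M e x = gct t"
  shows "sat M e (NotFree_fm k v x) \<longleftrightarrow> i \<notin> fvt t"
  unfolding sat_NotFree0[OF assms(1,2)] assms(3,4) using SNF_D SNF_t by blast
lemma sat_NotFree_f: 
  assumes "tb k x" "tb k v" "val M e v = gct (Var i)" "val M e x = gc A"
  shows "sat M e (NotFree_fm k v x) \<longleftrightarrow> i \<notin> fv A"
  unfolding sat_NotFree0[OF assms(1,2)] assms(3,4) using SNF_D SNF_f by blast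

lemma le_np: "n \<le> b \<Longrightarrow> n \<le> npair a b" "n \<le> a \<Longrightarrow> n \<le> npair a b"
  using npair_le order_trans by blast+
lemma gct_le_gct: "i \<in> fvt t \<Longrightarrow> gct (Var i) \<le> gct t"
  by (induction t) (auto simp del: gct.simps(1) intro: le_np)
lemma gct_le_gc: "i \<in> fv A \<Longrightarrow> gct (Var i) \<le> gc A"
  by (induction A) (auto simp del: gct.simps intro: le_np gct_le_gct)

lemma all_var_le:
  assumes "\<And>i. P (gct (Var i)) \<longleftrightarrow> i \<notin> fv A"
  shows "(\<forall>n. n \<le> gc A \<longrightarrow> (\<exists>i. n = gct (Var i)) \<longrightarrow> P n) \<longleftrightarrow> fv A = {}"
proof
  assume h: "\<forall>n. n \<le> gc A \<longrightarrow> (\<exists>i. n = gct (Var i)) \<longrightarrow> P n"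
  have "i \<notin> fv A" for i
  proof
    assume i: "i \<in> fv A"
    have "P (gct (Var i))" using h gct_le_gc[OF i] by blast
    then show False using assms i by blast
  qed
  then show "fv A = {}" by blast
next
  assume "fv A = {}"
  then have "P (gct (Var i))" for i using assms by blast
  then show "\<forall>n. n \<le> gc A \<longrightarrow> (\<exists>i. n = gct (Var i)) \<longrightarrow> P n" by blast
qed

lemma all_var_le1:
  assumes "\<And>i. P (gct (Var i)) \<longleftrightarrow> i \<notin> fv A"
  shows "(\<forall>n. n \<le> gc A \<longrightarrow> (\<exists>i. n = gct (Var i)) \<longrightarrow> n \<noteq> gct (Var j) \<longrightarrow> P n) \<longleftrightarrow> fv A \<subseteq> {j}"
proof
  assume h: "\<forall>n. n \<le> gc A \<longrightarrow> (\<exists>i. n = gct (Var i)) \<longrightarrow> n \<noteq> gct (Var j) \<longrightarrow> P n"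
  have "i = j" if i: "i \<in> fv A" for i
  proof (rule ccontr)
    assume "i \<noteq> j"
    then have "gct (Var i) \<noteq> gct (Var j)" by (simp del: gct.simps)
    then have "P (gct (Var i))" using h gct_le_gc[OF i] by blast
    then show False using assms i by blast
  qed
  then show "fv A \<subseteq> {j}" by blast
next
  assume a: "fv A \<subseteq> {j}"
  show "\<forall>n. n \<le> gc A \<longrightarrow> (\<exists>i. n = gct (Var i)) \<longrightarrow> n \<noteq> gct (Var j) \<longrightarrow> P n"
  proof (intro allI impI, elim exE)
    fix n i assume "n \<noteq> gct (Var j)" "n = gct (Var i)"
    then have "i \<noteq> j" by blast
    then show "P n" using a assms[of i] \<open>n = gct (Var i)\<close> by blast
  qed
qed

lemma sat_Sent [simp]:
  assumes "tb k x" shows "sat M e (Sent_fm k x) \<longleftrightarrow> (\<exists>A. sentence A \<and> val M e x = gc A)"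
proof -
  let ?N = "\<forall>n. n \<le> val M e x \<longrightarrow> (\<exists>i. n = gct (Var i)) \<longrightarrow> sat M (e(k := n)) (NotFree_fm (Suc k) (Var k) x)"
  have "sat M e (Sent_fm k x) \<longleftrightarrow> (\<exists>A. val M e x = gc A) \<and> ?N"
    using assms by (simp add: Sent_fm_def del: gct.simps)
  moreover have "?N \<longleftrightarrow> sentence A" if x: "val M e x = gc A" for A
    unfolding x sentence_def
    by (rule all_var_le, rule sat_NotFree_f) (use x assms in \<open>simp_all del: gct.simps\<close>)
  ultimately show ?thesis by auto
qed

lemma sat_L1:
  assumes "tb k x" "tb k v" "val M e v = gct (Var i)"
  shows "sat M e (L1_fm k v x) \<longleftrightarrow> (\<exists>A. fv A = {i} \<and> val M e x = gc A)"
proof -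
  let ?N = "\<forall>n. n \<le> val M e x \<longrightarrow> (\<exists>i. n = gct (Var i)) \<longrightarrow> n \<noteq> gct (Var i) \<longrightarrow> sat M (e(k := n)) (NotFree_fm (Suc k) (Var k) x)"
  have "sat M e (L1_fm k v x) \<longleftrightarrow> (\<exists>A. val M e x = gc A) \<and> \<not> sat M e (NotFree_fm k v x) \<and> ?N"
    using assms by (simp add: L1_fm_def del: gct.simps)
  moreover have "?N \<longleftrightarrow> fv A \<subseteq> {i}" if x: "val M e x = gc A" for A
    unfolding x
    by (rule all_var_le1, rule sat_NotFree_f) (use x assms in \<open>simp_all del: gct.simps\<close>)
  moreover have "sat M e (NotFree_fm k v x) \<longleftrightarrow> i \<notin> fv A" if "val M e x = gc A" for A
    by (rule sat_NotFree_f) (use assms that in auto)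
  ultimately show ?thesis by auto
qed

definition "SSb T V Q z \<longleftrightarrow> (\<exists>x y. z = npair x y \<and> ((x = V \<and> y = T) \<or> ((\<exists>i. x = gct (Var i)) \<and> x \<noteq> V \<and> y = x) \<or>
    (x = gct Zero \<and> y = x) \<or>
    (\<exists>c\<in>set [2, 5, 7, 8, 9, 11, 12]. \<exists>n. x = npair c n \<and> (\<exists>n'. npair n n' \<in> Q \<and> y = npair c n')) \<or>
    (\<exists>c\<in>set [3, 4, 6, 10, 13, 14, 15]. \<exists>m n. x = npair c (npair m n) \<and> (\<exists>m' n'. npair m m' \<in> Q \<and> npair n n' \<in> Q \<and> y = npair c (npair m' n'))) \<or>
    (\<exists>c\<in>set [16, 17]. \<exists>m n. x = npair c (npair m n) \<and> ((m = V \<and> y = x) \<or>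
       (m \<noteq> V \<and> (\<exists>n'. npair n n' \<in> Q \<and> y = npair c (npair m n')))))))"

lemma sat_Sbt0:
  assumes "tb k x" "tb k t" "tb k v" "tb k y"
  shows "sat M e (Sbt_fm k x t v y) \<longleftrightarrow> SeqIn (SSb (val M e t) (val M e v)) (npair (val M e x) (val M e y))"
proof -
  have "sat M e (Sbt_fm k x t v y) \<longleftrightarrow> SeqIn (SSb (val M e t) (val M e v)) (val M e (pair_tm x y))"
    unfolding Sbt_fm_def
  proof (rule sat_Ind, goal_cases)
    case (2 k' mem Q e' z)
    have v: "tb k' v" "tb k' t" using 2 assms tb_mono by (metis add_leE)+
    have vv [simp]: "val M e' v = val M e v" "val M e' t = val M e t" using assms 2(2) by (rule_tac val_agree; simp)+
    note mem = 2(4)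
    have A: "sat M (e'(k' := m, Suc k' := n)) (un_fm (Suc (Suc k')) [c] (\<lambda>k s. \<^bold>\<exists>k. mem (Suc k) (pair_tm s (Var k)) \<^bold>\<and>
       Var (Suc k') \<^bold>= pair_tm (num c) (Var k)) (Var k')) \<longleftrightarrow> (\<exists>r. m = npair c r \<and> (\<exists>n'. npair r n' \<in> Q \<and> n = npair c n'))" for m n c
      using v by (simp add: sat_un mem)
    have B: "sat M (e'(k' := m, Suc k' := n)) (bin_fm (Suc (Suc k')) [c] (\<lambda>k s r. \<^bold>\<exists>k. \<^bold>\<exists>(Suc k). mem (Suc (Suc k)) (pair_tm s (Var k)) \<^bold>\<and>
       mem (Suc (Suc k)) (pair_tm r (Var (Suc k))) \<^bold>\<and>
       Var (Suc k') \<^bold>= pair_tm (num c) (pair_tm (Var k) (Var (Suc k)))) (Var k')) \<longleftrightarrow> (\<exists>p q. m = npair c (npair p q) \<and> (\<exists>m' n'. npair p m' \<in> Q \<and> npair q n' \<in> Q \<and> n = npair c (npair m' n')))" for m n c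
      using v by (simp add: sat_bin mem)
    have C: "sat M (e'(k' := m, Suc k' := n)) (bin_fm (Suc (Suc k')) [c] (\<lambda>k w s. (w \<^bold>= v \<^bold>\<and> Var (Suc k') \<^bold>= Var k') \<^bold>\<or>
       ((\<^bold>\<not> (w \<^bold>= v)) \<^bold>\<and> (\<^bold>\<exists>k. mem (Suc k) (pair_tm s (Var k)) \<^bold>\<and>
         Var (Suc k') \<^bold>= pair_tm (num c) (pair_tm w (Var k))))) (Var k')) \<longleftrightarrow> (\<exists>p q. m = npair c (npair p q) \<and> ((p = val M e v \<and> n = m) \<or>
       (p \<noteq> val M e v \<and> (\<exists>n'. npair q n' \<in> Q \<and> n = npair c (npair p n')))))" for m n c
      using v by (simp add: sat_bin mem)
    have E: "val M (e'(k' := m, Suc k' := n)) v = val M e v" "val M (e'(k' := m, Suc k' := n)) t = val M e t" for m n using v by simp_all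
    have Z: "val M (e'(k' := m, Suc k' := n)) z = val M e' z" for m n using 2 by simp
    show ?case unfolding SSb_def sbt_step_def
      by (simp only: sat.simps sat_Disj bex_cong_simps A B C E Z val.simps val_pair val_num fun_upd_same fun_upd_other
        Suc_eq_plus1[symmetric] add_2_eq_Suc' sat_Var tb_simps lessI less_SucI
        n_not_Suc_n not_False_eq_True)
  qed (use assms in simp)
  then show ?thesis by simp
qed

lemma bexm: "(\<And>x. P x \<longrightarrow> Q x) \<Longrightarrow> (\<exists>x\<in>A. P x) \<longrightarrow> (\<exists>x\<in>A. Q x)" by blast

lemma SSb_mono: "Q \<subseteq> Q' \<Longrightarrow> SSb T V Q y \<longrightarrow> SSb T V Q' y"
  unfolding SSb_def by (intro disj_mono conj_mono ex_mono bexm in_mono imp_refl)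

lemma SSb_step:
  "SSb T V Q y \<Longrightarrow> finite Q \<Longrightarrow> \<forall>z\<in>Q. SeqIn (SSb T V) z \<Longrightarrow> SeqIn (SSb T V) y"
  by (rule SeqIn_intro[where S="SSb T V" and Q=Q]) (use SSb_mono in blast)+

lemma pair_ex: "(\<exists>a b. npair x y = npair a b \<and> P a b) = P x y"
  by auto

lemma SSb_pair: "SSb T V Q (npair x y) \<longleftrightarrow> ((x = V \<and> y = T) \<or> ((\<exists>i. x = gct (Var i)) \<and> x \<noteq> V \<and> y = x) \<or>
    (x = gct Zero \<and> y = x) \<or>
    (\<exists>c\<in>set [2, 5, 7, 8, 9, 11, 12]. \<exists>n. x = npair c n \<and> (\<exists>n'. npair n n' \<in> Q \<and> y = npair c n')) \<or>
    (\<exists>c\<in>set [3, 4, 6, 10, 13, 14, 15]. \<exists>m n. x = npair c (npair m n) \<and> (\<exists>m' n'. npair m m' \<in> Q \<and> npair n n' \<in> Q \<and> y = npair c (npair m' n'))) \<or>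
    (\<exists>c\<in>set [16, 17]. \<exists>m n. x = npair c (npair m n) \<and> ((m = V \<and> y = x) \<or>
       (m \<noteq> V \<and> (\<exists>n'. npair n n' \<in> Q \<and> y = npair c (npair m n'))))))"
  unfolding SSb_def by (rule pair_ex)

lemma SSb_simps [simp]:
  "SSb T (gct (Var i)) Q (npair (gct (Var j)) y) \<longleftrightarrow> (if i = j then y = T else y = gct (Var j))"
  "SSb T (gct (Var i)) Q (npair (gct Zero) y) \<longleftrightarrow> y = gct Zero"
  "SSb T (gct (Var i)) Q (npair (gct (Succ a)) y) \<longleftrightarrow> (\<exists>n. npair (gct a) n \<in> Q \<and> y = npair 2 n)"
  "SSb T (gct (Var i)) Q (npair (gct (Fu a)) y) \<longleftrightarrow> (\<exists>n. npair (gct a) n \<in> Q \<and> y = npair 5 n)"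
  "SSb T (gct (Var i)) Q (npair (gc (PU a)) y) \<longleftrightarrow> (\<exists>n. npair (gct a) n \<in> Q \<and> y = npair 7 n)"
  "SSb T (gct (Var i)) Q (npair (gc (PAg a)) y) \<longleftrightarrow> (\<exists>n. npair (gct a) n \<in> Q \<and> y = npair 8 n)"
  "SSb T (gct (Var i)) Q (npair (gc (PK1 a)) y) \<longleftrightarrow> (\<exists>n. npair (gct a) n \<in> Q \<and> y = npair 9 n)"
  "SSb T (gct (Var i)) Q (npair (gc (PT a)) y) \<longleftrightarrow> (\<exists>n. npair (gct a) n \<in> Q \<and> y = npair 11 n)"
  "SSb T (gct (Var i)) Q (npair (gc (Neg A)) y) \<longleftrightarrow> (\<exists>n. npair (gc A) n \<in> Q \<and> y = npair 12 n)"
  "SSb T (gct (Var i)) Q (npair (gct (Add a b)) y) \<longleftrightarrow> (\<exists>m n. npair (gct a) m \<in> Q \<and> npair (gct b) n \<in> Q \<and> y = npair 3 (npair m n))"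
  "SSb T (gct (Var i)) Q (npair (gct (Mul a b)) y) \<longleftrightarrow> (\<exists>m n. npair (gct a) m \<in> Q \<and> npair (gct b) n \<in> Q \<and> y = npair 4 (npair m n))"
  "SSb T (gct (Var i)) Q (npair (gc (Eq a b)) y) \<longleftrightarrow> (\<exists>m n. npair (gct a) m \<in> Q \<and> npair (gct b) n \<in> Q \<and> y = npair 6 (npair m n))"
  "SSb T (gct (Var i)) Q (npair (gc (PK2 a b)) y) \<longleftrightarrow> (\<exists>m n. npair (gct a) m \<in> Q \<and> npair (gct b) n \<in> Q \<and> y = npair 10 (npair m n))"
  "SSb T (gct (Var i)) Q (npair (gc (Imp A B)) y) \<longleftrightarrow> (\<exists>m n. npair (gc A) m \<in> Q \<and> npair (gc B) n \<in> Q \<and> y = npair 13 (npair m n))"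
  "SSb T (gct (Var i)) Q (npair (gc (And A B)) y) \<longleftrightarrow> (\<exists>m n. npair (gc A) m \<in> Q \<and> npair (gc B) n \<in> Q \<and> y = npair 14 (npair m n))"
  "SSb T (gct (Var i)) Q (npair (gc (Or A B)) y) \<longleftrightarrow> (\<exists>m n. npair (gc A) m \<in> Q \<and> npair (gc B) n \<in> Q \<and> y = npair 15 (npair m n))"
  "SSb T (gct (Var i)) Q (npair (gc (Forall j A)) y) \<longleftrightarrow> (if i = j then y = gc (Forall j A) else (\<exists>n. npair (gc A) n \<in> Q \<and> y = npair 16 (npair (gct (Var j)) n)))"
  "SSb T (gct (Var i)) Q (npair (gc (Exists j A)) y) \<longleftrightarrow> (if i = j then y = gc (Exists j A) else (\<exists>n. npair (gc A) n \<in> Q \<and> y = npair 17 (npair (gct (Var j)) n)))"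
  by (simp add: SSb_pair)+

lemma ceq [simp]:
  "(gct (Succ a) = npair 2 n) = (gct a = n)"
  "(gct (Fu a) = npair 5 n) = (gct a = n)"
  "(gc (PU a) = npair 7 n) = (gct a = n)"
  "(gc (PAg a) = npair 8 n) = (gct a = n)"
  "(gc (PK1 a) = npair 9 n) = (gct a = n)"
  "(gc (PT a) = npair 11 n) = (gct a = n)"
  "(gc (Neg A) = npair 12 n) = (gc A = n)"
  "(gct (Add a b) = npair 3 n) = (npair (gct a) (gct b) = n)"
  "(gct (Mul a b) = npair 4 n) = (npair (gct a) (gct b) = n)"
  "(gc (Eq a b) = npair 6 n) = (npair (gct a) (gct b) = n)"
  "(gc (PK2 a b) = npair 10 n) = (npair (gct a) (gct b) = n)"
  "(gc (Imp A B) = npair 13 n) = (npair (gc A) (gc B) = n)"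
  "(gc (And A B) = npair 14 n) = (npair (gc A) (gc B) = n)"
  "(gc (Or A B) = npair 15 n) = (npair (gc A) (gc B) = n)"
  "(gc (Forall j A) = npair 16 n) = (npair (gct (Var j)) (gc A) = n)"
  "(gc (Exists j A) = npair 17 n) = (npair (gct (Var j)) (gc A) = n)"
  by (simp_all)

lemma SSb_t: "SeqIn (SSb (gct t) (gct (Var i))) (npair (gct a) (gct (subt a t i)))"
proof (induction a)
  case (Var x) then show ?case by (intro SSb_step[where Q="{}"]) (auto simp del: gct.simps gc.simps split: if_splits)
next   case Zero then show ?case by (intro SSb_step[where Q="{}"]) (auto simp del: gct.simps gc.simps split: if_splits)
next   case (Succ a) then show ?case by (intro SSb_step[where Q="{npair (gct a) (gct (subt a t i))}"]) (auto simp del: gct.simps gc.simps split: if_splits)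
next   case (Add a b) then show ?case by (intro SSb_step[where Q="{npair (gct a) (gct (subt a t i)), npair (gct b) (gct (subt b t i))}"]) (auto simp del: gct.simps gc.simps split: if_splits)
next   case (Mul a b) then show ?case by (intro SSb_step[where Q="{npair (gct a) (gct (subt a t i)), npair (gct b) (gct (subt b t i))}"]) (auto simp del: gct.simps gc.simps split: if_splits)
next   case (Fu a) then show ?case by (intro SSb_step[where Q="{npair (gct a) (gct (subt a t i))}"]) (auto simp del: gct.simps gc.simps split: if_splits)
qed

lemma SSb_f: "SeqIn (SSb (gct t) (gct (Var i))) (npair (gc A) (gc (sbt A t i)))"
proof (induction A)
  case (PU a) then show ?case by (intro SSb_step[where Q="{npair (gct a) (gct (subt a t i))}"]) (auto simp del: gct.simps gc.simps simp: SSb_t split: if_splits)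
next   case (PAg a) then show ?case by (intro SSb_step[where Q="{npair (gct a) (gct (subt a t i))}"]) (auto simp del: gct.simps gc.simps simp: SSb_t split: if_splits)
next   case (PK1 a) then show ?case by (intro SSb_step[where Q="{npair (gct a) (gct (subt a t i))}"]) (auto simp del: gct.simps gc.simps simp: SSb_t split: if_splits)
next   case (PT a) then show ?case by (intro SSb_step[where Q="{npair (gct a) (gct (subt a t i))}"]) (auto simp del: gct.simps gc.simps simp: SSb_t split: if_splits)
next   case (Eq a b) then show ?case by (intro SSb_step[where Q="{npair (gct a) (gct (subt a t i)), npair (gct b) (gct (subt b t i))}"]) (auto simp del: gct.simps gc.simps simp: SSb_t split: if_splits)
next   case (PK2 a b) then show ?case by (intro SSb_step[where Q="{npair (gct a) (gct (subt a t i)), npair (gct b) (gct (subt b t i))}"]) (auto simp del: gct.simps gc.simps simp: SSb_t split: if_splits)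
next   case (Neg a) then show ?case by (intro SSb_step[where Q="{npair (gc a) (gc (sbt a t i))}"]) (auto simp del: gct.simps gc.simps simp: SSb_t split: if_splits)
next   case (Imp a b) then show ?case by (intro SSb_step[where Q="{npair (gc a) (gc (sbt a t i)), npair (gc b) (gc (sbt b t i))}"]) (auto simp del: gct.simps gc.simps simp: SSb_t split: if_splits)
next   case (And a b) then show ?case by (intro SSb_step[where Q="{npair (gc a) (gc (sbt a t i)), npair (gc b) (gc (sbt b t i))}"]) (auto simp del: gct.simps gc.simps simp: SSb_t split: if_splits)
next   case (Or a b) then show ?case by (intro SSb_step[where Q="{npair (gc a) (gc (sbt a t i)), npair (gc b) (gc (sbt b t i))}"]) (auto simp del: gct.simps gc.simps simp: SSb_t split: if_splits)
next   case (Forall x a) then show ?case by (intro SSb_step[where Q="if x = i then {} else {npair (gc a) (gc (sbt a t i))}"]) (auto simp del: gct.simps gc.simps simp: SSb_t split: if_splits)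
next   case (Exists x a) then show ?case by (intro SSb_step[where Q="if x = i then {} else {npair (gc a) (gc (sbt a t i))}"]) (auto simp del: gct.simps gc.simps simp: SSb_t split: if_splits)
qed

lemma SSb_D: "SeqIn (SSb (gct t) (gct (Var i))) z \<Longrightarrow>
   (\<forall>a y. z = npair (gct a) y \<longrightarrow> y = gct (subt a t i)) \<and> (\<forall>A y. z = npair (gc A) y \<longrightarrow> y = gc (sbt A t i))"
proof (erule SeqIn_induct, intro conjI allI impI)
  fix Q z a y assume "SSb (gct t) (gct (Var i)) Q z" "z = npair (gct a) y"
    "\<forall>z\<in>Q. (\<forall>a y. z = npair (gct a) y \<longrightarrow> y = gct (subt a t i)) \<and> (\<forall>A y. z = npair (gc A) y \<longrightarrow> y = gc (sbt A t i))"
  then show "y = gct (subt a t i)"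
    apply (cases a; simp only: SSb_simps split: if_splits)
    by (auto split: if_splits)
next
  fix Q z a y assume "SSb (gct t) (gct (Var i)) Q z" "z = npair (gc a) y"
    "\<forall>z\<in>Q. (\<forall>a y. z = npair (gct a) y \<longrightarrow> y = gct (subt a t i)) \<and> (\<forall>A y. z = npair (gc A) y \<longrightarrow> y = gc (sbt A t i))"
  then show "y = gc (sbt a t i)"
    apply (cases a; simp only: SSb_simps split: if_splits)
    by (auto split: if_splits)
qed

lemma sat_Sbt_t:
  assumes "tb k x" "tb k t" "tb k v" "tb k y" "val M e x = gct a" "val M e t = gct b" "val M e v = gct (Var i)"
  shows "sat M e (Sbt_fm k x t v y) \<longleftrightarrow> val M e y = gct (subt a b i)"
  unfolding sat_Sbt0[OF assms(1-4)] assms(5-) 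
  by (rule iffI) (use SSb_D[of b i] in blast, simp only: SSb_t)

lemma sat_Sbt_f:
  assumes "tb k x" "tb k t" "tb k v" "tb k y" "val M e x = gc A" "val M e t = gct b" "val M e v = gct (Var i)"
  shows "sat M e (Sbt_fm k x t v y) \<longleftrightarrow> val M e y = gc (sbt A b i)"
  unfolding sat_Sbt0[OF assms(1-4)] assms(5-) 
  by (rule iffI) (use SSb_D[of b i] in blast, simp only: SSb_f)

declare gct.simps(1) [simp del] 

lemma SNF_t_iff: "SeqIn (SNF (gct (Var i))) (gct t) \<longleftrightarrow> i \<notin> fvt t" using SNF_t SNF_D by blast
lemma SNF_f_iff: "SeqIn (SNF (gct (Var i))) (gc A) \<longleftrightarrow> i \<notin> fv A" using SNF_f SNF_D by blast

definition "SFF T V Q y \<longleftrightarrow> (\<exists>n. (\<exists>c\<in>set [7, 8, 9, 11]. y = npair c n)) \<or>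
   (\<exists>m n. (\<exists>c\<in>set [6, 10]. y = npair c (npair m n))) \<or>
   (\<exists>n. (\<exists>c\<in>set [12]. y = npair c n) \<and> n \<in> Q) \<or>
   (\<exists>m n. (\<exists>c\<in>set [13, 14, 15]. y = npair c (npair m n)) \<and> m \<in> Q \<and> n \<in> Q) \<or>
   (\<exists>m n. (\<exists>c\<in>set [16, 17]. y = npair c (npair m n)) \<and> (SeqIn (SNF V) y \<or> SeqIn (SNF m) T \<and> n \<in> Q))"

lemma sat_FF0:
  assumes "tb k x" "tb k v" "tb k t"
  shows "sat M e (FreeFor_fm k t v x) \<longleftrightarrow> SeqIn (SFF (val M e t) (val M e v)) (val M e x)"
  unfolding FreeFor_fm_def
proof (rule sat_Ind, fact, goal_cases)
  case (1 k' mem Q e' y)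
  have v: "tb k' v" "tb k' t" using 1 assms tb_mono by (metis add_leE)+
  have [simp]: "val M e' v = val M e v" "val M e' t = val M e t" using assms 1(2) by (rule_tac val_agree; simp)+
  show ?case using 1 v unfolding SFF_def by (simp add: sat_un sat_bin sat_NotFree0 del: list.set)
qed

lemma SFF_mono: "Q \<subseteq> Q' \<Longrightarrow> SFF T V Q y \<longrightarrow> SFF T V Q' y"
  unfolding SFF_def by (intro disj_mono conj_mono ex_mono bexm in_mono imp_refl)
lemma SFF_step:
  "SFF T V Q y \<Longrightarrow> finite Q \<Longrightarrow> \<forall>z\<in>Q. SeqIn (SFF T V) z \<Longrightarrow> SeqIn (SFF T V) y"
  by (rule SeqIn_intro[where S="SFF T V" and Q=Q]) (use SFF_mono in blast)+

lemma SFF_simps [simp]: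
  "SFF (gct t) (gct (Var i)) Q (gc (PU a))" "SFF (gct t) (gct (Var i)) Q (gc (PAg a))"
  "SFF (gct t) (gct (Var i)) Q (gc (PK1 a))" "SFF (gct t) (gct (Var i)) Q (gc (PT a))"
  "SFF (gct t) (gct (Var i)) Q (gc (Eq a b))" "SFF (gct t) (gct (Var i)) Q (gc (PK2 a b))"
  "SFF (gct t) (gct (Var i)) Q (gc (Neg A)) \<longleftrightarrow> gc A \<in> Q"
  "SFF (gct t) (gct (Var i)) Q (gc (Imp A B)) \<longleftrightarrow> gc A \<in> Q \<and> gc B \<in> Q"
  "SFF (gct t) (gct (Var i)) Q (gc (And A B)) \<longleftrightarrow> gc A \<in> Q \<and> gc B \<in> Q"
  "SFF (gct t) (gct (Var i)) Q (gc (Or A B)) \<longleftrightarrow> gc A \<in> Q \<and> gc B \<in> Q"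
  by (simp_all add: SFF_def)
lemma SFF_simps2 [simp]:
  "SFF (gct t) (gct (Var i)) Q (gc (Forall x A)) \<longleftrightarrow> i \<notin> fv (Forall x A) \<or> x \<notin> fvt t \<and> gc A \<in> Q"
  "SFF (gct t) (gct (Var i)) Q (gc (Exists x A)) \<longleftrightarrow> i \<notin> fv (Exists x A) \<or> x \<notin> fvt t \<and> gc A \<in> Q"
  using SNF_f_iff[of i "Forall x A"] SNF_f_iff[of i "Exists x A"]
  by (simp_all add: SFF_def SNF_t_iff)

lemma SFF_iff: "SeqIn (SFF (gct t) (gct (Var i))) (gc A) \<longleftrightarrow> free_for t i A"
proof
  show "free_for t i A \<Longrightarrow> SeqIn (SFF (gct t) (gct (Var i))) (gc A)"
  proof (induction A)
    case (Forall x A) then show ?case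
      by (intro SFF_step[where Q="if i \<notin> fv (Forall x A) then {} else {gc A}"]) (auto simp del: gc.simps)
  next case (Exists x A) then show ?case
      by (intro SFF_step[where Q="if i \<notin> fv (Exists x A) then {} else {gc A}"]) (auto simp del: gc.simps)
  next case (Neg A) then show ?case by (intro SFF_step[where Q="{gc A}"]) (auto simp del: gc.simps)
  next case (Imp A B) then show ?case by (intro SFF_step[where Q="{gc A, gc B}"]) (auto simp del: gc.simps)
  next case (And A B) then show ?case by (intro SFF_step[where Q="{gc A, gc B}"]) (auto simp del: gc.simps)
  next case (Or A B) then show ?case by (intro SFF_step[where Q="{gc A, gc B}"]) (auto simp del: gc.simps)
  qed (intro SFF_step[where Q="{}"]; auto simp del: gc.simps)+
next
  have "SeqIn (SFF (gct t) (gct (Var i))) y \<Longrightarrow> (\<forall>A. y = gc A \<longrightarrow> free_for t i A)" for y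
  proof (erule SeqIn_induct, intro allI impI)
    fix Q y A assume "SFF (gct t) (gct (Var i)) Q y" "y = gc A"
      "\<forall>z\<in>Q. \<forall>A. z = gc A \<longrightarrow> free_for t i A"
    then show "free_for t i A" by (cases A) (auto simp del: gc.simps)
  qed
  then show "SeqIn (SFF (gct t) (gct (Var i))) (gc A) \<Longrightarrow> free_for t i A" by blast
qed

lemma sat_FF:
  assumes "tb k x" "tb k v" "tb k t" "val M e x = gc A" "val M e t = gct b" "val M e v = gct (Var i)"
  shows "sat M e (FreeFor_fm k t v x) \<longleftrightarrow> free_for b i A"
  unfolding sat_FF0[OF assms(1-3)] assms(4-) SFF_iff ..

definition "SNu Q z \<longleftrightarrow> z = npair 0 (gct Zero) \<or> (\<exists>n t. z = npair (Suc n) (npair 2 t) \<and> npair n t \<in> Q)"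

lemma sat_Num0:
  assumes "tb k n" "tb k t"
  shows "sat M e (Num_fm k n t) \<longleftrightarrow> SeqIn SNu (npair (val M e n) (val M e t))"
proof -
  have "sat M e (Num_fm k n t) \<longleftrightarrow> SeqIn SNu (val M e (pair_tm n t))"
    unfolding Num_fm_def
  proof (rule sat_Ind, goal_cases)
    case (2 k' mem Q e' y)
    then show ?case by (simp add: SNu_def)
  qed (use assms in simp)
  then show ?thesis by simp
qed

lemma SNu_iff: "SeqIn SNu z \<longleftrightarrow> z \<in> {npair n (gct (num n)) | n. True}"
proof (rule SeqIn_eq)
  fix Q y assume S: "SNu Q y" and Q: "Q \<subseteq> {npair n (gct (num n)) |n. True}"
  from S show "y \<in> {npair n (gct (num n)) |n. True}"
    unfolding SNu_def
  proof (elim disjE exE conjE)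
    show "y = npair 0 (gct Zero) \<Longrightarrow> ?thesis" by (auto intro!: exI[of _ 0])
    fix n t assume "y = npair (Suc n) (npair 2 t)" "npair n t \<in> Q"
    then show ?thesis using Q by (auto intro!: exI[of _ "Suc n"])
  qed
next
  assume st: "\<And>Q y. SNu Q y \<Longrightarrow> finite Q \<Longrightarrow> \<forall>z\<in>Q. SeqIn SNu z \<Longrightarrow> SeqIn SNu y"
  have "SeqIn SNu (npair n (gct (num n)))" for n
  proof (induction n)
    case 0 show ?case by (rule st[of "{}"]) (auto simp: SNu_def)
  next
    case (Suc n)
    have "SNu {npair n (gct (num n))} (npair (Suc n) (gct (num (Suc n))))" by (simp add: SNu_def)
    then show ?case by (rule st) (use Suc in auto)
  qed
  then show "\<forall>z\<in>{npair n (gct (num n)) |n. True}. SeqIn SNu z" by blast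
qed (unfold SNu_def, blast)

lemma sat_Num [simp]:
  "tb k n \<Longrightarrow> tb k t \<Longrightarrow> sat M e (Num_fm k n t) \<longleftrightarrow> val M e t = gct (num (val M e n))"
  by (auto simp add: sat_Num0 SNu_iff)

definition "SVa Q z \<longleftrightarrow> z = npair (gct Zero) 0 \<or> (\<exists>a m. z = npair (npair 2 a) (Suc m) \<and> npair a m \<in> Q) \<or>
   (\<exists>a m b n. npair a m \<in> Q \<and> npair b n \<in> Q \<and> (z = npair (npair 3 (npair a b)) (m + n) \<or> z = npair (npair 4 (npair a b)) (m * n)))"

lemma sat_Val0:
  assumes "tb k n" "tb k t"
  shows "sat M e (Val_fm k t n) \<longleftrightarrow> SeqIn SVa (npair (val M e t) (val M e n))"
proof -
  have "sat M e (Val_fm k t n) \<longleftrightarrow> SeqIn SVa (val M e (pair_tm t n))"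
    unfolding Val_fm_def
  proof (rule sat_Ind, goal_cases)
    case (2 k' mem Q e' y)
    then show ?case by (simp add: SVa_def val_step_def)
  qed (use assms in simp)
  then show ?thesis by simp
qed

definition "cv (M::lstruct) = val M (\<lambda>_. 0)"

lemma SVa_iff: "SeqIn SVa z \<longleftrightarrow> z \<in> {npair (gct t) (cv M t) | t. PAtm t \<and> fvt t = {}}" (is "_ \<longleftrightarrow> _ \<in> ?X")
proof (rule SeqIn_eq)
  fix Q y assume S: "SVa Q y" and Q: "Q \<subseteq> ?X"
  from S show "y \<in> ?X"
    unfolding SVa_def
  proof (elim disjE exE conjE)
    show "y = npair (gct Zero) 0 \<Longrightarrow> ?thesis" by (auto intro!: exI[of _ Zero] simp: cv_def)
  next
    fix n t assume "y = npair (npair 2 t) (Suc n)" "npair t n \<in> Q"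
    moreover obtain s where "t = gct s" "n = cv M s" "PAtm s" "fvt s = {}"
      using Q calculation by fastforce
    ultimately show ?thesis by (auto simp: cv_def intro!: exI[of _ "Succ s"])
  next
    fix a m b n assume "npair a m \<in> Q" "npair b n \<in> Q" "y = npair (npair 3 (npair a b)) (m + n)"
    moreover obtain s t where "a = gct s" "b = gct t" "m = cv M s" "n = cv M t" "PAtm s" "PAtm t" "fvt s = {}" "fvt t = {}"
      using subsetD[OF Q calculation(1)] subsetD[OF Q calculation(2)] by auto
    ultimately show ?thesis by (auto simp: cv_def intro!: exI[of _ "Add s t"])
  next
    fix a m b n assume "npair a m \<in> Q" "npair b n \<in> Q" "y = npair (npair 4 (npair a b)) (m * n)"
    moreover obtain s t where "a = gct s" "b = gct t" "m = cv M s" "n = cv M t" "PAtm s" "PAtm t" "fvt s = {}" "fvt t = {}"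
      using subsetD[OF Q calculation(1)] subsetD[OF Q calculation(2)] by auto
    ultimately show ?thesis by (auto simp: cv_def intro!: exI[of _ "Mul s t"])
  qed
next
  assume st: "\<And>Q y. SVa Q y \<Longrightarrow> finite Q \<Longrightarrow> \<forall>z\<in>Q. SeqIn SVa z \<Longrightarrow> SeqIn SVa y"
  have "PAtm t \<Longrightarrow> fvt t = {} \<Longrightarrow> SeqIn SVa (npair (gct t) (cv M t))" for t
  proof (induction t)
    case Zero show ?case by (rule st[of "{}"]) (auto simp: SVa_def cv_def)
  next
    case (Succ t)
    have "SVa {npair (gct t) (cv M t)} (npair (gct (Succ t)) (cv M (Succ t)))" by (simp add: SVa_def cv_def; blast)
    then show ?case by (rule st) (use Succ in auto)
  next
    case (Add s t)
    have "SVa {npair (gct s) (cv M s), npair (gct t) (cv M t)} (npair (gct (Add s t)) (cv M (Add s t)))" by (simp add: SVa_def cv_def; blast)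
    then show ?case by (rule st) (use Add in auto)
  next
    case (Mul s t)
    have "SVa {npair (gct s) (cv M s), npair (gct t) (cv M t)} (npair (gct (Mul s t)) (cv M (Mul s t)))" by (simp add: SVa_def cv_def; blast)
    then show ?case by (rule st) (use Mul in auto)
  qed auto
  then show "\<forall>z\<in>?X. SeqIn SVa z" by blast
qed (unfold SVa_def, blast)

lemma sat_Val:
  "tb k n \<Longrightarrow> tb k x \<Longrightarrow> PAtm t \<Longrightarrow> fvt t = {} \<Longrightarrow> val M e x = gct t \<Longrightarrow>
   sat M e (Val_fm k x n) \<longleftrightarrow> val M e n = cv M t"
  by (auto simp add: sat_Val0 SVa_iff[of _ M])

definition "SGe X Q z \<longleftrightarrow> z = X \<or> (\<exists>m n. (\<exists>c\<in>set [16]. z = npair c (npair m n)) \<and> (\<exists>i. m = gct (Var i)) \<and> n \<in> Q)"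

lemma sat_Gen0:
  assumes "tb k x" "tb k y"
  shows "sat M e (Gen_fm k x y) \<longleftrightarrow> SeqIn (SGe (val M e x)) (val M e y)"
    unfolding Gen_fm_def
proof (rule sat_Ind, fact, goal_cases)
  case (1 k' mem Q e' y)
  have v: "tb k' x" using 1 assms tb_mono by (metis add_leE)
  have [simp]: "val M e' x = val M e x" using assms 1(2) by (rule_tac val_agree; simp)
  show ?case using 1 v by (simp add: SGe_def sat_bin)
qed

lemma SGe_iff: "SeqIn (SGe X) (gc B) \<longleftrightarrow> (\<exists>A. X = gc A \<and> B \<in> generalizations A)"
proof
  have "SeqIn (SGe X) z \<Longrightarrow> \<forall>B. z = gc B \<longrightarrow> (\<exists>A. X = gc A \<and> B \<in> generalizations A)" for z
  proof (erule SeqIn_induct, intro allI impI)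
    fix Q y B assume S: "SGe X Q y" "y = gc B" and Q: "\<forall>z\<in>Q. \<forall>B. z = gc B \<longrightarrow> (\<exists>A. X = gc A \<and> B \<in> generalizations A)"
    show "\<exists>A. X = gc A \<and> B \<in> generalizations A"
    proof (cases "y = X")
      case True then show ?thesis using S by (auto simp: generalizations_def intro!: exI[of _ B] exI[of _ "[]"])
    next
      case False
      then obtain i n where n: "gc B = npair 16 (npair (gct (Var i)) n)" "n \<in> Q"
        using S by (auto simp: SGe_def)
      then obtain C where B: "B = Forall i C" "n = gc C" by (cases B) auto
      then obtain A xs where "X = gc A" "C = foldr Forall xs A" using Q n unfolding generalizations_def by blast
      then show ?thesis using B by (auto simp: generalizations_def intro!: exI[of _ A] exI[of _ "i # xs"])
    qed
  qed
  then show "SeqIn (SGe X) (gc B) \<Longrightarrow> \<exists>A. X = gc A \<and> B \<in> generalizations A" by blast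
next
  have st: "SGe X Q y \<Longrightarrow> finite Q \<Longrightarrow> \<forall>z\<in>Q. SeqIn (SGe X) z \<Longrightarrow> SeqIn (SGe X) y" for Q y
    by (rule SeqIn_intro[where S="SGe X" and Q=Q]) (unfold SGe_def, blast+)
  have "SeqIn (SGe X) (gc (foldr Forall xs A))" if X: "X = gc A" for A xs
  proof (induction xs)
    case Nil
    have "SGe X {} (gc (foldr Forall [] A))" using X by (simp add: SGe_def)
    then show ?case by (rule st) auto
  next
    case (Cons x xs)
    have "SGe X {gc (foldr Forall xs A)} (gc (foldr Forall (x # xs) A))" by (simp add: SGe_def; blast)
    then show ?case by (rule st) (use Cons in auto)
  qed
  then show "\<exists>A. X = gc A \<and> B \<in> generalizations A \<Longrightarrow> SeqIn (SGe X) (gc B)"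
    by (auto simp: generalizations_def)
qed

lemma SSb_f_iff: "SeqIn (SSb (gct t) (gct (Var i))) (npair (gc A) y) \<longleftrightarrow> y = gc (sbt A t i)"
  by (rule iffI) (use SSb_D[of t i] in blast, simp only: SSb_f)

lemma gc_inv:
  "gc A = npair 6 n \<longleftrightarrow> (\<exists>s t. A = Eq s t \<and> npair (gct s) (gct t) = n)"
  "gc A = npair 12 n \<longleftrightarrow> (\<exists>B. A = Neg B \<and> gc B = n)"
  "gc A = npair 13 n \<longleftrightarrow> (\<exists>B C. A = Imp B C \<and> npair (gc B) (gc C) = n)"
  "gc A = npair 14 n \<longleftrightarrow> (\<exists>B C. A = And B C \<and> npair (gc B) (gc C) = n)"
  "gc A = npair 15 n \<longleftrightarrow> (\<exists>B C. A = Or B C \<and> npair (gc B) (gc C) = n)"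
  "gc A = npair 16 n \<longleftrightarrow> (\<exists>x B. A = Forall x B \<and> npair (gct (Var x)) (gc B) = n)"
  "gc A = npair 17 n \<longleftrightarrow> (\<exists>x B. A = Exists x B \<and> npair (gct (Var x)) (gc B) = n)"
  by (cases A; auto)+

definition "schem x a b c v s t \<longleftrightarrow>
  x = npair 13 (npair a (npair 13 (npair b a))) \<or>
  x = npair 13 (npair (npair 13 (npair a (npair 13 (npair b c)))) (npair 13 (npair (npair 13 (npair a b)) (npair 13 (npair a c))))) \<or>
  x = npair 13 (npair (npair 13 (npair (npair 12 a) (npair 12 b))) (npair 13 (npair b a))) \<or>
  x = npair 13 (npair (npair 14 (npair a b)) a) \<or>
  x = npair 13 (npair (npair 14 (npair a b)) b) \<or>
  x = npair 13 (npair a (npair 13 (npair b (npair 14 (npair a b))))) \<or>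
  x = npair 13 (npair a (npair 15 (npair a b))) \<or>
  x = npair 13 (npair b (npair 15 (npair a b))) \<or>
  x = npair 13 (npair (npair 13 (npair a c)) (npair 13 (npair (npair 13 (npair b c)) (npair 13 (npair (npair 15 (npair a b)) c))))) \<or>
  ((\<exists>t'. t = gct t') \<and> SeqIn (SFF t v) a \<and> SeqIn (SSb t v) (npair a b) \<and> x = npair 13 (npair (npair 16 (npair v a)) b)) \<or>
  x = npair 13 (npair (npair 16 (npair v (npair 13 (npair a b)))) (npair 13 (npair (npair 16 (npair v a)) (npair 16 (npair v b))))) \<or>
  (SeqIn (SNF v) a \<and> x = npair 13 (npair a (npair 16 (npair v a)))) \<or>
  x = npair 13 (npair (npair 17 (npair v a)) (npair 12 (npair 16 (npair v (npair 12 a))))) \<or>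
  x = npair 13 (npair (npair 12 (npair 16 (npair v (npair 12 a)))) (npair 17 (npair v a))) \<or>
  x = npair 6 (npair t t) \<or>
  ((\<exists>C. c = gc C) \<and> (\<exists>i. v = gct (Var i)) \<and> SeqIn (SFF s v) c \<and> SeqIn (SFF t v) c \<and>
    SeqIn (SSb s v) (npair c a) \<and> SeqIn (SSb t v) (npair c b) \<and>
    x = npair 13 (npair (npair 6 (npair s t)) (npair 13 (npair a b))))"

lemma sat_Schema0:
  assumes x: "tb k x"
  shows "sat M e (Schema_fm k x) \<longleftrightarrow> (\<exists>a b c v s t. schem (val M e x) a b c v s t)"
proof -
  have tbs: "tb (k+1) x" "tb (k+2) x" "tb (k+3) x" "tb (k+4) x" "tb (k+5) x" "tb (k+6) x"
    using x by simp_all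
  have "sat M e (Schema_fm k x) \<longleftrightarrow> (\<exists>a b c v s t. 
     sat M (e(k := a, k+1 := b, k+2 := c, k+3 := v, k+4 := s, k+5 := t)) (Disj [
       x \<^bold>= imp_tm (Var k) (imp_tm (Var (k+1)) (Var k)),
       x \<^bold>= imp_tm (imp_tm (Var k) (imp_tm (Var (k+1)) (Var (k+2)))) (imp_tm (imp_tm (Var k) (Var (k+1))) (imp_tm (Var k) (Var (k+2)))),
       x \<^bold>= imp_tm (imp_tm (neg_tm (Var k)) (neg_tm (Var (k+1)))) (imp_tm (Var (k+1)) (Var k)),
       x \<^bold>= imp_tm (and_tm (Var k) (Var (k+1))) (Var k),
       x \<^bold>= imp_tm (and_tm (Var k) (Var (k+1))) (Var (k+1)),
       x \<^bold>= imp_tm (Var k) (imp_tm (Var (k+1)) (and_tm (Var k) (Var (k+1)))),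
       x \<^bold>= imp_tm (Var k) (or_tm (Var k) (Var (k+1))),
       x \<^bold>= imp_tm (Var (k+1)) (or_tm (Var k) (Var (k+1))),
       x \<^bold>= imp_tm (imp_tm (Var k) (Var (k+2))) (imp_tm (imp_tm (Var (k+1)) (Var (k+2))) (imp_tm (or_tm (Var k) (Var (k+1))) (Var (k+2)))),
       Term_fm (k+6) (Var (k+5)) \<^bold>\<and> FreeFor_fm (k+6) (Var (k+5)) (Var (k+3)) (Var k) \<^bold>\<and> Sbt_fm (k+6) (Var k) (Var (k+5)) (Var (k+3)) (Var (k+1)) \<^bold>\<and> x \<^bold>= imp_tm (all_tm (Var (k+3)) (Var k)) (Var (k+1)),
       x \<^bold>= imp_tm (all_tm (Var (k+3)) (imp_tm (Var k) (Var (k+1)))) (imp_tm (all_tm (Var (k+3)) (Var k)) (all_tm (Var (k+3)) (Var (k+1)))),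
       NotFree_fm (k+6) (Var (k+3)) (Var k) \<^bold>\<and> x \<^bold>= imp_tm (Var k) (all_tm (Var (k+3)) (Var k)),
       x \<^bold>= imp_tm (ex_tm (Var (k+3)) (Var k)) (neg_tm (all_tm (Var (k+3)) (neg_tm (Var k)))),
       x \<^bold>= imp_tm (neg_tm (all_tm (Var (k+3)) (neg_tm (Var k)))) (ex_tm (Var (k+3)) (Var k)),
       x \<^bold>= pair_tm (num 6) (pair_tm (Var (k+5)) (Var (k+5))),
       Form_fm (k+6) (Var (k+2)) \<^bold>\<and> Var_fm (k+6) (Var (k+3)) \<^bold>\<and> FreeFor_fm (k+6) (Var (k+4)) (Var (k+3)) (Var (k+2)) \<^bold>\<and> FreeFor_fm (k+6) (Var (k+5)) (Var (k+3)) (Var (k+2)) \<^bold>\<and>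
         Sbt_fm (k+6) (Var (k+2)) (Var (k+4)) (Var (k+3)) (Var k) \<^bold>\<and> Sbt_fm (k+6) (Var (k+2)) (Var (k+5)) (Var (k+3)) (Var (k+1)) \<^bold>\<and>
         x \<^bold>= imp_tm (pair_tm (num 6) (pair_tm (Var (k+4)) (Var (k+5)))) (imp_tm (Var k) (Var (k+1)))]))"
    unfolding Schema_fm_def Let_def by simp
  also have "\<dots> \<longleftrightarrow> (\<exists>a b c v s t. schem (val M e x) a b c v s t)"
    using x tbs unfolding schem_def
    by (simp add: sat_FF0 sat_Sbt0 sat_NotFree0 numeral_eq_Suc)
  finally show ?thesis .
qed

lemma exI6: "P a b c v s t \<Longrightarrow> \<exists>a b c v s t. P a b c v s t" by blast

lemma sch1: "gc F = npair 13 (npair a (npair 13 (npair b a))) \<Longrightarrow> logical_schema F"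
  by (auto simp: gc_inv SFF_iff SSb_f_iff SNF_f_iff intro: logical_schema.intros)
lemma sch2: "gc F = npair 13 (npair (npair 13 (npair a (npair 13 (npair b c)))) (npair 13 (npair (npair 13 (npair a b)) (npair 13 (npair a c))))) \<Longrightarrow> logical_schema F"
  by (auto simp: gc_inv SFF_iff SSb_f_iff SNF_f_iff intro: logical_schema.intros)
lemma sch3: "gc F = npair 13 (npair (npair 13 (npair (npair 12 a) (npair 12 b))) (npair 13 (npair b a))) \<Longrightarrow> logical_schema F"
  by (auto simp: gc_inv SFF_iff SSb_f_iff SNF_f_iff intro: logical_schema.intros)
lemma sch4: "gc F = npair 13 (npair (npair 14 (npair a b)) a) \<Longrightarrow> logical_schema F"
  by (auto simp: gc_inv SFF_iff SSb_f_iff SNF_f_iff intro: logical_schema.intros)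
lemma sch5: "gc F = npair 13 (npair (npair 14 (npair a b)) b) \<Longrightarrow> logical_schema F"
  by (auto simp: gc_inv SFF_iff SSb_f_iff SNF_f_iff intro: logical_schema.intros)
lemma sch6: "gc F = npair 13 (npair a (npair 13 (npair b (npair 14 (npair a b))))) \<Longrightarrow> logical_schema F"
  by (auto simp: gc_inv SFF_iff SSb_f_iff SNF_f_iff intro: logical_schema.intros)
lemma sch7: "gc F = npair 13 (npair a (npair 15 (npair a b))) \<Longrightarrow> logical_schema F"
  by (auto simp: gc_inv SFF_iff SSb_f_iff SNF_f_iff intro: logical_schema.intros)
lemma sch8: "gc F = npair 13 (npair b (npair 15 (npair a b))) \<Longrightarrow> logical_schema F"
  by (auto simp: gc_inv SFF_iff SSb_f_iff SNF_f_iff intro: logical_schema.intros)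
lemma sch9: "gc F = npair 13 (npair (npair 13 (npair a c)) (npair 13 (npair (npair 13 (npair b c)) (npair 13 (npair (npair 15 (npair a b)) c))))) \<Longrightarrow> logical_schema F"
  by (auto simp: gc_inv SFF_iff SSb_f_iff SNF_f_iff intro: logical_schema.intros)
lemma sch10: "((\<exists>t'. t = gct t') \<and> SeqIn (SFF t v) a \<and> SeqIn (SSb t v) (npair a b) \<and> gc F = npair 13 (npair (npair 16 (npair v a)) b)) \<Longrightarrow> logical_schema F"
  by (auto simp: gc_inv SFF_iff SSb_f_iff SNF_f_iff intro: logical_schema.intros)
lemma sch11: "gc F = npair 13 (npair (npair 16 (npair v (npair 13 (npair a b)))) (npair 13 (npair (npair 16 (npair v a)) (npair 16 (npair v b))))) \<Longrightarrow> logical_schema F"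
  by (auto simp: gc_inv SFF_iff SSb_f_iff SNF_f_iff intro: logical_schema.intros)
lemma sch12: "(SeqIn (SNF v) a \<and> gc F = npair 13 (npair a (npair 16 (npair v a)))) \<Longrightarrow> logical_schema F"
  by (auto simp: gc_inv SFF_iff SSb_f_iff SNF_f_iff intro: logical_schema.intros)
lemma sch13: "gc F = npair 13 (npair (npair 17 (npair v a)) (npair 12 (npair 16 (npair v (npair 12 a))))) \<Longrightarrow> logical_schema F"
  by (auto simp: gc_inv SFF_iff SSb_f_iff SNF_f_iff intro: logical_schema.intros)
lemma sch14: "gc F = npair 13 (npair (npair 12 (npair 16 (npair v (npair 12 a)))) (npair 17 (npair v a))) \<Longrightarrow> logical_schema F"
  by (auto simp: gc_inv SFF_iff SSb_f_iff SNF_f_iff intro: logical_schema.intros)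
lemma sch15: "gc F = npair 6 (npair t t) \<Longrightarrow> logical_schema F"
  by (auto simp: gc_inv SFF_iff SSb_f_iff SNF_f_iff intro: logical_schema.intros)
lemma sch16: "((\<exists>C. c = gc C) \<and> (\<exists>i. v = gct (Var i)) \<and> SeqIn (SFF s v) c \<and> SeqIn (SFF t v) c \<and>
    SeqIn (SSb s v) (npair c a) \<and> SeqIn (SSb t v) (npair c b) \<and>
    gc F = npair 13 (npair (npair 6 (npair s t)) (npair 13 (npair a b)))) \<Longrightarrow> logical_schema F"
  by (auto simp: gc_inv SFF_iff SSb_f_iff SNF_f_iff intro: logical_schema.intros)

lemma schem_D: "schem (gc F) a b c v s t \<Longrightarrow> logical_schema F"
  unfolding schem_def apply (elim disjE)
  subgoal by (rule sch1)
  subgoal by (rule sch2)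
  subgoal by (rule sch3)
  subgoal by (rule sch4)
  subgoal by (rule sch5)
  subgoal by (rule sch6)
  subgoal by (rule sch7)
  subgoal by (rule sch8)
  subgoal by (rule sch9)
  subgoal by (rule sch10)
  subgoal by (rule sch11)
  subgoal by (rule sch12)
  subgoal by (rule sch13)
  subgoal by (rule sch14)
  subgoal by (rule sch15)
  subgoal by (rule sch16)
  done

lemma schem_I: "logical_schema F \<Longrightarrow> \<exists>a b c v s t. schem (gc F) a b c v s t"
proof (induction rule: logical_schema.induct)
  case (1 A B)
  show ?case by (rule exI6[of _ "gc A" "gc B" "0" "0" "0" "0"]) (use 1 in \<open>simp add: schem_def SFF_iff SSb_f_iff SNF_f_iff\<close>)
next
  case (2 A B C)
  show ?case by (rule exI6[of _ "gc A" "gc B" "gc C" "0" "0" "0"]) (use 2 in \<open>simp add: schem_def SFF_iff SSb_f_iff SNF_f_iff\<close>)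
next
  case (3 A B)
  show ?case by (rule exI6[of _ "gc A" "gc B" "0" "0" "0" "0"]) (use 3 in \<open>simp add: schem_def SFF_iff SSb_f_iff SNF_f_iff\<close>)
next
  case (4 A B)
  show ?case by (rule exI6[of _ "gc A" "gc B" "0" "0" "0" "0"]) (use 4 in \<open>simp add: schem_def SFF_iff SSb_f_iff SNF_f_iff\<close>)
next
  case (5 A B)
  show ?case by (rule exI6[of _ "gc A" "gc B" "0" "0" "0" "0"]) (use 5 in \<open>simp add: schem_def SFF_iff SSb_f_iff SNF_f_iff\<close>)
next
  case (6 A B)
  show ?case by (rule exI6[of _ "gc A" "gc B" "0" "0" "0" "0"]) (use 6 in \<open>simp add: schem_def SFF_iff SSb_f_iff SNF_f_iff\<close>)
next
  case (7 A B)
  show ?case by (rule exI6[of _ "gc A" "gc B" "0" "0" "0" "0"]) (use 7 in \<open>simp add: schem_def SFF_iff SSb_f_iff SNF_f_iff\<close>)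
next
  case (8 B A)
  show ?case by (rule exI6[of _ "gc A" "gc B" "0" "0" "0" "0"]) (use 8 in \<open>simp add: schem_def SFF_iff SSb_f_iff SNF_f_iff\<close>)
next
  case (9 A C B)
  show ?case by (rule exI6[of _ "gc A" "gc B" "gc C" "0" "0" "0"]) (use 9 in \<open>simp add: schem_def SFF_iff SSb_f_iff SNF_f_iff\<close>)
next
  case (10 t x A)
  show ?case by (rule exI6[of _ "gc A" "gc (sbt A t x)" "0" "gct (Var x)" "0" "gct t"]) (use 10 in \<open>simp add: schem_def SFF_iff SSb_f_iff SNF_f_iff\<close>)
next
  case (11 x A B)
  show ?case by (rule exI6[of _ "gc A" "gc B" "0" "gct (Var x)" "0" "0"]) (use 11 in \<open>simp add: schem_def SFF_iff SSb_f_iff SNF_f_iff\<close>)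
next
  case (12 x A)
  show ?case by (rule exI6[of _ "gc A" "0" "0" "gct (Var x)" "0" "0"]) (use 12 in \<open>simp add: schem_def SFF_iff SSb_f_iff SNF_f_iff\<close>)
next
  case (13 x A)
  show ?case by (rule exI6[of _ "gc A" "0" "0" "gct (Var x)" "0" "0"]) (use 13 in \<open>simp add: schem_def SFF_iff SSb_f_iff SNF_f_iff\<close>)
next
  case (14 x A)
  show ?case by (rule exI6[of _ "gc A" "0" "0" "gct (Var x)" "0" "0"]) (use 14 in \<open>simp add: schem_def SFF_iff SSb_f_iff SNF_f_iff\<close>)
next
  case (15 t)
  show ?case by (rule exI6[of _ "0" "0" "0" "0" "0" "gct t"]) (use 15 in \<open>simp add: schem_def SFF_iff SSb_f_iff SNF_f_iff\<close>)
next
  case (16 s x A t)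
  show ?case by (rule exI6[of _ "gc (sbt A s x)" "gc (sbt A t x)" "gc A" "gct (Var x)" "gct s" "gct t"]) (use 16 in \<open>simp add: schem_def SFF_iff SSb_f_iff SNF_f_iff\<close>)
qed

lemma schem_iff: "(\<exists>a b c v s t. schem (gc F) a b c v s t) \<longleftrightarrow> logical_schema F"
  using schem_D schem_I by blast

declare gc.simps [simp del] gct.simps [simp del]

lemma generalizations_self: "A \<in> generalizations A"
  by (auto simp: generalizations_def intro: exI[of _ "[]"])

lemma code_ex: "((\<exists>B. S B \<and> v = gc B) \<and> N v) \<longleftrightarrow> v \<in> gc ` {B. S B \<and> N (gc B)}" by auto
lemma ex_code: "(\<exists>n. (\<exists>A. n = gc A \<and> G A) \<and> N n) \<longleftrightarrow> (\<exists>A. G A \<and> N (gc A))" by auto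

lemma sat_LogAx [simp]:
  assumes y: "tb k y"
  shows "sat M e (LogAx_fm k y) \<longleftrightarrow> val M e y \<in> gc ` logical_axioms"
proof -
  have "sat M e (LogAx_fm k y) \<longleftrightarrow> (\<exists>B. sentence B \<and> val M e y = gc B) \<and>
     (\<exists>n. SeqIn (SGe n) (val M e y) \<and> (\<exists>a b c v s t. schem n a b c v s t))"
    using y by (simp add: LogAx_fm_def sat_Gen0 sat_Schema0)
  also have "\<dots> \<longleftrightarrow> val M e y \<in> gc ` {B. sentence B \<and> (\<exists>n. SeqIn (SGe n) (gc B) \<and> (\<exists>a b c v s t. schem n a b c v s t))}"
    by (rule code_ex)
  also have "{B. sentence B \<and> (\<exists>n. SeqIn (SGe n) (gc B) \<and> (\<exists>a b c v s t. schem n a b c v s t))} = logical_axioms"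
  proof -
    have "(\<exists>n. SeqIn (SGe n) (gc B) \<and> (\<exists>a b c v s t. schem n a b c v s t)) \<longleftrightarrow> (\<exists>A. logical_schema A \<and> B \<in> generalizations A)" for B
    proof -
      have "(\<exists>n. SeqIn (SGe n) (gc B) \<and> (\<exists>a b c v s t. schem n a b c v s t)) \<longleftrightarrow>
        (\<exists>n. (\<exists>A. n = gc A \<and> B \<in> generalizations A) \<and> (\<exists>a b c v s t. schem n a b c v s t))"
        by (simp only: SGe_iff)
      also have "\<dots> \<longleftrightarrow> (\<exists>A. B \<in> generalizations A \<and> (\<exists>a b c v s t. schem (gc A) a b c v s t))"
        by (rule ex_code)
      finally show ?thesis by (simp only: schem_iff conj_commute)
    qed
    then show ?thesis by (simp only: logical_axioms_def)
  qed
  finally show ?thesis .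
qed

lemma sat_IndAx:
  assumes x: "tb k x" and v: "val M e x = gc F"
  shows "sat M e (IndAx_fm k x) \<longleftrightarrow> (\<exists>i A. F = induction_schema i A)"
proof -
  have "sat M e (IndAx_fm k x) \<longleftrightarrow> (\<exists>v a b c. 
     gc F = npair 13 (npair (npair 14 (npair b (npair 16 (npair v (npair 13 (npair a c)))))) (npair 16 (npair v a))) \<and>
     SeqIn (SSb (gct Zero) v) (npair a b) \<and> SeqIn (SSb (npair 2 v) v) (npair a c))"
    using x v by (simp add: IndAx_fm_def Let_def sat_Sbt0)
  also have "\<dots> \<longleftrightarrow> (\<exists>i A. F = induction_schema i A)"
  proof
    assume "\<exists>v a b c. 
     gc F = npair 13 (npair (npair 14 (npair b (npair 16 (npair v (npair 13 (npair a c)))))) (npair 16 (npair v a))) \<and>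
     SeqIn (SSb (gct Zero) v) (npair a b) \<and> SeqIn (SSb (npair 2 v) v) (npair a c)"
    then show "\<exists>i A. F = induction_schema i A"
      using SSb_f_iff[of "Succ (Var i)" i for i]
      by (auto simp: gc_inv induction_schema_def SSb_f_iff gct.simps(3))
  next
    assume "\<exists>i A. F = induction_schema i A"
    then obtain i A where F: "F = induction_schema i A" by blast
    show "\<exists>v a b c. 
     gc F = npair 13 (npair (npair 14 (npair b (npair 16 (npair v (npair 13 (npair a c)))))) (npair 16 (npair v a))) \<and>
     SeqIn (SSb (gct Zero) v) (npair a b) \<and> SeqIn (SSb (npair 2 v) v) (npair a c)"
      by (rule exI[of _ "gct (Var i)"], rule exI[of _ "gc A"], rule exI[of _ "gc (sbt A Zero i)"], rule exI[of _ "gc (sbt A (Succ (Var i)) i)"])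
         (use SSb_f_iff[of "Succ (Var i)" i A] in \<open>simp add: F induction_schema_def gc.simps SSb_f_iff gct.simps(3)\<close>)
  qed
  finally show ?thesis .
qed

lemma sat_PAAx [simp]:
  assumes y: "tb k y"
  shows "sat M e (PAAx_fm k y) \<longleftrightarrow> val M e y \<in> gc ` PA_axioms"
proof -
  have "sat M (e(k := gc A)) (IndAx_fm (Suc k) (Var k)) \<longleftrightarrow> (\<exists>i C. A = induction_schema i C)" for A
    by (rule sat_IndAx) auto
  note ind = this
  have *: "(\<exists>n. SeqIn (SGe n) (gc B) \<and> sat M (e(k := n)) (IndAx_fm (Suc k) (Var k))) \<longleftrightarrow> 
     (\<exists>i A. B \<in> generalizations (induction_schema i A))" for B
    unfolding SGe_iff ex_code by (simp only: ind) blast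
  have "sat M e (PAAx_fm k y) \<longleftrightarrow> val M e y \<in> gc ` {PA1, PA2, PA3, PA4, PA5, PA6} \<or> 
     (\<exists>B. sentence B \<and> val M e y = gc B) \<and>
     (\<exists>n. SeqIn (SGe n) (val M e y) \<and> sat M (e(k := n)) (IndAx_fm (Suc k) (Var k)))"
    using y by (simp add: PAAx_fm_def sat_Gen0)
  also have "\<dots> \<longleftrightarrow> val M e y \<in> gc ` PA_axioms"
    unfolding PA_axioms_def image_Un Un_iff
    by (subst code_ex[where N="\<lambda>z. \<exists>n. SeqIn (SGe n) z \<and> sat M (e(k := n)) (IndAx_fm (Suc k) (Var k))"]) (simp only: *)
  finally show ?thesis .
qed

definition "SPr R Q y \<longleftrightarrow> y \<in> gc ` logical_axioms \<or> y \<in> gc ` PA_axioms \<or> y = gc NonTriv \<or> y = gc K1K2 \<or> y = gc UKK \<or> y = R \<or>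
  (\<exists>z. z \<in> Q \<and> npair 13 (npair z y) \<in> Q)"

lemma sat_PrFrom0:
  assumes "tb k r" "tb k x"
  shows "sat M e (PrFrom_fm k r x) \<longleftrightarrow> SeqIn (SPr (val M e r)) (val M e x)"
  unfolding PrFrom_fm_def
proof (rule sat_Ind, fact, goal_cases)
  case (1 k' mem Q e' y)
  have v: "tb k' r" using 1 assms tb_mono by (metis add_leE)
  have [simp]: "val M e' r = val M e r" using assms 1(2) by (rule_tac val_agree; simp)
  show ?case using 1 v by (simp add: SPr_def)
qed

lemma SPr_iff: "SeqIn (SPr (gc B)) y \<longleftrightarrow> y \<in> gc ` thms (PA_axioms \<union> {NonTriv, K1K2, UKK, B}) {}"
proof (rule SeqIn_eq)
  fix Q y assume "SPr (gc B) Q y" and Q: "Q \<subseteq> gc ` thms (PA_axioms \<union> {NonTriv, K1K2, UKK, B}) {}"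
  then show "y \<in> gc ` thms (PA_axioms \<union> {NonTriv, K1K2, UKK, B}) {}"
    unfolding SPr_def
  proof (elim disjE)
    assume "\<exists>z. z \<in> Q \<and> npair 13 (npair z y) \<in> Q"
    then obtain z where "z \<in> Q" "npair 13 (npair z y) \<in> Q" by blast
    then obtain A C where "z = gc A" "A \<in> thms (PA_axioms \<union> {NonTriv, K1K2, UKK, B}) {}"
       "npair 13 (npair z y) = gc C" "C \<in> thms (PA_axioms \<union> {NonTriv, K1K2, UKK, B}) {}" using Q by blast
    moreover then obtain D where "C = Imp A D" "y = gc D" 
      using gc_inv(3)[of C "npair z y"] by auto
    ultimately show ?thesis using thms.mp by blast
  qed (auto intro: thms.intros)
next
  let ?T = "thms (PA_axioms \<union> {NonTriv, K1K2, UKK, B}) {}"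
  assume st: "\<And>Q y. SPr (gc B) Q y \<Longrightarrow> finite Q \<Longrightarrow> \<forall>z\<in>Q. SeqIn (SPr (gc B)) z \<Longrightarrow> SeqIn (SPr (gc B)) y"
  have "A \<in> ?T \<Longrightarrow> SeqIn (SPr (gc B)) (gc A)" for A
  proof (induction rule: thms.induct)
    case (logic A) then show ?case by (intro st[of "{}"]) (auto simp: SPr_def)
  next case (axiom A) then show ?case by (intro st[of "{}"]) (auto simp: SPr_def)
  next
    case (mp A C) 
    have "SPr (gc B) {gc A, gc (Imp A C)} (gc C)" by (auto simp: SPr_def gc.simps)
    then show ?case by (rule st) (use mp in auto)
  qed auto
  then show "\<forall>z\<in>gc ` ?T. SeqIn (SPr (gc B)) z" by blast
qed (unfold SPr_def, blast)



lemma fv_le: "fv (le_fm k s t) \<subseteq> fvt s \<union> fvt t" by (auto simp: le_fm_def)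
lemma fv_less: "fv (less_fm k s t) \<subseteq> fvt s \<union> fvt t" using fv_le[of k "Succ s" t] by (auto simp: less_fm_def)
lemma fv_beta: "fv (beta_fm k a b i y) \<subseteq> fvt a \<union> fvt b \<union> fvt i \<union> fvt y"
  using fv_le[of k y "Mul (Succ i) b"] by (auto simp: beta_fm_def)
lemma fv_Disj [simp]: "fv (Disj As) = (\<Union>A\<in>set As. fv A)" by (induction As) (auto simp: Disj_def)

lemma fv_Ind:
  assumes "\<And>k' mem y D. (\<And>k'' z. fv (mem k'' z) \<subseteq> fvt z \<union> D) \<Longrightarrow> fv (step k' mem y) \<subseteq> fvt y \<union> (F \<union> D)"
  shows "fv (Ind_fm k step x) \<subseteq> fvt x \<union> F"
proof -
  define mem where "mem = (\<lambda>j z. \<^bold>\<exists>j. less_fm (j+1) (Var j) (Var (k+3)) \<^bold>\<and> beta_fm (j+1) (Var k) (Var (k+1)) (Var j) z)"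
  have "fv (mem j z) \<subseteq> fvt z \<union> {k, k+1, k+3}" for j z
    using fv_less[of "j+1" "Var j" "Var (k+3)"] fv_beta[of "j+1" "Var k" "Var (k+1)" "Var j" z]
    by (auto simp: mem_def)
  from assms[of mem, OF this, of "k+5" "Var (k+4)"]
  have "fv (step (k+5) mem (Var (k+4))) \<subseteq> {k+4} \<union> F \<union> {k, k+1, k+3}" by simp
  then show ?thesis unfolding Ind_fm_def Let_def mem_def[symmetric]
    using fv_beta[of "k+3" "Var k" "Var (k+1)" "Var (k+2)" x] fv_le[of "k+4" "Var (k+3)" "Var (k+2)"] fv_beta[of "k+5" "Var k" "Var (k+1)" "Var (k+3)" "Var (k+4)"]
    by auto
qed

lemma fv_Var [simp]: "fv (Var_fm k x) = fvt x - {k}" by (auto simp: Var_fm_def)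

lemma fv_un: assumes "\<And>k s. fv (P k s) \<subseteq> fvt s \<union> S" and "fvt y \<subseteq> S" shows "fv (un_fm k cs P y) \<subseteq> S"
  using assms(1)[of "k+1" "Var k"] assms(2) unfolding un_fm_def by auto
lemma fv_bin: assumes "\<And>k s t. fv (P k s t) \<subseteq> fvt s \<union> fvt t \<union> S" and "fvt y \<subseteq> S" shows "fv (bin_fm k cs P y) \<subseteq> S"
  using assms(1)[of "k+2" "Var k" "Var (k+1)"] assms(2) unfolding bin_fm_def by auto
lemma fv_Disj_le: "(\<And>c. c \<in> set cs \<Longrightarrow> fv (f c) \<subseteq> S) \<Longrightarrow> fv (Disj (map f cs)) \<subseteq> S"
  by (auto)

lemma fvt_tms [simp]: "fvt (T_tm t) = fvt t" "fvt (K2_tm s t) = fvt s \<union> fvt t"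
  "fvt (neg_tm t) = fvt t" "fvt (imp_tm s t) = fvt s \<union> fvt t" "fvt (and_tm s t) = fvt s \<union> fvt t"
  "fvt (or_tm s t) = fvt s \<union> fvt t" "fvt (all_tm s t) = fvt s \<union> fvt t" "fvt (ex_tm s t) = fvt s \<union> fvt t"
  by (auto simp: T_tm_def K2_tm_def neg_tm_def imp_tm_def and_tm_def or_tm_def all_tm_def ex_tm_def)

lemma fv_Term: "fv (Term_fm k x) \<subseteq> fvt x"
proof -
  have "fv (Term_fm k x) \<subseteq> fvt x \<union> {}" unfolding Term_fm_def
  proof (rule fv_Ind, goal_cases)
    case (1 k' mem y D)
    have m: "i \<in> fv (mem k z) \<Longrightarrow> i \<in> fvt z \<union> D" for i k z using 1 by blast
    show ?case unfolding term_step_def fv.simps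
      by (intro Un_least fv_un fv_bin fv_Disj_le; auto dest!: m )
  qed
  then show ?thesis by auto
qed

lemma fv_TermL0: "fv (TermL0_fm k x) \<subseteq> fvt x"
proof -
  have "fv (TermL0_fm k x) \<subseteq> fvt x \<union> {}" unfolding TermL0_fm_def
  proof (rule fv_Ind, goal_cases)
    case (1 k' mem y D)
    have m: "i \<in> fv (mem k z) \<Longrightarrow> i \<in> fvt z \<union> D" for i k z using 1 by blast
    show ?case unfolding term_step_def fv.simps
      by (intro Un_least fv_un fv_bin fv_Disj_le; auto dest!: m )
  qed
  then show ?thesis by auto
qed

lemma fv_TermPA0: "fv (TermPA0_fm k x) \<subseteq> fvt x"
proof -
  have "fv (TermPA0_fm k x) \<subseteq> fvt x \<union> {}" unfolding TermPA0_fm_def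
  proof (rule fv_Ind, goal_cases)
    case (1 k' mem y D)
    have m: "i \<in> fv (mem k z) \<Longrightarrow> i \<in> fvt z \<union> D" for i k z using 1 by blast
    show ?case unfolding term_step_def fv.simps
      by (intro Un_least fv_un fv_bin fv_Disj_le; auto dest!: m )
  qed
  then show ?thesis by auto
qed

lemma fv_Form: "fv (Form_fm k x) \<subseteq> fvt x"
proof -
  have "fv (Form_fm k x) \<subseteq> fvt x \<union> {}" unfolding Form_fm_def
  proof (rule fv_Ind, goal_cases)
    case (1 k' mem y D)
    have m: "i \<in> fv (mem k z) \<Longrightarrow> i \<in> fvt z \<union> D" for i k z using 1 by blast
    show ?case unfolding fv.simps
      by (intro Un_least fv_un fv_bin fv_Disj_le; auto dest!: m fv_Term[THEN subsetD])
  qed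
  then show ?thesis by auto
qed

lemma fv_NotFree: "fv (NotFree_fm k v x) \<subseteq> fvt v \<union> fvt x"
proof -
  have "fv (NotFree_fm k v x) \<subseteq> fvt x \<union> fvt v" unfolding NotFree_fm_def
  proof (rule fv_Ind, goal_cases)
    case (1 k' mem y D)
    have m: "i \<in> fv (mem k z) \<Longrightarrow> i \<in> fvt z \<union> D" for i k z using 1 by blast
    show ?case unfolding fv.simps
      by (intro Un_least fv_un fv_bin fv_Disj_le; auto dest!: m )
  qed
  then show ?thesis by auto
qed

lemma fv_Num: "fv (Num_fm k n t) \<subseteq> fvt n \<union> fvt t"
proof -
  have "fv (Num_fm k n t) \<subseteq> fvt (pair_tm n t) \<union> {}" unfolding Num_fm_def
  proof (rule fv_Ind, goal_cases)
    case (1 k' mem y D)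
    have m: "i \<in> fv (mem k z) \<Longrightarrow> i \<in> fvt z \<union> D" for i k z using 1 by blast
    show ?case unfolding fv.simps
      by (intro Un_least fv_un fv_bin fv_Disj_le; auto dest!: m )
  qed
  then show ?thesis by auto
qed

lemma fv_Val: "fv (Val_fm k t n) \<subseteq> fvt t \<union> fvt n"
proof -
  have "fv (Val_fm k t n) \<subseteq> fvt (pair_tm t n) \<union> {}" unfolding Val_fm_def
  proof (rule fv_Ind, goal_cases)
    case (1 k' mem y D)
    have m: "i \<in> fv (mem k z) \<Longrightarrow> i \<in> fvt z \<union> D" for i k z using 1 by blast
    show ?case unfolding val_step_def fv.simps
      by (intro Un_least fv_un fv_bin fv_Disj_le; auto dest!: m )
  qed
  then show ?thesis by auto
qed

lemma fv_Gen: "fv (Gen_fm k x y) \<subseteq> fvt x \<union> fvt y"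
proof -
  have "fv (Gen_fm k x y) \<subseteq> fvt y \<union> fvt x" unfolding Gen_fm_def
  proof (rule fv_Ind, goal_cases)
    case (1 k' mem y D)
    have m: "i \<in> fv (mem k z) \<Longrightarrow> i \<in> fvt z \<union> D" for i k z using 1 by blast
    show ?case unfolding fv.simps
      by (intro Un_least fv_un fv_bin fv_Disj_le; auto dest!: m )
  qed
  then show ?thesis by auto
qed

lemma fv_FreeFor: "fv (FreeFor_fm k t v x) \<subseteq> fvt t \<union> fvt v \<union> fvt x"
proof -
  have "fv (FreeFor_fm k t v x) \<subseteq> fvt x \<union> (fvt t \<union> fvt v)" unfolding FreeFor_fm_def
  proof (rule fv_Ind, goal_cases)
    case (1 k' mem y D)
    have m: "i \<in> fv (mem k z) \<Longrightarrow> i \<in> fvt z \<union> D" for i k z using 1 by blast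
    show ?case unfolding fv.simps
      by (intro Un_least fv_un fv_bin fv_Disj_le; auto dest!: m fv_NotFree[THEN subsetD])
  qed
  then show ?thesis by auto
qed

lemma fv_sbt_step:
  assumes "\<And>k z. fv (mem k z) \<subseteq> fvt z \<union> D"
  shows "fv (sbt_step t v k mem x y) \<subseteq> fvt t \<union> fvt v \<union> fvt x \<union> fvt y \<union> D"
proof -
  have m: "i \<in> fv (mem k z) \<Longrightarrow> i \<in> fvt z \<union> D" for i k z using assms by blast
  show ?thesis unfolding sbt_step_def fv.simps
    by (intro Un_least fv_un fv_bin fv_Disj_le; auto dest!: m)
qed

lemma fv_Sbt: "fv (Sbt_fm k x t v y) \<subseteq> fvt x \<union> fvt t \<union> fvt v \<union> fvt y"
proof -
  have "fv (Sbt_fm k x t v y) \<subseteq> fvt (pair_tm x y) \<union> (fvt t \<union> fvt v)" unfolding Sbt_fm_def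
  proof (rule fv_Ind, goal_cases)
    case (1 k' mem y D)
    show ?case using fv_sbt_step[of mem D t v "k'+2" "Var k'" "Var (k'+1)", OF 1] by auto
  qed
  then show ?thesis by auto
qed

lemma fv_Sent: "fv (Sent_fm k x) \<subseteq> fvt x"
  by (auto simp: Sent_fm_def dest!: fv_Form[THEN subsetD] fv_NotFree[THEN subsetD] fv_le[THEN subsetD])
lemma fv_L1: "fv (L1_fm k v x) \<subseteq> fvt v \<union> fvt x"
  by (auto simp: L1_fm_def dest!: fv_Form[THEN subsetD] fv_NotFree[THEN subsetD] fv_le[THEN subsetD])
lemma fv_Schema: "fv (Schema_fm k x) \<subseteq> fvt x"
  by (auto simp: Schema_fm_def Let_def simp del: fv_Disj simp: fv_Disj[of "_ # _"] dest!: fv_Form[THEN subsetD] fv_NotFree[THEN subsetD] fv_Term[THEN subsetD] fv_FreeFor[THEN subsetD] fv_Sbt[THEN subsetD])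
lemma fv_LogAx: "fv (LogAx_fm k x) \<subseteq> fvt x"
  by (auto simp: LogAx_fm_def dest!: fv_Sent[THEN subsetD] fv_Gen[THEN subsetD] fv_Schema[THEN subsetD])
lemma fv_IndAx: "fv (IndAx_fm k x) \<subseteq> fvt x"
  by (auto simp: IndAx_fm_def Let_def dest!: fv_Sbt[THEN subsetD])
lemma fv_PAAx: "fv (PAAx_fm k x) \<subseteq> fvt x"
  by (auto simp: PAAx_fm_def dest!: fv_Sent[THEN subsetD] fv_Gen[THEN subsetD] fv_IndAx[THEN subsetD])

lemma fv_PrFrom: "fv (PrFrom_fm k r x) \<subseteq> fvt r \<union> fvt x"
proof -
  have "fv (PrFrom_fm k r x) \<subseteq> fvt x \<union> fvt r" unfolding PrFrom_fm_def
  proof (rule fv_Ind, goal_cases)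
    case (1 k' mem y D)
    have m: "i \<in> fv (mem k z) \<Longrightarrow> i \<in> fvt z \<union> D" for i k z using 1 by blast
    show ?case unfolding fv.simps
      by (intro Un_least fv_un fv_bin fv_Disj_le; auto dest!: m fv_LogAx[THEN subsetD] fv_PAAx[THEN subsetD])
  qed
  then show ?thesis by auto
qed

lemma fv_PrDiag: "fv (PrDiag_fm k t x) \<subseteq> fvt t \<union> fvt x"
  by (auto simp: PrDiag_fm_def Let_def dest!: fv_Num[THEN subsetD] fv_Sbt[THEN subsetD] fv_PrFrom[THEN subsetD])

lemmas fvs = fv_Sent[THEN subsetD] fv_L1[THEN subsetD] fv_Num[THEN subsetD] fv_Val[THEN subsetD] fv_Sbt[THEN subsetD] fv_TermL0[THEN subsetD]
  fv_TermPA0[THEN subsetD] fv_PrDiag[THEN subsetD] 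

lemma closed:
  "sentence NonTriv" "sentence K1K2" "sentence UKK" "sentence R_DCB"
  "A \<in> {PA1,PA2,PA3,PA4,PA5,PA6} \<Longrightarrow> sentence A"
  "sentence T_neg" "sentence (T_bin imp_tm Imp)" "sentence (T_bin and_tm And)" "sentence (T_bin or_tm Or)"
  "sentence T_all" "sentence T_ex" "sentence Ax_V" "sentence UBF" "sentence IA" "sentence In_plus" "sentence In_minus"
  unfolding sentence_def
  by (auto simp: NonTriv_def K1K2_def UKK_def R_DCB_def R_schema_def Pr_DCB_fm_def PA1_def PA2_def PA3_def PA4_def PA5_def PA6_def
    T_neg_def T_bin_def T_all_def T_ex_def Ax_V_def UBF_def IA_def In_plus_def In_minus_def dest!: fvs)

lemma closed_PA: "A \<in> PA_axioms \<Longrightarrow> sentence A"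
  unfolding PA_axioms_def using closed(5) by auto

lemma subt_id: "i \<notin> fvt a \<Longrightarrow> subt a t i = a" by (induction a) auto
lemma sbt_id: "i \<notin> fv A \<Longrightarrow> sbt A t i = A" by (induction A) (auto simp: subt_id)

lemma fixpoint: "sbt R_diag (gq R_diag) 0 = R_DCB"
proof -
  have *: "0 \<notin> fv (Sent_fm 3 v2)" "0 \<notin> fv (Num_fm 5 (Var 3) (Var 4))" "0 \<notin> fv (Sbt_fm 6 (Var 3) (Var 4) (num (gct v0)) (Var 5))"
     "0 \<notin> fv (PrFrom_fm 6 (Var 5) v2)"
    by (auto dest!: fvs fv_PrFrom[THEN subsetD])
  show ?thesis using * 
    by (subst R_diag_def) (simp add: R_DCB_def R_schema_def Pr_DCB_fm_def PrDiag_fm_def Let_def sbt_id subt_id del: One_nat_def)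
qed

lemma sat_PrDCB:
  assumes x: "tb k x"
  shows "sat M e (Pr_DCB_fm k x) \<longleftrightarrow> val M e x \<in> gc ` DCB"
proof -
  have s: "sat M (e(k := gc R_diag, Suc k := gct (num (gc R_diag)), k + 2 := r)) (Sbt_fm (k + 3) (Var k) (Var (Suc k)) (num (gct v0)) (Var (k + 2)))
    \<longleftrightarrow> r = gc R_DCB" for r
    using fixpoint by (subst sat_Sbt_f[where A=R_diag and b="gq R_diag" and i=0]) (auto simp: gq_def)
  have "sat M e (Pr_DCB_fm k x) \<longleftrightarrow> SeqIn (SPr (gc R_DCB)) (val M e x)"
    using x s by (simp add: Pr_DCB_fm_def PrDiag_fm_def Let_def sat_PrFrom0)
  also have "\<dots> \<longleftrightarrow> val M e x \<in> gc ` DCB"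
    unfolding SPr_iff DCB_def DCB_axioms_def by simp
  finally show ?thesis .
qed

lemma sat_agree: "\<forall>i\<in>fv A. e' i = e i \<Longrightarrow> sat M e' A \<longleftrightarrow> sat M e A"
proof (induction A arbitrary: e e')
  case (PU t)
  have "val M e' t = val M e t" by (rule val_agree0) (use PU in simp)
  then show ?case by simp
next
  case (PAg t)
  have "val M e' t = val M e t" by (rule val_agree0) (use PAg in simp)
  then show ?case by simp
next
  case (PK1 t)
  have "val M e' t = val M e t" by (rule val_agree0) (use PK1 in simp)
  then show ?case by simp
next
  case (PT t)
  have "val M e' t = val M e t" by (rule val_agree0) (use PT in simp)
  then show ?case by simp
next
  case (Eq s t)
  have "val M e' s = val M e s" "val M e' t = val M e t" by (rule val_agree0; use Eq in simp)+
  then show ?case by simp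
next
  case (PK2 s t)
  have "val M e' s = val M e s" "val M e' t = val M e t" by (rule val_agree0; use PK2 in simp)+
  then show ?case by simp
next
  case (Neg A)
  have "sat M e' A \<longleftrightarrow> sat M e A" by (rule Neg.IH) (use Neg.prems in simp)
  then show ?case by simp
next
  case (Imp A B)
  have "sat M e' A \<longleftrightarrow> sat M e A" by (rule Imp.IH) (use Imp.prems in simp)
  moreover have "sat M e' B \<longleftrightarrow> sat M e B" by (rule Imp.IH) (use Imp.prems in simp)
  ultimately show ?case by simp
next
  case (And A B)
  have "sat M e' A \<longleftrightarrow> sat M e A" by (rule And.IH) (use And.prems in simp)
  moreover have "sat M e' B \<longleftrightarrow> sat M e B" by (rule And.IH) (use And.prems in simp)
  ultimately show ?case by simp
next
  case (Or A B)
  have "sat M e' A \<longleftrightarrow> sat M e A" by (rule Or.IH) (use Or.prems in simp)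
  moreover have "sat M e' B \<longleftrightarrow> sat M e B" by (rule Or.IH) (use Or.prems in simp)
  ultimately show ?case by simp
next
  case (Forall x A)
  have "sat M (e'(x := n)) A \<longleftrightarrow> sat M (e(x := n)) A" for n by (rule Forall.IH) (use Forall.prems in simp)
  then show ?case by simp
next
  case (Exists x A)
  have "sat M (e'(x := n)) A \<longleftrightarrow> sat M (e(x := n)) A" for n by (rule Exists.IH) (use Exists.prems in simp)
  then show ?case by simp
qed

primrec substs :: "fm \<Rightarrow> nat list \<Rightarrow> tm list \<Rightarrow> fm" where
  "substs B [] ts = B" | "substs B (x # xs) ts = substs (sbt B (hd ts) x) xs (tl ts)"
primrec upd where
  "upd M e [] ts = e" | "upd M e (x # xs) ts = upd M (e(x := cv M (hd ts))) xs (tl ts)"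

lemma upd_agree: "e' i = e i \<Longrightarrow> upd M e' xs ts i = upd M e xs ts i"
proof (induction xs arbitrary: e e' ts)
  case (Cons x xs)
  show ?case unfolding upd.simps by (rule Cons.IH) (use Cons.prems in auto)
qed simp

lemma all_code: "(\<forall>n. (\<exists>t. P t \<and> n = gct t) \<longrightarrow> N n) \<longleftrightarrow> (\<forall>t. P t \<longrightarrow> N (gct t))" by auto

lemma sat_T_atom0:
  assumes "tb k c" "\<forall>x\<in>set xs. x < k" "fvt c \<inter> set xs = {}" "fv A \<subseteq> {..<k}" "val M e c = gc B"
  shows "sat M e (T_atom_fm k c A xs) \<longleftrightarrow> (\<forall>ts. length ts = length xs \<and> (\<forall>t\<in>set ts. PAtm t \<and> fvt t = {}) \<longrightarrow>
     (gc (substs B xs ts) \<in> Tint M \<longleftrightarrow> sat M (upd M e xs ts) A))"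
  using assms
proof (induction xs arbitrary: k c e B)
  case Nil then show ?case by auto
next
  case (Cons x xs)
  have x: "x < k" "x \<notin> fvt c" using Cons.prems by auto
  have main: "(\<exists>n. sat M (e(k := gct t, x := n)) (Val_fm (k+1) (Var k) (Var x)) \<and> (\<exists>m. sat M (e(k := gct t, x := n, k+1 := m)) (Sbt_fm (k+2) c (Var k) (num (gct (Var x))) (Var (k+1)) \<^bold>\<and>
          T_atom_fm (k+2) (Var (k+1)) A xs))) \<longleftrightarrow> 
     (\<forall>ts. length ts = length xs \<and> (\<forall>t\<in>set ts. PAtm t \<and> fvt t = {}) \<longrightarrow>
     (gc (substs (sbt B t x) xs ts) \<in> Tint M \<longleftrightarrow> sat M (upd M (e(x := cv M t)) xs ts) A))"
    if t: "PAtm t" "fvt t = {}" for t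
  proof -
    have v: "sat M (e(k := gct t, x := n)) (Val_fm (k+1) (Var k) (Var x)) \<longleftrightarrow> n = cv M t" for n
      using t x by (subst sat_Val[where t=t]) auto
    have vc: "val M (e(k := gct t, x := n, k+1 := m)) c = gc B" for n m
    proof -
      have "val M (e(k := gct t, x := n, k+1 := m)) c = val M e c"
        by (rule val_agree0) (use Cons.prems(1) x in \<open>auto simp: tb_def\<close>)
      then show ?thesis using Cons.prems by simp
    qed
    have s: "sat M (e(k := gct t, x := n, k+1 := m)) (Sbt_fm (k+2) c (Var k) (num (gct (Var x))) (Var (k+1))) \<longleftrightarrow> m = gc (sbt B t x)" for n m
      by (subst sat_Sbt_f[where A=B and b=t and i=x]) (use vc Cons.prems(1) x in auto)
    have a: "sat M (e(k := gct t, x := cv M t, k+1 := gc (sbt B t x))) (T_atom_fm (k+2) (Var (k+1)) A xs) \<longleftrightarrow> 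
     (\<forall>ts. length ts = length xs \<and> (\<forall>t\<in>set ts. PAtm t \<and> fvt t = {}) \<longrightarrow>
     (gc (substs (sbt B t x) xs ts) \<in> Tint M \<longleftrightarrow> sat M (upd M (e(k := gct t, x := cv M t, k+1 := gc (sbt B t x))) xs ts) A))"
      by (rule Cons.IH) (use Cons.prems in auto)
    have b: "sat M (upd M (e(k := gct t, x := cv M t, k+1 := gc (sbt B t x))) xs ts) A \<longleftrightarrow> sat M (upd M (e(x := cv M t)) xs ts) A" for ts
      by (rule sat_agree, rule ballI, rule upd_agree) (use Cons.prems(4) in auto)
    have "(\<exists>n. sat M (e(k := gct t, x := n)) (Val_fm (k+1) (Var k) (Var x)) \<and> (\<exists>m. sat M (e(k := gct t, x := n, k+1 := m)) (Sbt_fm (k+2) c (Var k) (num (gct (Var x))) (Var (k+1)) \<^bold>\<and>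
          T_atom_fm (k+2) (Var (k+1)) A xs))) \<longleftrightarrow> sat M (e(k := gct t, x := cv M t, k+1 := gc (sbt B t x))) (T_atom_fm (k+2) (Var (k+1)) A xs)"
      unfolding v sat.simps(9) s by blast
    then show ?thesis unfolding a b .
  qed
  have "sat M e (T_atom_fm k c A (x # xs)) \<longleftrightarrow> (\<forall>t. PAtm t \<and> fvt t = {} \<longrightarrow> (\<exists>n. sat M (e(k := gct t, x := n)) (Val_fm (k+1) (Var k) (Var x)) \<and> (\<exists>m. sat M (e(k := gct t, x := n, k+1 := m)) (Sbt_fm (k+2) c (Var k) (num (gct (Var x))) (Var (k+1)) \<^bold>\<and>
          T_atom_fm (k+2) (Var (k+1)) A xs))))"
  proof -
    have "sat M (e(k := n)) (TermPA0_fm (k+1) (Var k)) \<longleftrightarrow> (\<exists>t. (PAtm t \<and> fvt t = {}) \<and> n = gct t)" for n by simp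
    then show ?thesis unfolding T_atom_fm.simps sat.simps(8,11,12) sat.simps(9)[of M _ "Val_fm _ _ _"]
      by (simp only: all_code)
  qed
  also have "\<dots> \<longleftrightarrow> (\<forall>t. PAtm t \<and> fvt t = {} \<longrightarrow> (\<forall>ts. length ts = length xs \<and> (\<forall>t\<in>set ts. PAtm t \<and> fvt t = {}) \<longrightarrow>
     (gc (substs (sbt B t x) xs ts) \<in> Tint M \<longleftrightarrow> sat M (upd M (e(x := cv M t)) xs ts) A)))"
    using main by blast
  also have "\<dots> \<longleftrightarrow> (\<forall>ts. length ts = length (x # xs) \<and> (\<forall>t\<in>set ts. PAtm t \<and> fvt t = {}) \<longrightarrow>
     (gc (substs B (x # xs) ts) \<in> Tint M \<longleftrightarrow> sat M (upd M e (x # xs) ts) A))" (is "?L \<longleftrightarrow> ?R")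
  proof
    assume L: ?L show ?R
    proof (intro allI impI)
      fix ts :: "tm list" assume h: "length ts = length (x # xs) \<and> (\<forall>t\<in>set ts. PAtm t \<and> fvt t = {})"
      then obtain t ts' where "ts = t # ts'" by (cases ts) auto
      then show "(gc (substs B (x # xs) ts) \<in> Tint M \<longleftrightarrow> sat M (upd M e (x # xs) ts) A)" using L h by simp
    qed
  next
    assume R: ?R show ?L
    proof (intro allI impI)
      fix t ts assume "PAtm t \<and> fvt t = {}" "length ts = length xs \<and> (\<forall>t\<in>set ts. PAtm t \<and> fvt t = {})"
      then show "(gc (substs (sbt B t x) xs ts) \<in> Tint M \<longleftrightarrow> sat M (upd M (e(x := cv M t)) xs ts) A)"
        using R[rule_format, of "t # ts"] by simp
    qed
  qed
  finally show ?case .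
qed

lemma finite_fvt [simp]: "finite (fvt t)" by (induction t) auto
lemma finite_fv [simp]: "finite (fv A)" by (induction A) auto

lemma sat_T_atom:
  "sat M e (T_atom A) \<longleftrightarrow> (\<forall>ts. length ts = card (fv A) \<and> (\<forall>t\<in>set ts. PAtm t \<and> fvt t = {}) \<longrightarrow>
     (gc (substs A (sorted_list_of_set (fv A)) ts) \<in> Tint M \<longleftrightarrow> sat M (upd M e (sorted_list_of_set (fv A)) ts) A))"
  unfolding T_atom_def Let_def
  by (subst sat_T_atom0[where B=A]) (auto simp: less_Suc_eq_le intro: Max_ge)

lemma fv_T_atom: "fv (T_atom_fm k c A xs) \<subseteq> fvt c \<union> (fv A - set xs)"
proof (induction xs arbitrary: k c)
  case (Cons x xs)
  show ?case using Cons[of "k+2" "Var (k+1)"] by (auto dest!: fvs)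
qed auto

lemma closed_T_atom: "sentence (T_atom A)"
  unfolding sentence_def T_atom_def Let_def using fv_T_atom[of _ "gq A" A "sorted_list_of_set (fv A)"] by auto

end

theory Submission
  imports Defs
begin

text \<open>Every revision stage \<open>f = \<Gamma>\<^sup>n(f\<^sub>0)\<close> assigns to each world a set of codes that is
  closed under modus ponens and contains the theorems of \<open>DCB\<close>: at stage \<open>0\<close> by assumption, and
  at stage \<open>n + 1\<close> because \<open>DCB\<close> holds in all structures of stage \<open>n\<close>, its reflection axiom
  asserting only that the sets of stage \<open>n\<close> contain \<open>DCB\<close>. From stage \<open>1\<close> on, these sets are complete
  theories of expansions of the standard model, which gives the compositional axioms of \<open>FS\<close> and
  \<open>UBF\<close>; at stage \<open>n + 1\<close> both \<open>K(\<alpha>, T\<phi>)\<close> and \<open>T(K(\<alpha>, \<phi>))\<close> say that \<open>\<phi>\<close> belongs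
  to the stage-\<open>n\<close> sets of all \<open>\<alpha>\<close>-accessible worlds. Each application of a rule delays the stage
  from which a theorem holds by at most one, so the bound exists for each derivation, hence for
  each finite set of theorems.\<close>

section \<open>Soundness of first-order logic and arithmetic\<close>

lemma val_subt: "val M e (subt s t x) = val M (e(x := val M e t)) s"
  by (induction s) auto

text \<open>If \<open>x\<close> is not free in the quantified formula, substitution and reassignment
  are both vacuous. Otherwise \<open>free_for\<close> keeps \<open>y\<close> out of \<open>t\<close>
  and \<open>x\<close> \<noteq> \<open>y\<close>, so the reassignments commute and \<open>t\<close>
  keeps its value.\<close>

lemma sat_sbt:
  "free_for t x A \<Longrightarrow> sat M e (sbt A t x) \<longleftrightarrow> sat M (e(x := val M e t)) A"
proof (induction A arbitrary: e)
  case (Forall y A)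
  show ?case
  proof (cases "x \<in> fv (\<^bold>\<forall>y. A)")
    case False
    then have "sat M (e(x := val M e t)) (\<^bold>\<forall>y. A) \<longleftrightarrow> sat M e (\<^bold>\<forall>y. A)"
      by (intro sat_agree) auto
    then show ?thesis using sbt_id[OF False] by (simp only:)
  next
    case True
    then have ne: "x \<noteq> y" and y: "y \<notin> fvt t" and free: "free_for t x A"
      using Forall.prems by auto
    have "val M (e(y := n)) t = val M e t" for n
      using y by (intro val_agree0) auto
    then have "sat M (e(y := n)) (sbt A t x) \<longleftrightarrow> sat M (e(x := val M e t, y := n)) A" for n
      unfolding fun_upd_twist[OF ne] Forall.IH[OF free] by simp
    then show ?thesis using ne by (simp del: fun_upd_apply)
  qed
next
  case (Exists y A)
  show ?case
  proof (cases "x \<in> fv (\<^bold>\<exists>y. A)")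
    case False
    then have "sat M (e(x := val M e t)) (\<^bold>\<exists>y. A) \<longleftrightarrow> sat M e (\<^bold>\<exists>y. A)"
      by (intro sat_agree) auto
    then show ?thesis using sbt_id[OF False] by (simp only:)
  next
    case True
    then have ne: "x \<noteq> y" and y: "y \<notin> fvt t" and free: "free_for t x A"
      using Exists.prems by auto
    have "val M (e(y := n)) t = val M e t" for n
      using y by (intro val_agree0) auto
    then have "sat M (e(y := n)) (sbt A t x) \<longleftrightarrow> sat M (e(x := val M e t, y := n)) A" for n
      unfolding fun_upd_twist[OF ne] Exists.IH[OF free] by simp
    then show ?thesis using ne by (simp del: fun_upd_apply)
  qed
qed (auto simp: val_subt)

lemma free_for_closed: "fvt t = {} \<Longrightarrow> free_for t x A"
  by (induction A) auto

text \<open>The term contains \<open>x\<close> itself, but below a quantifier on \<open>x\<close>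
  there is no free \<open>x\<close> left to replace.\<close>

lemma free_for_Succ_Var: "free_for (Succ (Var x)) x A"
  by (induction A) auto

section \<open>Validity of the axioms of logic and arithmetic\<close>

lemma sat_logical_schema: "logical_schema A \<Longrightarrow> sat M e A"
proof (induction arbitrary: e rule: logical_schema.induct)
  case (12 x A)
  then show ?case using sat_agree[of A "e(x := n)" e M for n] by auto
qed (auto simp: sat_sbt)

lemma models_generalizations: "M \<Turnstile> A \<Longrightarrow> B \<in> generalizations A \<Longrightarrow> M \<Turnstile> B"
proof -
  assume A: "M \<Turnstile> A" and "B \<in> generalizations A"
  then obtain xs where "B = foldr Forall xs A" by (auto simp: generalizations_def)
  moreover have "M \<Turnstile> foldr Forall xs A" for xs
    by (induction xs) (use A in \<open>auto simp: models_def\<close>)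
  ultimately show "M \<Turnstile> B" by simp
qed

lemma models_logical_axioms: "A \<in> logical_axioms \<Longrightarrow> M \<Turnstile> A"
proof -
  assume "A \<in> logical_axioms"
  then obtain B where "logical_schema B" and "A \<in> generalizations B"
    by (auto simp: logical_axioms_def)
  moreover from this have "M \<Turnstile> B" by (simp add: models_def sat_logical_schema)
  ultimately show "M \<Turnstile> A" by (blast intro: models_generalizations)
qed

text \<open>The domain is the standard one, so induction on \<open>nat\<close> applies to the set
  defined by any formula of the full language.\<close>

lemma models_induction_schema: "M \<Turnstile> induction_schema x A"
  unfolding models_def
proof
  fix e
  define P where "P = (\<lambda>n. sat M (e(x := n)) A)"
  have "sat M e (sbt A Zero x) \<longleftrightarrow> P 0"
    by (simp add: sat_sbt free_for_closed P_def)
  moreover have "sat M (e(x := n)) (sbt A (Succ (Var x)) x) \<longleftrightarrow> P (Suc n)" for n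
    by (subst sat_sbt[OF free_for_Succ_Var]) (simp add: P_def)
  moreover have "sat M (e(x := n)) A \<longleftrightarrow> P n" for n
    by (simp only: P_def)
  moreover have "P n" if "P 0" and "\<forall>n. P n \<longrightarrow> P (Suc n)" for n
    using that by (induction n) auto
  ultimately show "sat M e (induction_schema x A)"
    by (simp only: induction_schema_def sat.simps) blast
qed

lemma models_PA_axioms: "A \<in> PA_axioms \<Longrightarrow> M \<Turnstile> A"
  unfolding PA_axioms_def
  by (auto intro: models_generalizations models_induction_schema)
     (auto simp: models_def PA1_def PA2_def PA3_def PA4_def PA5_def PA6_def)

lemma models_thms:
  assumes "A \<in> thms Ax {}" and "\<And>B. B \<in> Ax \<Longrightarrow> M \<Turnstile> B"
  shows "M \<Turnstile> A"
  using assms(1)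
proof (induction rule: thms.induct)
  case (mp A B) then show ?case by (auto simp: models_def)
qed (auto intro: assms(2) models_logical_axioms)

lemma sentence_thms:
  assumes "A \<in> thms Ax {}" and "\<And>B. B \<in> Ax \<Longrightarrow> sentence B"
  shows "sentence A"
  using assms(1)
proof (induction rule: thms.induct)
  case (mp A B) then show ?case by (auto simp: sentence_def)
qed (auto simp: assms(2) logical_axioms_def)

lemma sentence_DCB: "A \<in> DCB \<Longrightarrow> sentence A"
  unfolding DCB_def
  by (erule sentence_thms) (auto simp: DCB_axioms_def closed closed_PA)

section \<open>The theory of a structure\<close>

text \<open>Revision makes the theory of one structure the extension of T in the next; stating the
  truth lemmas for \<open>Tint M = Th N\<close> frees them from frames.\<close>

definition Th :: "lstruct \<Rightarrow> nat set" where
  "Th M = {gc A | A. sentence A \<and> M \<Turnstile> A}"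

lemma sat_sentence: "sentence A \<Longrightarrow> sat M e A \<longleftrightarrow> M \<Turnstile> A"
  unfolding models_def by (metis empty_iff sat_agree sentence_def)

lemma gc_in_Th: "sentence A \<Longrightarrow> gc A \<in> Th M \<longleftrightarrow> sat M e A"
  by (auto simp: Th_def sat_sentence)

section \<open>Iterated substitution of closed terms\<close>

lemma fvt_subt: "fvt t = {} \<Longrightarrow> fvt (subt s t x) = fvt s - {x}"
  by (induction s) auto

lemma fv_sbt: "fvt t = {} \<Longrightarrow> fv (sbt A t x) = fv A - {x}"
  by (induction A) (auto simp: fvt_subt)

lemma fv_substs:
  "length ts = length xs \<Longrightarrow> \<forall>t\<in>set ts. fvt t = {} \<Longrightarrow> fv (substs A xs ts) = fv A - set xs"
proof (induction xs arbitrary: A ts)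
  case (Cons x xs)
  then obtain t ts' where "ts = t # ts'" by (cases ts) auto
  then show ?case using Cons by (auto simp: fv_sbt)
qed simp

lemma val_closed: "fvt t = {} \<Longrightarrow> val M e t = cv M t"
  unfolding cv_def by (rule val_agree0) simp

lemma upd_fun_upd: "x \<notin> set xs \<Longrightarrow> upd M (e(x := c)) xs ts = (upd M e xs ts)(x := c)"
proof (induction xs arbitrary: e ts)
  case (Cons y xs)
  then show ?case using fun_upd_twist[of x y e] by (simp del: fun_upd_apply)
qed simp

text \<open>Closed terms cannot be captured. \<open>sat_sbt\<close> assigns the first variable last,
  \<open>upd\<close> assigns it first; distinctness makes the order irrelevant.\<close>

lemma sat_substs:
  "distinct xs \<Longrightarrow> length ts = length xs \<Longrightarrow> \<forall>t\<in>set ts. fvt t = {} \<Longrightarrow>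
    sat M e (substs A xs ts) \<longleftrightarrow> sat M (upd M e xs ts) A"
proof (induction xs arbitrary: A ts)
  case (Cons x xs)
  then obtain t ts' where ts: "ts = t # ts'" by (cases ts) auto
  then have "sat M e (substs A (x # xs) ts) \<longleftrightarrow> sat M (upd M e xs ts') (sbt A t x)"
    using Cons by simp
  also have "\<dots> \<longleftrightarrow> sat M ((upd M e xs ts')(x := cv M t)) A"
    using Cons.prems ts sat_sbt[OF free_for_closed, of t] val_closed[of t] by simp
  finally show ?case using Cons.prems ts by (simp add: upd_fun_upd del: fun_upd_apply)
qed simp

section \<open>Truth axioms of \<open>FS\<close>\<close>

text \<open>Consecutive stages at one world differ only in K and T. The atomic truth axioms compare
  an atom in both, so they need agreement on the remaining symbols.\<close>

definition same_Lminus_reduct :: "lstruct \<Rightarrow> lstruct \<Rightarrow> bool" where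
  "same_Lminus_reduct M N \<longleftrightarrow> Uint M = Uint N \<and> uint M = uint N \<and> Agint M = Agint N"

lemma val_reduct: "same_Lminus_reduct M N \<Longrightarrow> val M e t = val N e t"
  by (induction t) (auto simp: same_Lminus_reduct_def)

lemma upd_reduct: "same_Lminus_reduct M N \<Longrightarrow> upd M e xs ts = upd N e xs ts"
  by (induction xs arbitrary: e ts) (simp_all add: cv_def val_reduct)

lemma sat_Lminus_atom_reduct:
  "same_Lminus_reduct M N \<Longrightarrow> Lminus_atom A \<Longrightarrow> sat M e A \<longleftrightarrow> sat N e A"
  using val_reduct[of M N e] by (cases A) (auto simp: same_Lminus_reduct_def)

lemma models_T_atom:
  assumes T: "Tint M = Th N" and red: "same_Lminus_reduct M N" and A: "Lminus_atom A"
  shows "M \<Turnstile> T_atom A"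
proof -
  let ?xs = "sorted_list_of_set (fv A)"
  have "gc (substs A ?xs ts) \<in> Tint M \<longleftrightarrow> sat M (upd M e ?xs ts) A"
    if ts: "length ts = card (fv A)" "\<forall>t\<in>set ts. PAtm t \<and> fvt t = {}" for e ts
  proof -
    have "sentence (substs A ?xs ts)"
      using ts by (simp add: sentence_def fv_substs)
    then have "gc (substs A ?xs ts) \<in> Tint M \<longleftrightarrow> sat N e (substs A ?xs ts)"
      unfolding T by (rule gc_in_Th)
    also have "\<dots> \<longleftrightarrow> sat N (upd N e ?xs ts) A"
      using ts by (intro sat_substs) auto
    finally show ?thesis by (simp add: sat_Lminus_atom_reduct[OF red A] upd_reduct[OF red])
  qed
  then show ?thesis unfolding models_def sat_T_atom by blast
qed

text \<open>Numerals name every element of the standard model and every closed term has a value, so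
  instances amount to quantification over the domain. Numerals are arithmetical, hence the second
  form, which serves \<open>UBF\<close>.\<close>

lemma Th_quantifiers:
  assumes "fv A \<subseteq> {i}"
  shows "gc (\<^bold>\<forall>i. A) \<in> Th M \<longleftrightarrow> (\<forall>t. fvt t = {} \<longrightarrow> gc (sbt A t i) \<in> Th M)"
    and "gc (\<^bold>\<forall>i. A) \<in> Th M \<longleftrightarrow> (\<forall>t. PAtm t \<and> fvt t = {} \<longrightarrow> gc (sbt A t i) \<in> Th M)"
    and "gc (\<^bold>\<exists>i. A) \<in> Th M \<longleftrightarrow> (\<exists>t. fvt t = {} \<and> gc (sbt A t i) \<in> Th M)"
proof -
  define e where "e = (\<lambda>_::nat. 0::nat)"
  have sbt: "gc (sbt A t i) \<in> Th M \<longleftrightarrow> sat M (e(i := cv M t)) A" if "fvt t = {}" for t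
    using that assms gc_in_Th[of "sbt A t i" M e] sat_sbt[OF free_for_closed, of t]
      val_closed[of t]
    by (simp add: sentence_def fv_sbt)
  have num: "fvt (num n) = {}" "PAtm (num n)" "cv M (num n) = n" for n
    by (induction n) (simp_all add: cv_def)
  have "sentence (\<^bold>\<forall>i. A)" "sentence (\<^bold>\<exists>i. A)" using assms by (auto simp: sentence_def)
  note quant = this[THEN gc_in_Th[where e = e], unfolded sat.simps]
  show "gc (\<^bold>\<forall>i. A) \<in> Th M \<longleftrightarrow> (\<forall>t. fvt t = {} \<longrightarrow> gc (sbt A t i) \<in> Th M)"
    unfolding quant by (metis sbt num(1,3))
  show "gc (\<^bold>\<forall>i. A) \<in> Th M \<longleftrightarrow> (\<forall>t. PAtm t \<and> fvt t = {} \<longrightarrow> gc (sbt A t i) \<in> Th M)"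
    unfolding quant by (metis sbt num)
  show "gc (\<^bold>\<exists>i. A) \<in> Th M \<longleftrightarrow> (\<exists>t. fvt t = {} \<and> gc (sbt A t i) \<in> Th M)"
    unfolding quant by (metis sbt num(1,3))
qed

lemma Th_Neg: "sentence A \<Longrightarrow> gc (\<^bold>\<not> A) \<in> Th M \<longleftrightarrow> gc A \<notin> Th M"
  using gc_in_Th[of "\<^bold>\<not> A" M "\<lambda>_. 0"] gc_in_Th[of A M "\<lambda>_. 0"] by (simp add: sentence_def)

lemma Th_binary:
  assumes "sentence A" "sentence B"
  shows "gc (A \<^bold>\<rightarrow> B) \<in> Th M \<longleftrightarrow> (gc A \<in> Th M \<longrightarrow> gc B \<in> Th M)"
    and "gc (A \<^bold>\<and> B) \<in> Th M \<longleftrightarrow> gc A \<in> Th M \<and> gc B \<in> Th M"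
    and "gc (A \<^bold>\<or> B) \<in> Th M \<longleftrightarrow> gc A \<in> Th M \<or> gc B \<in> Th M"
proof -
  have "sentence (A \<^bold>\<rightarrow> B)" "sentence (A \<^bold>\<and> B)" "sentence (A \<^bold>\<or> B)"
    using assms by (auto simp: sentence_def)
  note th = this[THEN gc_in_Th, of M "\<lambda>_. 0"] assms[THEN gc_in_Th, of M "\<lambda>_. 0"]
  show "gc (A \<^bold>\<rightarrow> B) \<in> Th M \<longleftrightarrow> (gc A \<in> Th M \<longrightarrow> gc B \<in> Th M)"
    and "gc (A \<^bold>\<and> B) \<in> Th M \<longleftrightarrow> gc A \<in> Th M \<and> gc B \<in> Th M"
    and "gc (A \<^bold>\<or> B) \<in> Th M \<longleftrightarrow> gc A \<in> Th M \<or> gc B \<in> Th M"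
    unfolding th by simp_all
qed

lemma models_T_neg: "Tint M = Th N \<Longrightarrow> M \<Turnstile> T_neg"
  unfolding models_def T_neg_def
  by (clarsimp simp flip: gc.simps) (auto simp: Th_Neg)

lemma models_T_bin:
  assumes T: "Tint M = Th N"
  shows "M \<Turnstile> T_bin imp_tm Imp" "M \<Turnstile> T_bin and_tm And" "M \<Turnstile> T_bin or_tm Or"
  unfolding models_def T_bin_def
  by (clarsimp simp: T simp flip: gc.simps; auto simp: Th_binary)+

lemma ex_gct: "(\<exists>n. (\<exists>t. P t \<and> n = gct t) \<and> Q n) \<longleftrightarrow> (\<exists>t. P t \<and> Q (gct t))"
  by auto

lemma models_T_all_ex:
  assumes T: "Tint M = Th N"
  shows "M \<Turnstile> T_all" and "M \<Turnstile> T_ex"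
proof -
  have s: "(\<exists>n. sat M (e(0 := gct (Var i), 1 := gc A, 2 := gct t, 3 := n))
      (Sbt_fm 4 v1 v2 v0 v3 \<^bold>\<and> PT v3)) \<longleftrightarrow> gc (sbt A t i) \<in> Th N" for e i A t
  proof -
    have "sat M (e(0 := gct (Var i), 1 := gc A, 2 := gct t, 3 := n)) (Sbt_fm 4 v1 v2 v0 v3)
        \<longleftrightarrow> n = gc (sbt A t i)" for n
      by (subst sat_Sbt_f) auto
    then show ?thesis using T by (simp del: One_nat_def)
  qed
  have L: "sat M (e(0 := gct (Var i), 1 := a)) (L1_fm 2 v0 v1) \<longleftrightarrow> (\<exists>A. fv A = {i} \<and> a = gc A)"
    for e i a by (subst sat_L1) auto
  let ?e = "\<lambda>e i A. e(0 := gct (Var i), 1 := gc A)"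
  have "sat M (?e e i A) (\<^bold>\<forall>2. TermL0_fm 3 v2 \<^bold>\<rightarrow> (\<^bold>\<exists>3. Sbt_fm 4 v1 v2 v0 v3 \<^bold>\<and> PT v3))
      \<longleftrightarrow> (\<forall>t. fvt t = {} \<longrightarrow> gc (sbt A t i) \<in> Th N)"
    "sat M (?e e i A) (\<^bold>\<exists>2. TermL0_fm 3 v2 \<^bold>\<and> (\<^bold>\<exists>3. Sbt_fm 4 v1 v2 v0 v3 \<^bold>\<and> PT v3))
      \<longleftrightarrow> (\<exists>t. fvt t = {} \<and> gc (sbt A t i) \<in> Th N)" for e i A
  proof -
    have "sat M (e(2 := n)) (TermL0_fm 3 v2) \<longleftrightarrow> (\<exists>t. fvt t = {} \<and> n = gct t)" for e n
      by simp
    then show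
      "sat M (?e e i A) (\<^bold>\<forall>2. TermL0_fm 3 v2 \<^bold>\<rightarrow> (\<^bold>\<exists>3. Sbt_fm 4 v1 v2 v0 v3 \<^bold>\<and> PT v3))
        \<longleftrightarrow> (\<forall>t. fvt t = {} \<longrightarrow> gc (sbt A t i) \<in> Th N)"
      "sat M (?e e i A) (\<^bold>\<exists>2. TermL0_fm 3 v2 \<^bold>\<and> (\<^bold>\<exists>3. Sbt_fm 4 v1 v2 v0 v3 \<^bold>\<and> PT v3))
        \<longleftrightarrow> (\<exists>t. fvt t = {} \<and> gc (sbt A t i) \<in> Th N)"
      unfolding sat.simps(8,11,12) sat.simps(9)[of _ _ "TermL0_fm 3 v2"]
      by (simp_all only: all_code ex_gct s)
  qed
  then have "sat M (?e e i A) (PT (all_tm v0 v1) \<^bold>\<leftrightarrow>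
        (\<^bold>\<forall>2. TermL0_fm 3 v2 \<^bold>\<rightarrow> (\<^bold>\<exists>3. Sbt_fm 4 v1 v2 v0 v3 \<^bold>\<and> PT v3)))"
    "sat M (?e e i A) (PT (ex_tm v0 v1) \<^bold>\<leftrightarrow>
        (\<^bold>\<exists>2. TermL0_fm 3 v2 \<^bold>\<and> (\<^bold>\<exists>3. Sbt_fm 4 v1 v2 v0 v3 \<^bold>\<and> PT v3)))"
    if "fv A = {i}" for e i A
    using that T by (simp_all add: Th_quantifiers del: sat.simps(11,12) One_nat_def flip: gc.simps)
  then show "M \<Turnstile> T_all" "M \<Turnstile> T_ex"
    unfolding models_def T_all_def T_ex_def
    by (auto simp: L simp del: sat.simps(9) One_nat_def)
qed

lemma models_FS_axioms:
  assumes "Tint M = Th N" "same_Lminus_reduct M N" "A \<in> FS_axioms"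
  shows "M \<Turnstile> A"
  using assms(3) unfolding FS_axioms_def
  by (auto intro: models_PA_axioms models_T_atom[OF assms(1,2)] models_T_neg[OF assms(1)]
      models_T_bin[OF assms(1)] models_T_all_ex[OF assms(1)])

section \<open>Stages of the revision sequence\<close>

lemma expand_simps [simp]:
  "Uint (expand G R f w) = Uint w" "uint (expand G R f w) = uint w" "Agint (expand G R f w) = G"
  "Tint (expand G R f w) = f w"
  "n \<in> K1int (expand G R f w) \<longleftrightarrow> (\<forall>\<alpha>\<in>G. (\<alpha>, n) \<in> K2int (expand G R f w))"
  "(\<alpha>, n) \<in> K2int (expand G R f w) \<longleftrightarrow> \<alpha> \<in> G \<and> (\<forall>v. (w, v) \<in> R \<alpha> \<longrightarrow> n \<in> f v)"
  by (auto simp: expand_def f_K_def f_ag_def)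

lemma Gam_eq_Th: "Gam G R f w = Th (expand G R f w)"
  by (simp add: Gam_def Th_def)

text \<open>The invariant: containing \<open>DCB\<close> is what \<open>R_DCB\<close> asks of the
  sets at accessible worlds, closure under modus ponens what \<open>UKK\<close> asks.\<close>

definition adequate_at :: "(world \<Rightarrow> nat set) \<Rightarrow> world \<Rightarrow> bool" where
  "adequate_at f w \<longleftrightarrow> gc ` DCB \<subseteq> f w \<and>
    (\<forall>A B. gc (A \<^bold>\<rightarrow> B) \<in> f w \<longrightarrow> gc A \<in> f w \<longrightarrow> gc B \<in> f w)"

lemma adequate_at_system:
  assumes "L_system S" "DCB \<subseteq> S" "f w = {gc A | A. A \<in> S}"
  shows "adequate_at f w"
  using assms unfolding adequate_at_def L_system_def by auto

lemma models_DCB_axioms: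
  assumes "G \<noteq> {}" and frame: "agency_frame G W R" and ad: "\<forall>v\<in>W. adequate_at f v"
    and A: "A \<in> DCB_axioms"
  shows "expand G R f w \<Turnstile> A"
proof -
  have acc: "adequate_at f v" if "(w, v) \<in> R \<alpha>" "\<alpha> \<in> G" for v \<alpha>
    using that frame ad by (auto simp: agency_frame_def)
  have "expand G R f w \<Turnstile> NonTriv"
    using \<open>G \<noteq> {}\<close> by (auto simp: models_def NonTriv_def)
  moreover have "expand G R f w \<Turnstile> K1K2"
    by (auto simp: models_def K1K2_def)
  moreover have "expand G R f w \<Turnstile> UKK"
    using acc by (auto simp: models_def UKK_def adequate_at_def simp flip: gc.simps)
  \<comment> \<open>By \<open>sat_PrDCB\<close> the provability predicate means membership in
    \<open>DCB\<close>, so the self-referential axiom only asserts that \<open>f\<close> contains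
    \<open>DCB\<close> at accessible worlds.\<close>
  moreover have "expand G R f w \<Turnstile> R_DCB"
    using acc by (auto simp: models_def R_DCB_def R_schema_def sat_PrDCB adequate_at_def)
  ultimately show ?thesis
    using A by (auto simp: DCB_axioms_def models_PA_axioms)
qed

lemma adequate_at_Gam:
  assumes "G \<noteq> {}" "agency_frame G W R" "\<forall>v\<in>W. adequate_at f v"
  shows "adequate_at (Gam G R f) w"
proof -
  have "expand G R f w \<Turnstile> A" if "A \<in> DCB" for A
    using that models_DCB_axioms[OF assms] unfolding DCB_def by (rule models_thms)
  then show ?thesis
    by (auto simp: adequate_at_def Gam_def sentence_DCB) (auto simp: models_def sentence_def)
qed

lemma adequate_at_funpow_Gam:
  assumes "G \<noteq> {}" "agency_frame G W R" "\<forall>v\<in>W. adequate_at f v"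
  shows "\<forall>v\<in>W. adequate_at ((Gam G R ^^ n) f) v"
  by (induction n) (simp_all add: assms adequate_at_Gam[OF assms(1,2)])

section \<open>Veracity and the supplementary axioms\<close>

text \<open>By reflexivity \<open>w\<close> is among its own accessible worlds, and T at
  \<open>w\<close> is \<open>f w\<close>.\<close>

lemma models_Ax_V:
  assumes "\<forall>\<alpha>\<in>G. refl_on W (R \<alpha>)" "w \<in> W"
  shows "expand G R f w \<Turnstile> Ax_V"
  using assms by (auto simp: models_def Ax_V_def refl_on_def)

text \<open>After one application of \<open>Gam\<close> the sets are theories of standard
  structures, each closed under the omega rule over closed arithmetical terms; the quantifiers over
  terms and over accessible worlds commute.\<close>

lemma models_UBF: "expand G R (Gam G R f) w \<Turnstile> UBF"
proof -
  let ?M = "expand G R (Gam G R f) w"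
  let ?e = "\<lambda>e \<alpha> i A. e(0 := \<alpha>, 1 := gct (Var i), 2 := gc A)"
  have L: "sat ?M (e(0 := \<alpha>, 1 := gct (Var i), 2 := a)) (L1_fm 3 v1 v2)
      \<longleftrightarrow> (\<exists>A. fv A = {i} \<and> a = gc A)" for e \<alpha> i a
    by (subst sat_L1) auto
  have "sat ?M (?e e \<alpha> i A) (PK2 v0 (all_tm v1 v2))"
    if \<alpha>: "\<alpha> \<in> G" and A: "fv A = {i}"
      and inst: "sat ?M (?e e \<alpha> i A)
        (\<^bold>\<forall>3. TermPA0_fm 4 v3 \<^bold>\<rightarrow> (\<^bold>\<exists>4. Sbt_fm 5 v2 v3 v1 (Var 4) \<^bold>\<and> PK2 v0 (Var 4)))"
    for e \<alpha> i A
  proof -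
    have "gc (sbt A t i) \<in> Gam G R f v"
      if t: "PAtm t \<and> fvt t = {}" and v: "(w, v) \<in> R \<alpha>" for t v
    proof -
      have "sat ?M ((?e e \<alpha> i A)(3 := gct t)) (TermPA0_fm 4 v3)" using t by auto
      then obtain n where
        n: "sat ?M ((?e e \<alpha> i A)(3 := gct t, 4 := n)) (Sbt_fm 5 v2 v3 v1 (Var 4) \<^bold>\<and> PK2 v0 (Var 4))"
        using inst unfolding sat.simps(8,11,12) by blast
      have "sat ?M ((?e e \<alpha> i A)(3 := gct t, 4 := n)) (Sbt_fm 5 v2 v3 v1 (Var 4))
          \<longleftrightarrow> n = gc (sbt A t i)"
        by (subst sat_Sbt_f) auto
      then show ?thesis using n v by auto
    qed
    then have "gc (\<^bold>\<forall>i. A) \<in> Gam G R f v" if "(w, v) \<in> R \<alpha>" for v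
      using that A unfolding Gam_eq_Th by (simp add: Th_quantifiers(2))
    then show ?thesis using \<alpha> by (simp add: gc.simps)
  qed
  then show ?thesis
    unfolding models_def UBF_def
    by (auto simp: L simp del: sat.simps(5,9) One_nat_def)
qed

text \<open>One revision step strips one T or K. Codes are left as pairs, the form to which
  \<open>val_tms\<close> evaluates the terms in the axioms.\<close>

lemma gc_atoms_in_Gam:
  "npair 11 (gct (gq A)) \<in> Gam G R f w \<longleftrightarrow> gc A \<in> f w"
  "\<alpha> \<in> G \<Longrightarrow> npair 10 (npair (gct (num \<alpha>)) (gct (gq A))) \<in> Gam G R f w \<longleftrightarrow>
    (\<forall>v. (w, v) \<in> R \<alpha> \<longrightarrow> gc A \<in> f v)"
  "\<alpha> \<in> G \<Longrightarrow> npair 12 (npair 10 (npair (gct (num \<alpha>)) (gct (gq A)))) \<in> Gam G R f w \<longleftrightarrow>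
    \<not> (\<forall>v. (w, v) \<in> R \<alpha> \<longrightarrow> gc A \<in> f v)"
  unfolding Gam_eq_Th gc.simps[symmetric]
  by (subst gc_in_Th; simp add: sentence_def)+

lemma models_IA: "expand G R (Gam G R f) w \<Turnstile> IA"
  by (auto simp: models_def IA_def gc_atoms_in_Gam simp flip: gq_def)

text \<open>The antecedent speaks of worlds one step from \<open>w\<close>, the consequent of worlds
  two steps away; transitivity reduces two steps to one.\<close>

lemma models_In_plus:
  assumes "\<forall>\<alpha>\<in>G. trans (R \<alpha>)"
  shows "expand G R (Gam G R f) w \<Turnstile> In_plus"
  using assms
  by (auto simp: models_def In_plus_def gc_atoms_in_Gam trans_def simp flip: gq_def)

text \<open>Some accessible \<open>v\<close> omits the code from \<open>f v\<close>; by the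
  Euclidean property every accessible world sees this \<open>v\<close>.\<close>

lemma models_In_minus:
  assumes "\<forall>\<alpha>\<in>G. Euclidean (R \<alpha>)"
  shows "expand G R (Gam G R f) w \<Turnstile> In_minus"
  unfolding models_def In_minus_def
  by (clarsimp simp: gc_atoms_in_Gam simp flip: gq_def) (use assms in \<open>unfold Euclidean_def, blast\<close>)

lemma models_FS_axioms_Gam: "A \<in> FS_axioms \<Longrightarrow> expand G R (Gam G R f) w \<Turnstile> A"
  by (rule models_FS_axioms[where N = "expand G R f w"])
     (simp_all add: Gam_eq_Th same_Lminus_reduct_def)

section \<open>From axioms to theorems\<close>

text \<open>Induction on the derivation, with one bound for all worlds because \<open>NEC_K\<close>
  needs its premise at every accessible world. \<open>X\<close> stays abstract so that the three
  parts share the argument.\<close>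

lemma KT_plus_eventually_holds:
  assumes ne: "G \<noteq> {}" and frame: "agency_frame G W R"
    and ad: "\<forall>v\<in>W. adequate_at f v" and refl: "\<forall>\<alpha>\<in>G. refl_on W (R \<alpha>)"
    and X: "\<And>B h w. B \<in> X \<Longrightarrow> expand G R (Gam G R h) w \<Turnstile> B"
    and A: "A \<in> KT_plus X"
  shows "\<exists>m. \<forall>n\<ge>m. \<forall>w\<in>W. expand G R ((Gam G R ^^ n) f) w \<Turnstile> A"
  using A unfolding KT_plus_def
proof (induction rule: thms.induct)
  case (logic A)
  then show ?case by (simp add: models_logical_axioms)
next
  case (axiom A)
  \<comment> \<open>The truth axioms and \<open>X\<close> are available for evaluations in the range
    of \<open>Gam\<close>, that is from stage 1 on.\<close>
  have "expand G R ((Gam G R ^^ Suc n) f) w \<Turnstile> A" if "w \<in> W" for n w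
    using axiom models_DCB_axioms[OF ne frame adequate_at_funpow_Gam[OF ne frame ad, of "Suc n"]]
      models_Ax_V[OF refl that] models_FS_axioms_Gam X
    by (auto simp: KT_axioms_def)
  then show ?case by (metis Suc_le_D)
next
  case (mp A B)
  then obtain k l where "\<forall>n\<ge>k. \<forall>w\<in>W. expand G R ((Gam G R ^^ n) f) w \<Turnstile> (A \<^bold>\<rightarrow> B)"
    and "\<forall>n\<ge>l. \<forall>w\<in>W. expand G R ((Gam G R ^^ n) f) w \<Turnstile> A" by blast
  then show ?case by (intro exI[of _ "max k l"]) (simp add: models_def)
next
  case (rule A B)
  then obtain m where m: "\<And>n w. m \<le> n \<Longrightarrow> w \<in> W \<Longrightarrow> expand G R ((Gam G R ^^ n) f) w \<Turnstile> A"
    by blast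
  consider "sentence A" "B = PT (gq A)" | "sentence B" "A = PT (gq B)"
    | "sentence A" "B = (\<^bold>\<forall>0. PAg v0 \<^bold>\<rightarrow> PK2 v0 (gq A))"
    using rule.hyps by (auto simp: KT_rules_def FS_rules_def NEC_T_def CONEC_T_def NEC_K_def)
  then show ?case
  proof cases
    case 1
    \<comment> \<open>Truth of \<open>A\<close> at stage \<open>n\<close> puts its code into T at
      stage \<open>n + 1\<close>, so the bound grows by one.\<close>
    then have "expand G R ((Gam G R ^^ Suc n) f) w \<Turnstile> B" if "m \<le> n" "w \<in> W" for n w
      using m[OF that] by (auto simp: models_def[of _ "PT _"] Gam_def)
    then show ?thesis by (metis Suc_le_D Suc_le_mono)
  next
    case 2
    \<comment> \<open>The converse reading, with the premise taken at stage \<open>n + 1\<close>;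
      the bound stays \<open>m\<close>.\<close>
    then have "expand G R ((Gam G R ^^ n) f) w \<Turnstile> B" if "m \<le> n" "w \<in> W" for n w
      using m[of "Suc n" w] that by (auto simp: models_def[of _ "PT _"] Gam_def)
    then show ?thesis by blast
  next
    case 3
    \<comment> \<open>Accessible worlds lie in \<open>W\<close>, so \<open>A\<close> holds at all of
      them at stage \<open>n\<close>.\<close>
    have "expand G R ((Gam G R ^^ Suc n) f) w \<Turnstile> B" if "m \<le> n" "w \<in> W" for n w
      using m[OF that(1)] 3 frame
      by (auto simp: models_def[of _ "\<^bold>\<forall>0. _"] agency_frame_def Gam_def)
    then show ?thesis by (metis Suc_le_D Suc_le_mono)
  qed
qed

lemma uniform_bound_finite:
  assumes "finite \<Phi>" "\<And>A. A \<in> \<Phi> \<Longrightarrow> \<exists>m::nat. \<forall>n\<ge>m. \<forall>w\<in>W. P n w A"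
  shows "\<exists>m. \<forall>n\<ge>m. \<forall>w\<in>W. \<forall>A\<in>\<Phi>. P n w A"
proof -
  \<comment> \<open>One bound is chosen per member, then the maximum; for empty \<Phi> the
    unspecified \<open>Max\<close> bounds nothing and is harmless.\<close>
  obtain m where "\<And>A. A \<in> \<Phi> \<Longrightarrow> \<forall>n\<ge>m A. \<forall>w\<in>W. P n w A" using assms(2) by metis
  moreover have "m A \<le> Max (m ` \<Phi>)" if "A \<in> \<Phi>" for A
    using assms(1) that by simp
  ultimately show ?thesis by (meson order_trans)
qed

theorem theorem14:
  fixes G :: "nat set" and W :: "world set" and R :: "nat \<Rightarrow> (world \<times> world) set"
    and f :: "world \<Rightarrow> nat set"
  assumes "G \<noteq> {}"
    and "agency_frame G W R"
    and "\<forall>w\<in>W. \<exists>S. L_system S \<and> DCB \<subseteq> S \<and> f w = {gc A | A. A \<in> S}"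
  shows "((\<forall>\<alpha>\<in>G. refl_on W (R \<alpha>)) \<longrightarrow>
            (\<forall>\<Phi>. finite \<Phi> \<and> \<Phi> \<subseteq> KT_plus {UBF, IA} \<longrightarrow>
              (\<exists>m. \<forall>n\<ge>m. \<forall>w\<in>W. \<forall>A\<in>\<Phi>. expand G R ((Gam G R ^^ n) f) w \<Turnstile> A))) \<and>
         ((\<forall>\<alpha>\<in>G. refl_on W (R \<alpha>) \<and> trans (R \<alpha>)) \<longrightarrow>
            (\<forall>\<Phi>. finite \<Phi> \<and> \<Phi> \<subseteq> KT_plus {UBF, IA, In_plus} \<longrightarrow>
              (\<exists>m. \<forall>n\<ge>m. \<forall>w\<in>W. \<forall>A\<in>\<Phi>. expand G R ((Gam G R ^^ n) f) w \<Turnstile> A))) \<and>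
         ((\<forall>\<alpha>\<in>G. refl_on W (R \<alpha>) \<and> trans (R \<alpha>) \<and> Euclidean (R \<alpha>)) \<longrightarrow>
            (\<forall>\<Phi>. finite \<Phi> \<and> \<Phi> \<subseteq> KT_plus {UBF, IA, In_plus, In_minus} \<longrightarrow>
              (\<exists>m. \<forall>n\<ge>m. \<forall>w\<in>W. \<forall>A\<in>\<Phi>. expand G R ((Gam G R ^^ n) f) w \<Turnstile> A)))"
proof -
  have ad: "\<forall>v\<in>W. adequate_at f v"
    using assms(3) adequate_at_system by blast
  \<comment> \<open>\<open>X\<close> becomes each set of supplementary axioms in turn; reflexivity
    serves \<open>KT\<close> itself, the other frame conditions validate \<open>In_plus\<close> and
    \<open>In_minus\<close>.\<close>
  have bound: "\<exists>m. \<forall>n\<ge>m. \<forall>w\<in>W. \<forall>A\<in>\<Phi>. expand G R ((Gam G R ^^ n) f) w \<Turnstile> A"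
    if "finite \<Phi> \<and> \<Phi> \<subseteq> KT_plus X" "\<forall>\<alpha>\<in>G. refl_on W (R \<alpha>)"
      "\<And>B h w. B \<in> X \<Longrightarrow> expand G R (Gam G R h) w \<Turnstile> B" for X \<Phi>
    using that(1) KT_plus_eventually_holds[OF assms(1,2) ad that(2,3)]
    by (intro uniform_bound_finite) auto
  show ?thesis
    by (intro conjI impI allI; erule bound)
       (auto intro: models_UBF models_IA models_In_plus models_In_minus)
qed

end
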